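(* Let $p=p(k)$ satisfy $k^{-3/2}\ll p\le 10\frac{\ln k}{k}$ as $k\to\infty$ (i.e. $pk^{3/2}\to\infty$). Set $\lambda=(k-1)\frac{p}{1-(1-p)^k}$ and $\lambda^{R}=(k-1)\frac{p(1-p)^{k-1}}{1-(1-p)^k}$. Let $\mathrm{ESC}$ be the event that the leftwalk with i.i.d. steps $Z_i\sim\mathrm{Po}(\lambda)$ satisfies $Y_i>0$ for all $i\ge1$, and let $\mathrm{ESC}^R$ be the event that the rightwalk with i.i.d. steps $Z_i^R\sim\mathrm{Po}(\lambda^R)$ satisfies $Y^R_i>0$ for all $i\ge 1$. Then, as $k\to\infty$, $$\Pr[\mathrm{TREE}]\sim \Pr[\mathrm{ESC}]\,\Pr[\mathrm{ESC}^{R}].$$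
   Context: Tilted balls-into-bins model with tilt $p$ (for an integer $k\ge2$): $k-1$ balls are placed independently, each into bin $T\in\{1,\dots,k\}$ with $\Pr[T=i]=\frac{p(1-p)^{i-1}}{1-(1-p)^k}$. Let $Z_i$ be the number of balls in bin $i$, $Y_0=1$, $Y_i=Y_{i-1}+Z_i-1$; $\mathrm{TREE}$ is the event $Y_t>0$ for $1\le t\le k-1$. Leftwalk: given nonnegative integers $Z_1,Z_2,\dots$, $Y_0=1$, $Y_i=Y_{i-1}+Z_i-1$. Rightwalk: given nonnegative integers $Z_1^R,Z_2^R,\dots$, $Y^R_0=0$, $Y^R_i=Y^R_{i-1}+1-Z^R_i$. *)

theory Defs
  imports "HOL-Probability.Probability" "HOL-Library.Landau_Symbols"
begin

definition tilted_bin_pmf :: "real \<Rightarrow> nat \<Rightarrow> nat pmf" where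
  "tilted_bin_pmf p k =
     embed_pmf (\<lambda>i. if i \<in> {1..k} then p * (1 - p) ^ (i - 1) / (1 - (1 - p) ^ k) else 0)"

text \<open>The weights form a probability mass function when \<open>0 < p < 1\<close> and \<open>k \<ge> 1\<close>; otherwise
  \<^const>\<open>tilted_bin_pmf\<close> may be unspecified.\<close>

lemma pmf_tilted_bin:
  assumes "0 < p" "p < 1" "1 \<le> k"
  shows "pmf (tilted_bin_pmf p k) i =
    (if i \<in> {1..k} then p * (1 - p) ^ (i - 1) / (1 - (1 - p) ^ k) else 0)"
  unfolding tilted_bin_pmf_def
proof (rule pmf_embed_pmf)
  let ?f = "\<lambda>i. if i \<in> {1..k} then p * (1 - p) ^ (i - 1) / (1 - (1 - p) ^ k) else 0"
  have lt: "(1 - p) ^ k < 1"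
    using assms by (simp add: power_less_one_iff)
  show nonneg: "0 \<le> ?f x" for x
    using assms lt by simp
  have "(\<Sum>i=1..k. p * (1 - p) ^ (i - 1)) = p * (\<Sum>i<k. (1 - p) ^ i)"
    unfolding sum_distrib_left
    by (rule sum.reindex_bij_witness[where i = Suc and j = "\<lambda>i. i - 1"]) auto
  also have "\<dots> = 1 - (1 - p) ^ k"
    using assms by (simp add: one_diff_power_eq)
  finally have s: "(\<Sum>i=1..k. p * (1 - p) ^ (i - 1)) = 1 - (1 - p) ^ k" .
  have "(\<integral>\<^sup>+ x. ennreal (?f x) \<partial>count_space UNIV) = (\<Sum>x\<in>{1..k}. ennreal (?f x))"
    by (rule nn_integral_count_space'[where A = "{1..k}"]) auto
  also have "\<dots> = ennreal (\<Sum>x\<in>{1..k}. ?f x)"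
    by (rule sum_ennreal) (rule nonneg)
  also have "(\<Sum>x\<in>{1..k}. ?f x) = 1"
    using s lt by (simp flip: sum_divide_distrib)
  finally show "(\<integral>\<^sup>+ x. ennreal (?f x) \<partial>count_space UNIV) = 1" by simp
qed

text \<open>A placement \<open>T\<close> sends ball \<open>j < k - 1\<close> to bin \<open>T j\<close>; the value \<open>0\<close> is only the
  default of \<^const>\<open>Pi_pmf\<close> outside the index set.\<close>

definition placement_pmf :: "real \<Rightarrow> nat \<Rightarrow> (nat \<Rightarrow> nat) pmf" where
  "placement_pmf p k = Pi_pmf {..<k - 1} 0 (\<lambda>_. tilted_bin_pmf p k)"

definition bin_count :: "nat \<Rightarrow> (nat \<Rightarrow> nat) \<Rightarrow> nat \<Rightarrow> nat" where
  "bin_count k T i = card {j. j < k - 1 \<and> T j = i}"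

fun leftwalk :: "(nat \<Rightarrow> nat) \<Rightarrow> nat \<Rightarrow> int" where
  "leftwalk Z 0 = 1"
| "leftwalk Z (Suc i) = leftwalk Z i + int (Z (Suc i)) - 1"

fun rightwalk :: "(nat \<Rightarrow> nat) \<Rightarrow> nat \<Rightarrow> int" where
  "rightwalk Z 0 = 0"
| "rightwalk Z (Suc i) = rightwalk Z i + 1 - int (Z (Suc i))"

definition TREE :: "nat \<Rightarrow> (nat \<Rightarrow> nat) set" where
  "TREE k = {T. \<forall>t\<in>{1..k - 1}. leftwalk (bin_count k T) t > 0}"

text \<open>The law of an i.i.d. \<open>Po(l)\<close> sequence \<open>Z\<^sub>1, Z\<^sub>2, \<dots>\<close>, for \<open>l > 0\<close>.\<close>

definition poisson_steps :: "real \<Rightarrow> (nat \<Rightarrow> nat) measure" where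
  "poisson_steps l = PiM {1..} (\<lambda>_. measure_pmf (poisson_pmf l))"

definition ESC :: "real \<Rightarrow> (nat \<Rightarrow> nat) set" where
  "ESC l = {Z \<in> space (poisson_steps l). \<forall>i\<ge>1. leftwalk Z i > 0}"

definition ESC\<^sub>R :: "real \<Rightarrow> (nat \<Rightarrow> nat) set" where
  "ESC\<^sub>R l = {Z \<in> space (poisson_steps l). \<forall>i\<ge>1. rightwalk Z i > 0}"

lemma measurable_step:
  "(\<lambda>Z. Z (Suc i)) \<in> measurable (poisson_steps l) (count_space UNIV)"
  unfolding poisson_steps_def
  using measurable_component_singleton[of "Suc i" "{1..}" "\<lambda>_. measure_pmf (poisson_pmf l)"]
  by (simp add: measurable_def)

lemma measurable_leftwalk:
  "(\<lambda>Z. leftwalk Z i) \<in> measurable (poisson_steps l) (count_space UNIV)"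
proof (induction i)
  case (Suc i)
  note [measurable] = Suc measurable_step
  show ?case by simp
qed simp

lemma measurable_rightwalk:
  "(\<lambda>Z. rightwalk Z i) \<in> measurable (poisson_steps l) (count_space UNIV)"
proof (induction i)
  case (Suc i)
  note [measurable] = Suc measurable_step
  show ?case by simp
qed simp

lemma sets_ESC: "ESC l \<in> sets (poisson_steps l)"
proof -
  note [measurable] = measurable_leftwalk
  show ?thesis unfolding ESC_def by measurable
qed

lemma sets_ESC_R: "ESC\<^sub>R l \<in> sets (poisson_steps l)"
proof -
  note [measurable] = measurable_rightwalk
  show ?thesis unfolding ESC\<^sub>R_def by measurable
qed

definition rate_left :: "real \<Rightarrow> nat \<Rightarrow> real" where
  "rate_left p k = (real k - 1) * (p / (1 - (1 - p) ^ k))"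

definition rate_right :: "real \<Rightarrow> nat \<Rightarrow> real" where
  "rate_right p k = (real k - 1) * (p * (1 - p) ^ (k - 1) / (1 - (1 - p) ^ k))"

end

theory Submission
  imports Defs
begin

text \<open>
  Write \<open>q = 1 - p\<close> and \<open>r\<^sub>i = \<lambda> q\<^sup>i\<close> for \<open>0 \<le> i < k\<close>.  The bin counts are independent \<open>Po(r\<^sub>i)\<close> variables
  conditioned on having sum \<open>k - 1\<close>, so the probability of \<open>TREE\<close> is a Poisson walk probability divided by the
  weight \<open>\<pi>\<close> of \<open>Po(k - 1)\<close> at its mean.  Cut off a left block and a right block of \<open>m = \<delta>k\<close> bins.  Both
  ends of the walk have to stay positive, and the middle stretch contributes the weight of a Poisson variable of
  mean \<open>\<mu> \<approx> (1 - O(\<delta>)) k\<close>.  That weight is at most \<open>(k / \<mu>)\<^sup>1\<^sup>/\<^sup>2 \<pi>\<close>, which gives the upper bound.  It is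
  at least \<open>\<pi> exp (- d\<^sup>2 / \<mu>)\<close> at distance \<open>d\<close> from the mean, and the walk does not reach zero in the middle
  by Kolmogorov's inequality, run from both ends up to the index where the rates cross \<open>1\<close>; this gives the
  lower bound.

  On the left, optional stopping of \<open>x\<^sup>Y\<close> compares the probability of staying positive for \<open>m\<close> steps with the
  positive root \<open>y\<close> of \<open>1 - y = exp (- \<lambda> y)\<close>, which is the escape probability.  On the right, the induction
  that proves the ballot theorem still gives two-sided bounds for the monotone rates, and the escape probability is
  \<open>1 - \<lambda>\<^sup>R\<close>.  Both escape probabilities are of larger order than \<open>k\<^sup>-\<^sup>1\<^sup>/\<^sup>2\<close>, the order of all the errors.

  This works while \<open>p k\<close> stays bounded.  A larger tilt makes every ball land further to the left, so the
  probability of \<open>TREE\<close> increases with \<open>p\<close>; comparison with \<open>p = C / k\<close> for large \<open>C\<close> shows that both sides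
  are close to \<open>1\<close> otherwise.
\<close>

section \<open>Poisson weights\<close>

text \<open>The lower bound on p enters as \<open>p k * real k * sqrt (real k)\<close> tending to
  infinity: while pk is bounded, both escape probabilities are at least of order pk, so they
  dominate k^(-1/2). They may still tend to 0, hence every error on the end blocks must be small
  relative to them, and a plain Chebyshev bound would not do. This is why second moments are
  weighted by survival, why the minorant on the right keeps the factor 1 - R/m, and why survival at
  nearby rates is compared multiplicatively. The scales: blocks have length about \<eta>^4 k, so
  they fluctuate by about \<eta>^2 sqrt k, small against the tolerance x = \<eta> sqrt k. That
  tolerance is small against sqrt k, the spread of the middle stretch, where it costs only a factor
  exp(-O(\<eta>^2)). The drift over a block is of order \<eta>^4 pk k, far above sqrt k for fixed
  \<eta>, so a walk that survives its block is unlikely to die later. The limit in k is taken before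
  \<eta> tends to 0.\<close>

definition pois :: "real \<Rightarrow> nat \<Rightarrow> real" where
  "pois l n = l ^ n / fact n * exp (- l)"

text \<open>Integer arguments, with weight 0 below zero, turn transition weights of walks into
  functions of differences of levels, free of range conditions.\<close>

definition poisz :: "real \<Rightarrow> int \<Rightarrow> real" where
  "poisz l i = (if i < 0 then 0 else pois l (nat i))"

lemma pois_nonneg: "0 \<le> l \<Longrightarrow> 0 \<le> pois l n"
  by (simp add: pois_def)

lemma pois_pos: "0 < l \<Longrightarrow> 0 < pois l n"
  by (simp add: pois_def)

lemma poisz_nonneg: "0 \<le> l \<Longrightarrow> 0 \<le> poisz l i"
  by (simp add: poisz_def pois_nonneg)

lemma poisz_of_nat [simp]: "poisz l (int n) = pois l n"
  by (simp add: poisz_def)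

text \<open>The size-biasing identity. It yields both moments and, inside a convolution, the mean
  number of balls in the last bin.\<close>

lemma pois_Suc: "real (Suc n) * pois l (Suc n) = l * pois l n"
  by (simp add: pois_def del: of_nat_Suc)

lemma pois_convolution: "(\<Sum>i\<le>n. pois a i * pois b (n - i)) = pois (a + b) n"
proof -
  have "pois a i * pois b (n - i) = real (n choose i) * a ^ i * b ^ (n - i) * (exp (- a - b) / fact n)"
    if "i \<le> n" for i
    using that by (simp add: pois_def binomial_fact exp_diff exp_minus field_simps)
  then have "(\<Sum>i\<le>n. pois a i * pois b (n - i)) =
      (\<Sum>i\<le>n. real (n choose i) * a ^ i * b ^ (n - i)) * (exp (- a - b) / fact n)"
    by (simp add: sum_distrib_right sum_divide_distrib)
  also have "\<dots> = pois (a + b) n"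
    by (simp add: pois_def binomial_ring[of a b n])
  finally show ?thesis .
qed

lemma poisz_convolution:
  assumes "finite I" "{u..v} \<subseteq> I"
  shows "(\<Sum>g\<in>I. poisz a (g - u) * poisz b (v - g)) = poisz (a + b) (v - u)"
proof -
  have "(\<Sum>g\<in>I. poisz a (g - u) * poisz b (v - g)) = (\<Sum>g\<in>{u..v}. poisz a (g - u) * poisz b (v - g))"
    using assms by (intro sum.mono_neutral_right) (auto simp: poisz_def)
  also have "\<dots> = poisz (a + b) (v - u)"
  proof (cases "u \<le> v")
    case True
    have "(\<Sum>g\<in>{u..v}. poisz a (g - u) * poisz b (v - g)) = (\<Sum>i\<le>nat (v - u). pois a i * pois b (nat (v - u) - i))"
      by (rule sum.reindex_bij_witness[where i = "\<lambda>i. u + int i" and j = "\<lambda>g. nat (g - u)"])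
        (use True in \<open>auto simp: poisz_def nat_diff_distrib intro!: arg_cong2[where f = pois]\<close>)
    then show ?thesis using True by (simp add: pois_convolution poisz_def)
  qed (simp add: poisz_def)
  finally show ?thesis .
qed

lemma poisz_convolution_le:
  assumes "finite I" "0 \<le> a" "0 \<le> b"
  shows "(\<Sum>g\<in>I. poisz a (g - u) * poisz b (v - g)) \<le> poisz (a + b) (v - u)"
proof -
  have "(\<Sum>g\<in>I. poisz a (g - u) * poisz b (v - g)) \<le> (\<Sum>g\<in>I \<union> {u..v}. poisz a (g - u) * poisz b (v - g))"
    using assms by (intro sum_mono2) (auto intro!: mult_nonneg_nonneg poisz_nonneg)
  then show ?thesis using assms poisz_convolution[of "I \<union> {u..v}" u v a b] by simp
qed

section \<open>Moments of the Poisson distribution\<close>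

lemma pois_sums: "pois l sums 1"
proof -
  have "(\<lambda>n. l ^ n /\<^sub>R fact n * exp (- l)) sums (exp l * exp (- l))"
    by (intro sums_mult2 exp_converges)
  then show ?thesis by (simp add: pois_def[abs_def] exp_minus field_simps)
qed

lemma pois_sums_mean: "(\<lambda>n. real n * pois l n) sums l"
proof -
  have "(\<lambda>n. real (Suc n) * pois l (Suc n)) sums l"
    unfolding pois_Suc using sums_mult[OF pois_sums, of l l] by simp
  then show ?thesis by (subst (asm) sums_Suc_iff) simp
qed

lemma pois_sums_square: "(\<lambda>n. (real n)\<^sup>2 * pois l n) sums (l + l\<^sup>2)"
proof -
  have e: "(real (Suc n))\<^sup>2 * pois l (Suc n) = l * (real n * pois l n) + l * pois l n" for n
    using arg_cong[OF pois_Suc[of n l], of "\<lambda>t. real (Suc n) * t"]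
    by (simp add: power2_eq_square algebra_simps)
  have "(\<lambda>n. (real (Suc n))\<^sup>2 * pois l (Suc n)) sums (l * l + l * 1)"
    unfolding e by (intro sums_add sums_mult pois_sums pois_sums_mean)
  then show ?thesis by (subst (asm) sums_Suc_iff) (simp add: power2_eq_square algebra_simps)
qed

text \<open>\<open>a\<close> stands for the deviation accumulated so far: since \<open>l\<close> is
  the mean, the cross term vanishes and one step adds exactly \<open>l\<close> to the second
  moment.\<close>

lemma pois_sums_variance: "(\<lambda>n. (a + (real n - l))\<^sup>2 * pois l n) sums (a\<^sup>2 + l)"
proof -
  have "(\<lambda>n. (a - l)\<^sup>2 * pois l n + 2 * (a - l) * (real n * pois l n) + (real n)\<^sup>2 * pois l n) sums
      ((a - l)\<^sup>2 * 1 + 2 * (a - l) * l + (l + l\<^sup>2))"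
    by (intro sums_add sums_mult pois_sums pois_sums_mean pois_sums_square)
  then show ?thesis by (simp add: power2_eq_square algebra_simps)
qed

lemma nn_integral_poisson_sums:
  assumes "0 < l" "\<And>n. 0 \<le> f n" "(\<lambda>n. f n * pois l n) sums s"
  shows "(\<integral>\<^sup>+z. ennreal (f z) \<partial>poisson_pmf l) = ennreal s"
proof -
  have "(\<integral>\<^sup>+z. ennreal (f z) \<partial>poisson_pmf l) = (\<Sum>n. ennreal (f n * pois l n))"
    using assms by (simp add: nn_integral_measure_pmf nn_integral_count_space_nat pois_def
        ennreal_mult[symmetric] mult.commute)
  also have "\<dots> = ennreal s"
    using assms(1,3) by (intro suminf_ennreal_eq) (auto intro!: mult_nonneg_nonneg assms(2) pois_nonneg)
  finally show ?thesis .
qed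

lemma nn_integral_poisson_variance:
  assumes "0 < l"
  shows "(\<integral>\<^sup>+z. ennreal ((a + (real z - l))\<^sup>2) \<partial>poisson_pmf l) = ennreal (a\<^sup>2 + l)"
  by (rule nn_integral_poisson_sums) (use assms pois_sums_variance in auto)

lemma nn_integral_poisson_power:
  assumes "0 < l" "0 \<le> x"
  shows "(\<integral>\<^sup>+z. ennreal (x ^ z) \<partial>poisson_pmf l) = ennreal (exp (l * (x - 1)))"
proof (rule nn_integral_poisson_sums)
  have "(\<lambda>n. (x * l) ^ n /\<^sub>R fact n * exp (- l)) sums (exp (x * l) * exp (- l))"
    by (intro sums_mult2 exp_converges)
  then show "(\<lambda>n. x ^ n * pois l n) sums exp (l * (x - 1))"
    by (simp add: pois_def exp_minus exp_diff field_simps power_mult_distrib)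
qed (use assms in auto)

lemma pois_diag_Suc_le: "pois (real (Suc n)) (Suc n) \<le> pois (real n) n"
proof (cases "n = 0")
  case False
  have "(1 + 1 / real n) ^ n \<le> exp 1"
    using exp_ge_one_plus_x_over_n_power_n[of n 1] False by simp
  then have "pois (real n) n * ((1 + 1 / real n) ^ n * exp (- 1)) \<le> pois (real n) n * 1"
    by (intro mult_left_mono pois_nonneg) (auto simp: exp_minus field_simps)
  moreover have "pois (real n) n * ((1 + 1 / real n) ^ n * exp (- 1)) = pois (real (Suc n)) (Suc n)"
  proof -
    have "real n ^ n * (1 + 1 / real n) ^ n = (real n + 1) ^ n"
      using False by (simp add: power_mult_distrib[symmetric] field_simps)
    then have "pois (real n) n * ((1 + 1 / real n) ^ n * exp (- 1)) = (real n + 1) ^ n / fact n * (exp (- real n) * exp (- 1))"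
      by (simp add: pois_def)
    also have "\<dots> = pois (real (Suc n)) (Suc n)"
      by (simp add: pois_def mult_exp_exp add.commute)
    finally show ?thesis .
  qed
  ultimately show ?thesis by simp
qed (simp add: pois_def)

lemma pois_diag_antimono: "m \<le> n \<Longrightarrow> pois (real n) n \<le> pois (real m) m"
  by (rule lift_Suc_antimono_le[of "\<lambda>n. pois (real n) n"]) (use pois_diag_Suc_le in auto)

text \<open>The ratio of consecutive terms is (1 + 1/n)^(n + 1/2) / e, at least 1, whereas without
  the square root it is (1 + 1/n)^n / e, at most 1. Together the two monotonicities compare weights
  at different means up to the square root of the ratio of the means, in place of Stirling's
  formula.\<close>

lemma sqrt_pois_diag_Suc_ge:
  assumes "0 < n"
  shows "sqrt (real n) * pois (real n) n \<le> sqrt (real (Suc n)) * pois (real (Suc n)) (Suc n)"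
proof -
  have "ln (1 + 1 / real n) \<ge> 2 / (2 * real n + 1)"
  proof -
    \<comment> \<open>\<open>g\<close> vanishes at 0 and has derivative t^2 / ((1 + t) (2 + t)^2);
      at t = 1/n its subtracted term is 2 / (2n + 1).\<close>
    define g where "g = (\<lambda>t::real. ln (1 + t) - 2 * t / (2 + t))"
    have "g 0 \<le> g (1 / real n)"
    proof (rule DERIV_nonneg_imp_nondecreasing[of 0 "1 / real n" g])
      fix t :: real assume "0 \<le> t"
      then have "(g has_real_derivative (1 / (1 + t) - (2 * (2 + t) - 2 * t) / ((2 + t) * (2 + t)))) (at t)"
        unfolding g_def by (auto intro!: derivative_eq_intros)
      moreover have "1 / (1 + t) - (2 * (2 + t) - 2 * t) / ((2 + t) * (2 + t)) = t\<^sup>2 / ((1 + t) * (2 + t)\<^sup>2)"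
        using \<open>0 \<le> t\<close> by (simp add: divide_simps power2_eq_square) algebra
      moreover have "t\<^sup>2 / ((1 + t) * (2 + t)\<^sup>2) \<ge> 0" using \<open>0 \<le> t\<close> by simp
      ultimately show "\<exists>y. (g has_real_derivative y) (at t) \<and> 0 \<le> y" by metis
    qed simp
    moreover have "2 * (1 / real n) / (2 + 1 / real n) = 2 / (2 * real n + 1)"
      using assms by (simp add: field_simps)
    ultimately show ?thesis by (simp add: g_def)
  qed
  then have "1 \<le> (real n + 1 / 2) * ln (1 + 1 / real n)"
    by (simp add: field_simps)
  then have "exp 1 \<le> exp ((real n + 1 / 2) * ln (1 + 1 / real n))" by simp
  also have "\<dots> = (1 + 1 / real n) ^ n * sqrt (1 + 1 / real n)"
  proof -
    have pos: "0 < 1 + 1 / real n" using assms by (simp add: add_pos_pos)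
    have "exp (1 / 2 * ln (1 + 1 / real n)) = sqrt (1 + 1 / real n)"
      using powr_half_sqrt[of "1 + 1 / real n"] pos by (simp add: powr_def)
    then show ?thesis using pos
      by (simp only: distrib_right exp_add exp_of_nat_mult exp_ln)
  qed
  finally have "exp 1 \<le> (1 + 1 / real n) ^ n * sqrt (1 + 1 / real n)" .
  then have "sqrt (real n) * pois (real n) n * 1 \<le> sqrt (real n) * pois (real n) n * ((1 + 1 / real n) ^ n * sqrt (1 + 1 / real n) * exp (- 1))"
    by (intro mult_left_mono mult_nonneg_nonneg pois_nonneg) (auto simp: exp_minus field_simps)
  also have "\<dots> = sqrt (real (Suc n)) * pois (real (Suc n)) (Suc n)"
  proof -
    have "real n ^ n * (1 + 1 / real n) ^ n = (real n + 1) ^ n"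
      using assms by (simp add: power_mult_distrib[symmetric] field_simps)
    moreover have "sqrt (real n) * sqrt (1 + 1 / real n) = sqrt (real n + 1)"
      using assms by (simp add: real_sqrt_mult[symmetric] field_simps)
    moreover have "sqrt (real n) * pois (real n) n * ((1 + 1 / real n) ^ n * sqrt (1 + 1 / real n) * exp (- 1)) =
       (sqrt (real n) * sqrt (1 + 1 / real n)) * ((real n ^ n * (1 + 1 / real n) ^ n) / fact n * (exp (- real n) * exp (- 1)))"
      by (simp add: pois_def)
    moreover have "(real n + 1) ^ n / fact n * (exp (- real n) * exp (- 1)) = pois (real (Suc n)) (Suc n)"
      by (simp add: pois_def mult_exp_exp add.commute)
    ultimately show ?thesis by (simp only: of_nat_Suc add.commute[of 1])
  qed
  finally show ?thesis by simp
qed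

lemma sqrt_pois_diag_mono:
  assumes "0 < m" "m \<le> n"
  shows "sqrt (real m) * pois (real m) m \<le> sqrt (real n) * pois (real n) n"
  using assms(2)
proof (induction n rule: dec_induct)
  case (step n)
  then show ?case using sqrt_pois_diag_Suc_ge[of n] assms by simp
qed simp

text \<open>For fixed \<open>n\<close>, l^n exp(-l) peaks at l = n; this is ln u <= u - 1 at u =
  l/n.\<close>

lemma pois_le_diag:
  assumes "0 < l"
  shows "pois l n \<le> pois (real n) n"
proof (cases "n = 0")
  case False
  have "ln (l / n) \<le> l / n - 1" using assms False by (intro ln_le_minus_one) auto
  then have "n * ln (l / n) \<le> l - n" using False by (simp add: field_simps)
  then have "exp (n * ln (l / n)) \<le> exp (l - n)" by simp
  then have "(l / n) ^ n \<le> exp (l - n)" using assms False by (simp add: exp_of_nat_mult)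
  then have "l ^ n * exp (- l) \<le> real n ^ n * exp (- real n)"
    using False by (simp add: power_divide exp_diff exp_minus field_simps)
  then have "l ^ n * exp (- l) / fact n \<le> real n ^ n * exp (- real n) / fact n"
    by (rule divide_right_mono) simp
  then show ?thesis by (simp add: pois_def field_simps)
qed (use assms in \<open>simp add: pois_def\<close>)

text \<open>The same logarithm inequality at the inverse ratio n/l. The exponent is quadratic in l -
  n, hence small when the deviation is a small multiple of sqrt l.\<close>

lemma pois_ge_diag:
  assumes "0 < l"
  shows "pois (real n) n * exp (- (l - n)\<^sup>2 / l) \<le> pois l n"
proof (cases "n = 0")
  case False
  have "ln (n / l) \<le> n / l - 1" using assms False by (intro ln_le_minus_one) auto
  then have "n * (1 - n / l) \<le> n * ln (l / n)" using assms False
    by (intro mult_left_mono) (auto simp: ln_div)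
  moreover have "l - n - (l - n)\<^sup>2 / l = n * (1 - n / l)"
    using assms by (simp add: field_simps power2_eq_square)
  ultimately have "exp (l - n - (l - n)\<^sup>2 / l) \<le> exp (n * ln (l / n))" by simp
  also have "\<dots> = (l / n) ^ n" using assms False by (simp add: exp_of_nat_mult)
  finally have "exp (- real n) * exp (- (l - n)\<^sup>2 / l) * exp l \<le> l ^ n / real n ^ n"
    by (simp add: power_divide mult_exp_exp add.commute algebra_simps)
  then have "real n ^ n * exp (- real n) * exp (- (l - n)\<^sup>2 / l) \<le> l ^ n * exp (- l)"
    using False by (simp add: exp_minus field_simps)
  then have "real n ^ n * exp (- real n) * exp (- (l - n)\<^sup>2 / l) / fact n \<le> l ^ n * exp (- l) / fact n"
    by (rule divide_right_mono) simp
  then show ?thesis by (simp add: pois_def field_simps)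
qed (use assms in \<open>simp add: pois_def power2_eq_square\<close>)

text \<open>Consecutive weights have ratio l / (n + 1), so the integer part of \<open>l\<close> is a
  mode; moving the mean to that integer can only increase the weight there.\<close>

lemma pois_le_floor:
  assumes "0 < l"
  shows "pois l n \<le> pois (real (nat \<lfloor>l\<rfloor>)) (nat \<lfloor>l\<rfloor>)"
proof -
  define N where "N = nat \<lfloor>l\<rfloor>"
  have N: "real N \<le> l" "l < real N + 1" using assms by (auto simp: N_def)
  have step: "pois l (Suc n) = l / real (Suc n) * pois l n" for n
    using pois_Suc[of n l] by (simp add: field_simps)
  have "pois l n \<le> pois l N"
  proof (cases "n \<le> N")
    case True
    then show ?thesis
    proof (induction n rule: inc_induct)
      case (step n)
      have "1 * pois l n \<le> l / real (Suc n) * pois l n"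
        using step N assms by (intro mult_right_mono pois_nonneg) (auto simp: field_simps)
      then show ?case using step \<open>pois l (Suc n) = l / real (Suc n) * pois l n\<close> by simp
    qed simp
  next
    case False
    then have "N \<le> n" by simp
    then show ?thesis
    proof (induction n rule: dec_induct)
      case (step n)
      have "l / real (Suc n) * pois l n \<le> 1 * pois l n"
        using step N assms by (intro mult_right_mono pois_nonneg) (auto simp: field_simps)
      then show ?case using step \<open>pois l (Suc n) = l / real (Suc n) * pois l n\<close> by simp
    qed simp
  qed
  also have "\<dots> \<le> pois (real N) N" by (rule pois_le_diag[OF assms])
  finally show ?thesis by (simp add: N_def)
qed

lemma poisz_le_sqrt:
  assumes "1 \<le> l" "l \<le> real n"
  shows "poisz l i \<le> sqrt (real n / real (nat \<lfloor>l\<rfloor>)) * pois (real n) n"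
proof -
  define N where "N = nat \<lfloor>l\<rfloor>"
  have N: "0 < N" "N \<le> n" using assms by (auto simp: N_def nat_le_iff floor_le_iff)
  have "poisz l i \<le> pois (real N) N"
    using assms pois_le_floor[of l "nat i"] pois_nonneg[of "real N" N] by (auto simp: poisz_def N_def)
  also have "\<dots> = sqrt N * pois (real N) N / sqrt N" using N by simp
  also have "\<dots> \<le> sqrt n * pois (real n) n / sqrt N"
    by (intro divide_right_mono sqrt_pois_diag_mono N) auto
  also have "\<dots> = sqrt (real n / real N) * pois (real n) n" by (simp add: real_sqrt_divide)
  finally show ?thesis by (simp add: N_def)
qed

section \<open>Killed Poisson walks\<close>

text \<open>Death is the absorbing state 0, so a killed walk remains a probability distribution and
  survival is the mass of the positive states. The step map receives the time index because the
  first step of the right walk is special.\<close>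

primrec chain :: "(nat \<Rightarrow> 's \<Rightarrow> nat \<Rightarrow> 's) \<Rightarrow> (nat \<Rightarrow> real) \<Rightarrow> 's \<Rightarrow> nat \<Rightarrow> 's pmf" where
  "chain F r s 0 = return_pmf s"
| "chain F r s (Suc n) = bind_pmf (chain F r s n) (\<lambda>g. map_pmf (F n g) (poisson_pmf (r n)))"

text \<open>For positive \<open>g\<close> the subtraction never truncates: a left step falls by at
  most one, so the walk dies exactly on level 0.\<close>

definition stepL :: "nat \<Rightarrow> nat \<Rightarrow> nat \<Rightarrow> nat" where
  "stepL i g z = (if g = 0 then 0 else g + z - 1)"

text \<open>Truncated subtraction sends every level at or below zero to death. At time 0 the
  rightwalk is on level 0 and still alive, hence the exception.\<close>

definition stepR :: "nat \<Rightarrow> nat \<Rightarrow> nat \<Rightarrow> nat" where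
  "stepR i g z = (if g = 0 \<and> 0 < i then 0 else g + 1 - z)"

text \<open>The right step after the first one; it also describes a restart from a positive level at
  the inner end of the right block.\<close>

definition stepD :: "nat \<Rightarrow> nat \<Rightarrow> nat \<Rightarrow> nat" where
  "stepD i g z = (if g = 0 then 0 else g + 1 - z)"

abbreviation (input) lwalk :: "(nat \<Rightarrow> real) \<Rightarrow> nat \<Rightarrow> nat pmf" where
  "lwalk r \<equiv> chain stepL r 1"

abbreviation (input) rwalk :: "(nat \<Rightarrow> real) \<Rightarrow> nat \<Rightarrow> nat pmf" where
  "rwalk r \<equiv> chain stepR r 0"

definition alive :: "nat pmf \<Rightarrow> real" where
  "alive M = measure_pmf.prob M {0<..}"

lemma alive_eq: "alive M = 1 - pmf M 0"
proof -
  have "alive M = measure_pmf.prob M (UNIV - {0})"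
    unfolding alive_def by (rule arg_cong[where f = "measure_pmf.prob M"]) auto
  then show ?thesis using measure_pmf.prob_compl[of "{0}" M] by (simp add: measure_pmf_single)
qed

lemma alive_nonneg: "0 \<le> alive M" and alive_le_1: "alive M \<le> 1"
  by (auto simp: alive_def)

lemma chain_add:
  "chain F r s (m + n) =
     bind_pmf (chain F r s m) (\<lambda>g. chain (\<lambda>i. F (m + i)) (\<lambda>i. r (m + i)) g n)"
  by (induction n) (simp_all add: bind_return_pmf' bind_assoc_pmf)

lemma nn_integral_chain_Suc:
  "(\<integral>\<^sup>+x. f x \<partial>chain F r s (Suc n)) =
     (\<integral>\<^sup>+g. (\<integral>\<^sup>+z. f (F n g z) \<partial>poisson_pmf (r n)) \<partial>chain F r s n)"
  by simp

lemma nn_integral_ge_alive: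
  "(\<integral>\<^sup>+g. (if g = 0 then 0 else ennreal c) \<partial>measure_pmf M) = ennreal c * ennreal (alive M)"
proof -
  have "(\<integral>\<^sup>+g. (if g = 0 then 0 else ennreal c) \<partial>measure_pmf M) =
      (\<integral>\<^sup>+g. ennreal c * indicator {0<..} g \<partial>measure_pmf M)"
    by (intro nn_integral_cong) auto
  then show ?thesis by (simp add: nn_integral_cmult alive_def measure_pmf.emeasure_eq_measure)
qed

lemma nn_integral_dead:
  "(\<integral>\<^sup>+g. (if g = 0 then ennreal c else 0) \<partial>measure_pmf M) = ennreal c * ennreal (pmf M 0)"
proof -
  have "(\<integral>\<^sup>+g. (if g = 0 then ennreal c else 0) \<partial>measure_pmf M) =
      (\<integral>\<^sup>+g. ennreal c * indicator {0} g \<partial>measure_pmf M)"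
    by (intro nn_integral_cong) auto
  then show ?thesis by (simp add: nn_integral_cmult emeasure_pmf_single)
qed

section \<open>Exponential functionals of the left walk\<close>

lemma stepL_power_integral:
  assumes "0 < l" "0 < x" "0 < g"
  shows "(\<integral>\<^sup>+z. ennreal (x ^ stepL i g z) \<partial>poisson_pmf l) = ennreal (x ^ (g - 1) * exp (l * (x - 1)))"
proof -
  have "(\<integral>\<^sup>+z. ennreal (x ^ stepL i g z) \<partial>poisson_pmf l) =
      (\<integral>\<^sup>+z. ennreal (x ^ (g - 1)) * ennreal (x ^ z) \<partial>poisson_pmf l)"
    using assms by (intro nn_integral_cong)
      (auto simp: stepL_def ennreal_mult[symmetric] power_add[symmetric] intro!: arg_cong[where f = "\<lambda>n. ennreal (x ^ n)"])
  also have "\<dots> = ennreal (x ^ (g - 1)) * ennreal (exp (l * (x - 1)))"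
    using assms by (simp add: nn_integral_cmult nn_integral_poisson_power)
  finally show ?thesis using assms by (simp add: ennreal_mult[symmetric])
qed

text \<open>\<open>x ^ Y\<close> is a supermartingale, as all rates are at least \<open>l\<close>
  and x <= 1. It starts at x and equals 1 on the dead state, so death has probability at most
  x.\<close>

lemma alive_left_ge:
  assumes r: "\<And>i. i < m \<Longrightarrow> 0 < r i" "\<And>i. i < m \<Longrightarrow> l \<le> r i"
    and x: "0 < x" "x \<le> 1" "exp (l * (x - 1)) \<le> x"
  shows "1 - x \<le> alive (lwalk r m)"
proof -
  have "(\<integral>\<^sup>+g. ennreal (x ^ g) \<partial>lwalk r n) \<le> ennreal x" if "n \<le> m" for n
    using that
  proof (induction n)
    case (Suc n)
    have "(\<integral>\<^sup>+z. ennreal (x ^ stepL n g z) \<partial>poisson_pmf (r n)) \<le> ennreal (x ^ g)" for g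
    proof (cases "g = 0")
      case True
      then show ?thesis by (simp add: stepL_def)
    next
      case False
      have "exp (r n * (x - 1)) \<le> exp (l * (x - 1))"
        using r(2)[of n] Suc.prems x by (simp add: mult_right_mono_neg)
      then have "x ^ (g - 1) * exp (r n * (x - 1)) \<le> x ^ (g - 1) * x"
        using x by (intro mult_left_mono order_trans[OF _ x(3)]) auto
      also have "\<dots> = x ^ g" using False by (simp add: power_eq_if)
      finally show ?thesis using stepL_power_integral[of "r n" x g] r(1)[of n] Suc.prems x False
        by (simp add: ennreal_leI)
    qed
    then have "(\<integral>\<^sup>+g. ennreal (x ^ g) \<partial>lwalk r (Suc n)) \<le> (\<integral>\<^sup>+g. ennreal (x ^ g) \<partial>lwalk r n)"
      unfolding nn_integral_chain_Suc by (intro nn_integral_mono) auto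
    then show ?case using Suc by simp
  qed (use x in simp)
  from this[of m] have le: "(\<integral>\<^sup>+g. ennreal (x ^ g) \<partial>lwalk r m) \<le> ennreal x" by simp
  have "ennreal 1 * ennreal (pmf (lwalk r m) 0) \<le> (\<integral>\<^sup>+g. ennreal (x ^ g) \<partial>lwalk r m)"
    unfolding nn_integral_dead[symmetric] using x by (intro nn_integral_mono) auto
  then have "ennreal (pmf (lwalk r m) 0) \<le> ennreal x" using le by simp
  then have "pmf (lwalk r m) 0 \<le> x" using x by simp
  then show ?thesis by (simp add: alive_eq)
qed

text \<open>With the value 1 on the dead state, \<open>x ^ Y * \<beta> ^ n\<close> is a
  submartingale. The discount handles the finite horizon: a surviving path contributes at most
  \<open>\<beta> ^ m\<close>, however low its level.\<close>

lemma alive_left_le: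
  assumes r: "\<And>i. i < m \<Longrightarrow> 0 < r i" "\<And>i. i < m \<Longrightarrow> r i \<le> l"
    and x: "0 < x" "x \<le> 1" "0 < \<beta>" "\<beta> \<le> 1" "x \<le> \<beta> * exp (l * (x - 1))"
  shows "alive (lwalk r m) * (1 - \<beta> ^ m) \<le> 1 - x"
proof -
  define f where "f = (\<lambda>n g. ennreal (if g = 0 then 1 else x ^ g * \<beta> ^ n))"
  have "ennreal x \<le> (\<integral>\<^sup>+g. f n g \<partial>lwalk r n)" if "n \<le> m" for n
    using that
  proof (induction n)
    case (Suc n)
    have "f n g \<le> (\<integral>\<^sup>+z. f (Suc n) (stepL n g z) \<partial>poisson_pmf (r n))" for g
    proof (cases "g = 0")
      case True
      then show ?thesis by (simp add: stepL_def f_def)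
    next
      case False
      have "exp (l * (x - 1)) \<le> exp (r n * (x - 1))"
        using r(2)[of n] Suc.prems x by (simp add: mult_right_mono_neg)
      then have "x \<le> \<beta> * exp (r n * (x - 1))"
        using x(3,5) by (meson mult_le_cancel_left_pos order_trans)
      then have "x ^ (g - 1) * \<beta> ^ n * x \<le> x ^ (g - 1) * \<beta> ^ n * (\<beta> * exp (r n * (x - 1)))"
        using x by (intro mult_left_mono) auto
      then have "x ^ g * \<beta> ^ n \<le> \<beta> ^ Suc n * (x ^ (g - 1) * exp (r n * (x - 1)))"
        using False by (simp add: power_eq_if mult_ac)
      then have "f n g \<le> ennreal (\<beta> ^ Suc n) * ennreal (x ^ (g - 1) * exp (r n * (x - 1)))"
        using False x by (simp add: f_def ennreal_mult[symmetric] ennreal_leI del: power_Suc)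
      also have "\<dots> = (\<integral>\<^sup>+z. ennreal (\<beta> ^ Suc n) * ennreal (x ^ stepL n g z) \<partial>poisson_pmf (r n))"
        using stepL_power_integral[of "r n" x g n] r(1)[of n] Suc.prems x False
        by (simp add: nn_integral_cmult del: power_Suc)
      also have "\<dots> \<le> (\<integral>\<^sup>+z. f (Suc n) (stepL n g z) \<partial>poisson_pmf (r n))"
      proof (rule nn_integral_mono)
        fix z
        have "\<beta> ^ Suc n \<le> 1" using x by (intro power_le_one) auto
        then show "ennreal (\<beta> ^ Suc n) * ennreal (x ^ stepL n g z) \<le> f (Suc n) (stepL n g z)"
          using x by (auto simp: f_def ennreal_mult[symmetric] mult.commute simp del: power_Suc)
      qed
      finally show ?thesis .
    qed
    then have "(\<integral>\<^sup>+g. f n g \<partial>lwalk r n) \<le> (\<integral>\<^sup>+g. f (Suc n) g \<partial>lwalk r (Suc n))"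
      unfolding nn_integral_chain_Suc by (intro nn_integral_mono) auto
    then show ?case using Suc by (meson Suc_leD order_trans)
  qed (simp add: f_def)
  from this[of m] have "ennreal x \<le> (\<integral>\<^sup>+g. f m g \<partial>lwalk r m)" by simp
  also have "\<dots> \<le> (\<integral>\<^sup>+g. (if g = 0 then ennreal 1 else 0) + (if g = 0 then 0 else ennreal (\<beta> ^ m)) \<partial>lwalk r m)"
    using x by (intro nn_integral_mono) (auto simp: f_def power_le_one intro!: ennreal_leI mult_left_le_one_le)
  also have "\<dots> = ennreal (pmf (lwalk r m) 0 + \<beta> ^ m * alive (lwalk r m))"
    using x by (subst nn_integral_add) (auto simp: nn_integral_dead nn_integral_ge_alive alive_nonneg ennreal_mult[symmetric] ennreal_plus[symmetric] simp del: ennreal_plus ennreal_1)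
  finally have "x \<le> pmf (lwalk r m) 0 + \<beta> ^ m * alive (lwalk r m)"
    using x alive_nonneg by (subst (asm) ennreal_le_iff) (auto intro!: add_nonneg_nonneg mult_nonneg_nonneg)
  then show ?thesis by (simp add: alive_eq algebra_simps)
qed

text \<open>Paths that die drop a nonnegative term, and step \<open>i\<close> adds variance
  \<open>r i\<close> only on survival up to \<open>i\<close>. The survival weights allow a Chebyshev
  error that is small relative to a survival probability tending to 0.\<close>

lemma second_moment_left:
  assumes r: "\<And>i. i < m \<Longrightarrow> 0 < r i"
  shows "(\<integral>\<^sup>+g. (if g = 0 then 0 else ennreal ((real g - (1 + (\<Sum>i<m. r i - 1)))\<^sup>2)) \<partial>lwalk r m)
    \<le> ennreal (\<Sum>i<m. r i * alive (lwalk r i))"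
  using r
proof (induction m)
  case (Suc m)
  define a where "a = 1 + (\<Sum>i<m. r i - 1)"
  have r: "0 < r m" using Suc.prems by simp
  have "(\<integral>\<^sup>+z. (if stepL m g z = 0 then 0 else ennreal ((real (stepL m g z) - (1 + (\<Sum>i<Suc m. r i - 1)))\<^sup>2)) \<partial>poisson_pmf (r m))
     \<le> (if g = 0 then 0 else ennreal ((real g - a)\<^sup>2)) + (if g = 0 then 0 else ennreal (r m))" for g
  proof (cases "g = 0")
    case False
    have "(\<integral>\<^sup>+z. (if stepL m g z = 0 then 0 else ennreal ((real (stepL m g z) - (1 + (\<Sum>i<Suc m. r i - 1)))\<^sup>2)) \<partial>poisson_pmf (r m))
      \<le> (\<integral>\<^sup>+z. ennreal (((real g - a) + (real z - r m))\<^sup>2) \<partial>poisson_pmf (r m))"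
      using False by (intro nn_integral_mono) (auto simp: stepL_def a_def of_nat_diff algebra_simps)
    then show ?thesis using False r by (simp add: nn_integral_poisson_variance)
  qed (simp add: stepL_def)
  then have "(\<integral>\<^sup>+g. (if g = 0 then 0 else ennreal ((real g - (1 + (\<Sum>i<Suc m. r i - 1)))\<^sup>2)) \<partial>lwalk r (Suc m))
     \<le> (\<integral>\<^sup>+g. (if g = 0 then 0 else ennreal ((real g - a)\<^sup>2)) + (if g = 0 then 0 else ennreal (r m)) \<partial>lwalk r m)"
    unfolding nn_integral_chain_Suc by (intro nn_integral_mono) auto
  also have "\<dots> = (\<integral>\<^sup>+g. (if g = 0 then 0 else ennreal ((real g - a)\<^sup>2)) \<partial>lwalk r m) + ennreal (r m) * ennreal (alive (lwalk r m))"
    by (subst nn_integral_add) (auto simp: nn_integral_ge_alive)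
  also have "\<dots> \<le> ennreal (\<Sum>i<m. r i * alive (lwalk r i)) + ennreal (r m * alive (lwalk r m))"
  proof -
    have "ennreal (r m * alive (lwalk r m)) = ennreal (r m) * ennreal (alive (lwalk r m))"
      using r alive_nonneg by (simp add: ennreal_mult)
    then show ?thesis using Suc.IH Suc.prems unfolding a_def by (simp only: add_right_mono less_SucI)
  qed
  also have "\<dots> = ennreal (\<Sum>i<Suc m. r i * alive (lwalk r i))"
    using Suc.prems alive_nonneg
    by (subst ennreal_plus[symmetric]) (auto intro!: sum_nonneg mult_nonneg_nonneg simp: less_imp_le)
  finally show ?case .
qed simp

text \<open>The dead state is given the weight \<open>X\<^sup>2\<close>, a lower bound for the squared deviation at the moment
  of death; this is the stopping-time argument behind Kolmogorov's maximal inequality.\<close>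

lemma dead_le:
  assumes r: "\<And>i. i < n \<Longrightarrow> 0 < r i" and c0: "c 0 = real h" and h: "0 < h" and \<sigma>: "\<sigma>\<^sup>2 = 1"
    and F0: "\<And>i z. F i 0 z = 0"
    and F: "\<And>i g z. i < n \<Longrightarrow> 0 < g \<Longrightarrow> (if F i g z = 0 then X\<^sup>2 else (real (F i g z) - c (Suc i))\<^sup>2) \<le>
      (\<sigma> * (real g - c i) + (real z - r i))\<^sup>2"
  shows "pmf (chain F r h n) 0 * X\<^sup>2 \<le> (\<Sum>i<n. r i)"
proof -
  define f where "f = (\<lambda>n g. ennreal (if g = 0 then X\<^sup>2 else (real g - c n)\<^sup>2))"
  have "(\<integral>\<^sup>+g. f m g \<partial>chain F r h m) \<le> ennreal (\<Sum>i<m. r i)" if "m \<le> n" for m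
    using that
  proof (induction m)
    case 0
    then show ?case using h c0 by (simp add: f_def)
  next
    case (Suc m)
    have rm: "0 < r m" using r[of m] Suc.prems by simp
    have "(\<integral>\<^sup>+z. f (Suc m) (F m g z) \<partial>poisson_pmf (r m)) \<le> f m g + ennreal (r m)" for g
    proof (cases "g = 0")
      case False
      have "(\<integral>\<^sup>+z. f (Suc m) (F m g z) \<partial>poisson_pmf (r m))
        \<le> (\<integral>\<^sup>+z. ennreal ((\<sigma> * (real g - c m) + (real z - r m))\<^sup>2) \<partial>poisson_pmf (r m))"
        unfolding f_def using F False Suc.prems by (intro nn_integral_mono ennreal_leI) auto
      also have "\<dots> = ennreal ((\<sigma> * (real g - c m))\<^sup>2 + r m)"
        by (rule nn_integral_poisson_variance[OF rm])
      finally show ?thesis using False rm \<sigma> by (simp add: f_def power_mult_distrib)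
    qed (simp add: F0 f_def)
    then have "(\<integral>\<^sup>+g. f (Suc m) g \<partial>chain F r h (Suc m)) \<le> (\<integral>\<^sup>+g. f m g + ennreal (r m) \<partial>chain F r h m)"
      unfolding nn_integral_chain_Suc by (intro nn_integral_mono) auto
    also have "\<dots> = (\<integral>\<^sup>+g. f m g \<partial>chain F r h m) + ennreal (r m)"
      by (subst nn_integral_add) auto
    also have "\<dots> \<le> ennreal (\<Sum>i<m. r i) + ennreal (r m)"
      using Suc by (intro add_right_mono) auto
    also have "\<dots> = ennreal (\<Sum>i<Suc m. r i)"
      using Suc.prems r by (subst ennreal_plus[symmetric]) (auto intro!: sum_nonneg simp: less_imp_le)
    finally show ?case .
  qed
  from this[of n] have "(\<integral>\<^sup>+g. f n g \<partial>chain F r h n) \<le> ennreal (\<Sum>i<n. r i)" by simp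
  moreover have "ennreal (X\<^sup>2) * ennreal (pmf (chain F r h n) 0) \<le> (\<integral>\<^sup>+g. f n g \<partial>chain F r h n)"
    unfolding nn_integral_dead[symmetric] by (intro nn_integral_mono) (auto simp: f_def)
  ultimately have "ennreal (X\<^sup>2 * pmf (chain F r h n) 0) \<le> ennreal (\<Sum>i<n. r i)"
    by (auto simp: ennreal_mult)
  then show ?thesis using r
    by (subst (asm) ennreal_le_iff) (auto intro!: sum_nonneg simp: mult.commute less_imp_le)
qed

text \<open>Rates at least 1 keep the mean path \<open>c\<close> at or above \<open>h\<close>, and
  the left walk dies exactly on level 0, so the deviation at death is at least X.\<close>

lemma dead_left_le:
  assumes r: "\<And>i. i < n \<Longrightarrow> 1 \<le> r i" and X: "0 < X" "X \<le> real h"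
  shows "pmf (chain stepL r h n) 0 * X\<^sup>2 \<le> (\<Sum>i<n. r i)"
proof -
  define c where "c = (\<lambda>n. real h + (\<Sum>i<n. r i - 1))"
  show ?thesis
  proof (rule dead_le[where c = c and \<sigma> = 1])
    fix i g z :: nat assume i: "i < n" and g: "0 < g"
    have "X \<le> c (Suc i)"
      using X r i sum_nonneg[of "{..<Suc i}" "\<lambda>i. r i - 1"] by (auto simp: c_def simp del: sum.lessThan_Suc)
    then have "(if stepL i g z = 0 then X\<^sup>2 else (real (stepL i g z) - c (Suc i))\<^sup>2) \<le> (real (stepL i g z) - c (Suc i))\<^sup>2"
      using X by (auto intro!: power_mono)
    also have "\<dots> = (1 * (real g - c i) + (real z - r i))\<^sup>2"
      using g by (intro arg_cong[where f = "\<lambda>t. t\<^sup>2"]) (simp add: stepL_def c_def of_nat_diff)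
    finally show "(if stepL i g z = 0 then X\<^sup>2 else (real (stepL i g z) - c (Suc i))\<^sup>2) \<le> (1 * (real g - c i) + (real z - r i))\<^sup>2" .
  qed (use X less_le_trans[OF zero_less_one r] in \<open>auto simp: c_def stepL_def\<close>)
qed

text \<open>Here \<sigma> = -1, as a large Poisson variable lowers the walk. A fatal step may
  overshoot zero; the overshoot hidden by truncation only increases the deviation.\<close>

lemma dead_right_le:
  assumes r: "\<And>i. i < n \<Longrightarrow> 0 < r i" "\<And>i. i < n \<Longrightarrow> r i \<le> 1" and X: "0 < X" "X \<le> real h"
  shows "pmf (chain stepD r h n) 0 * X\<^sup>2 \<le> (\<Sum>i<n. r i)"
proof -
  define c where "c = (\<lambda>n. real h + (\<Sum>i<n. 1 - r i))"
  show ?thesis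
  proof (rule dead_le[where c = c and \<sigma> = "- 1"])
    fix i g z :: nat assume i: "i < n" and g: "0 < g"
    define d where "d = - 1 * (real g - c i) + (real z - r i)"
    have cX: "X \<le> c (Suc i)"
      using X r i sum_nonneg[of "{..<Suc i}" "\<lambda>i. 1 - r i"] by (auto simp: c_def simp del: sum.lessThan_Suc)
    have "(if stepD i g z = 0 then X\<^sup>2 else (real (stepD i g z) - c (Suc i))\<^sup>2) \<le> d\<^sup>2"
    proof (cases "z < g + 1")
      case True
      then have "real (stepD i g z) - c (Suc i) = - d"
        using g by (simp add: stepD_def c_def d_def of_nat_diff)
      moreover have "stepD i g z \<noteq> 0" using True g by (simp add: stepD_def)
      ultimately show ?thesis by simp
    next
      case False
      then have "c (Suc i) \<le> d" by (simp add: c_def d_def)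
      then have "X\<^sup>2 \<le> d\<^sup>2" using cX X by (intro power_mono) auto
      moreover have "stepD i g z = 0" using False by (simp add: stepD_def)
      ultimately show ?thesis by simp
    qed
    then show "(if stepD i g z = 0 then X\<^sup>2 else (real (stepD i g z) - c (Suc i))\<^sup>2) \<le> (- 1 * (real g - c i) + (real z - r i))\<^sup>2"
      by (simp only: d_def)
  qed (use X r in \<open>auto simp: c_def stepD_def\<close>)
qed

section \<open>Transition weights and the ballot theorem\<close>

lemma pmf_poisson_pois: "0 < l \<Longrightarrow> pmf (poisson_pmf l) n = pois l n"
  by (simp add: pois_def)

lemma pmf_map_poisson_up:
  assumes "0 < l"
  shows "pmf (map_pmf (\<lambda>z. int z + u) (poisson_pmf l)) g = poisz l (g - u)"
proof -
  have "(\<lambda>z. int z + u) -` {g} = (if g - u < 0 then {} else {nat (g - u)})" by auto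
  then show ?thesis using assms
    by (simp add: pmf_map measure_pmf_single poisz_def pmf_poisson_pois del: pmf_poisson)
qed

lemma pmf_map_poisson_down:
  assumes "0 < l"
  shows "pmf (map_pmf (\<lambda>z. v - int z) (poisson_pmf l)) g = poisz l (v - g)"
proof -
  have "(\<lambda>z. v - int z) -` {g} = (if v - g < 0 then {} else {nat (v - g)})" by auto
  then show ?thesis using assms
    by (simp add: pmf_map measure_pmf_single poisz_def pmf_poisson_pois del: pmf_poisson)
qed

lemma pmf_map_stepL:
  assumes "0 < l" "0 < g"
  shows "pmf (map_pmf (stepL i f) (poisson_pmf l)) g = (if f = 0 then 0 else poisz l (int g + 1 - int f))"
proof -
  have "stepL i f -` {g} = (if f = 0 \<or> int g + 1 - int f < 0 then {} else {nat (int g + 1 - int f)})"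
    using assms by (auto simp: stepL_def split: if_splits)
  then show ?thesis using assms
    by (simp add: pmf_map measure_pmf_single poisz_def pmf_poisson_pois del: pmf_poisson)
qed

lemma pmf_map_stepD:
  assumes "0 < l" "0 < g"
  shows "pmf (map_pmf (stepD i f) (poisson_pmf l)) g = (if f = 0 then 0 else poisz l (int f + 1 - int g))"
proof -
  have "stepD i f -` {g} = (if f = 0 \<or> int f + 1 - int g < 0 then {} else {nat (int f + 1 - int g)})"
    using assms by (auto simp: stepD_def split: if_splits)
  then show ?thesis using assms
    by (simp add: pmf_map measure_pmf_single poisz_def pmf_poisson_pois del: pmf_poisson)
qed

lemma stepR_eq_stepD: "0 < i \<Longrightarrow> stepR i = stepD j"
  by (auto simp: fun_eq_iff stepR_def stepD_def)

text \<open>A left step falls by at most one, so predecessors of \<open>g\<close> are at most g + 1.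
  The free bound \<open>N\<close> lets the duality argument use one summation range for all
  levels.\<close>

lemma pmf_chain_left_Suc:
  assumes "0 < r n" "0 < g" "g < N"
  shows "pmf (chain stepL r h (Suc n)) g =
    (\<Sum>f\<in>{1..N}. pmf (chain stepL r h n) f * poisz (r n) (int g + 1 - int f))"
proof -
  have "pmf (chain stepL r h (Suc n)) g =
      (\<Sum>f\<in>{1..N}. pmf (map_pmf (stepL n f) (poisson_pmf (r n))) g * pmf (chain stepL r h n) f)"
    using assms
    by (simp add: pmf_bind)
      (rule integral_measure_pmf_real, auto simp: pmf_map_stepL poisz_def split: if_splits)
  then show ?thesis using assms by (simp add: pmf_map_stepL mult.commute)
qed

text \<open>Forgetting the killing only increases weights, and the free walk has a Poisson total.
  Level 0 is excluded, since all killed paths accumulate there.\<close>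

lemma pmf_chain_left_le:
  assumes "\<And>i. i < n \<Longrightarrow> 0 < r i" "0 < g"
  shows "pmf (chain stepL r h n) g \<le> poisz (\<Sum>i<n. r i) (int g + int n - int h)"
  using assms
proof (induction n arbitrary: g)
  case 0
  then show ?case by (auto simp: poisz_def pois_def indicator_def)
next
  case (Suc n)
  have "pmf (chain stepL r h (Suc n)) g =
      (\<Sum>f\<in>{1..g + 1}. pmf (chain stepL r h n) f * poisz (r n) (int g + 1 - int f))"
    using Suc.prems by (intro pmf_chain_left_Suc) auto
  also have "\<dots> \<le> (\<Sum>f\<in>{1..g + 1}. poisz (\<Sum>i<n. r i) (int f + int n - int h) * poisz (r n) (int g + 1 - int f))"
    using Suc by (intro sum_mono mult_right_mono poisz_nonneg Suc.IH) (auto simp: less_imp_le)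
  also have "\<dots> = (\<Sum>f\<in>int ` {1..g + 1}. poisz (\<Sum>i<n. r i) (f - (int h - int n)) * poisz (r n) ((int g + 1) - f))"
    by (subst sum.reindex) (auto simp: algebra_simps)
  also have "\<dots> \<le> poisz ((\<Sum>i<n. r i) + r n) ((int g + 1) - (int h - int n))"
    using Suc.prems by (intro poisz_convolution_le) (auto intro!: sum_nonneg simp: less_imp_le)
  finally show ?case by (simp add: algebra_simps)
qed

lemma pmf_chain_stepD_above:
  assumes "h + n < g"
  shows "pmf (chain stepD r h n) g = 0"
proof -
  have "set_pmf (chain stepD r h n) \<subseteq> {..h + n}"
    by (induction n) (auto simp: stepD_def split: if_splits)
  then show ?thesis using assms by (auto simp: pmf_eq_0_set_pmf)
qed

lemma pmf_chain_stepD_le: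
  assumes "\<And>i. i < n \<Longrightarrow> 0 < r i" "0 < g"
  shows "pmf (chain stepD r h n) g \<le> poisz (\<Sum>i<n. r i) (int h + int n - int g)"
  using assms
proof (induction n arbitrary: g)
  case 0
  then show ?case by (auto simp: poisz_def pois_def indicator_def)
next
  case (Suc n)
  have "pmf (chain stepD r h (Suc n)) g =
      (\<Sum>f\<in>{1..h + n}. pmf (map_pmf (stepD n f) (poisson_pmf (r n))) g * pmf (chain stepD r h n) f)"
    unfolding chain.simps pmf_bind
  proof (rule integral_measure_pmf_real)
    fix f assume "f \<in> set_pmf (chain stepD r h n)" "pmf (map_pmf (stepD n f) (poisson_pmf (r n))) g \<noteq> 0"
    then show "f \<in> {1..h + n}"
      using pmf_chain_stepD_above[of h n f r] Suc.prems
      by (cases "f = 0"; cases "h + n < f") (auto simp: pmf_map_stepD set_pmf_iff)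
  qed simp
  also have "\<dots> \<le> (\<Sum>f\<in>{1..h + n}. poisz (r n) (int f + 1 - int g) * poisz (\<Sum>i<n. r i) (int h + int n - int f))"
    using Suc.prems by (intro sum_mono) (auto simp: pmf_map_stepD less_imp_le intro!: mult_left_mono poisz_nonneg Suc.IH)
  also have "\<dots> = (\<Sum>f\<in>int ` {1..h + n}. poisz (r n) (f - (int g - 1)) * poisz (\<Sum>i<n. r i) ((int h + int n) - f))"
    by (subst sum.reindex) (auto simp: algebra_simps)
  also have "\<dots> \<le> poisz (r n + (\<Sum>i<n. r i)) ((int h + int n) - (int g - 1))"
    using Suc.prems by (intro poisz_convolution_le) (auto intro!: sum_nonneg simp: less_imp_le)
  finally show ?case by (simp add: algebra_simps)
qed

lemma pmf_chain_stepR_above: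
  assumes "n < g"
  shows "pmf (rwalk r n) g = 0"
proof -
  have "set_pmf (rwalk r n) \<subseteq> {..n}"
    by (induction n) (auto simp: stepR_def split: if_splits)
  then show ?thesis using assms by (auto simp: pmf_eq_0_set_pmf)
qed

lemma pmf_chain_right_Suc:
  assumes "0 < r n" "0 < g" "0 < n"
  shows "pmf (rwalk r (Suc n)) g =
    (\<Sum>f\<in>{1..n}. pmf (rwalk r n) f * poisz (r n) (int f + 1 - int g))"
proof -
  have "pmf (rwalk r (Suc n)) g =
      (\<Sum>f\<in>{1..n}. pmf (map_pmf (stepD n f) (poisson_pmf (r n))) g * pmf (rwalk r n) f)"
    unfolding chain.simps pmf_bind stepR_eq_stepD[OF assms(3), of n]
  proof (rule integral_measure_pmf_real)
    fix f assume "f \<in> set_pmf (rwalk r n)" "pmf (map_pmf (stepD n f) (poisson_pmf (r n))) g \<noteq> 0"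
    then show "f \<in> {1..n}"
      using pmf_chain_stepR_above[of n f r] assms
      by (cases "f = 0"; cases "n < f") (auto simp: pmf_map_stepD set_pmf_iff)
  qed simp
  then show ?thesis using assms by (simp add: pmf_map_stepD mult.commute)
qed

lemma pmf_chain_right_1:
  assumes "0 < r 0" "0 < g"
  shows "pmf (rwalk r (Suc 0)) g = poisz (r 0) (1 - int g)"
proof -
  have "stepR 0 0 -` {g} = (if g = 1 then {0} else {})"
    using assms by (auto simp: stepR_def)
  then show ?thesis using assms
    by (auto simp: bind_return_pmf pmf_map measure_pmf_single poisz_def pois_def)
qed

lemma pmf_bind_ge:
  assumes "finite H"
  shows "(\<Sum>h\<in>H. pmf M h * pmf (K h) g) \<le> pmf (bind_pmf M K) g"
proof -
  have "(\<Sum>h\<in>H. pmf M h * pmf (K h) g) = (\<integral>h. pmf (K h) g * indicator H h \<partial>measure_pmf M)"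
    using assms by (subst integral_measure_pmf_real[of H]) (auto simp: mult.commute indicator_def split: if_splits)
  also have "\<dots> \<le> (\<integral>h. pmf (K h) g \<partial>measure_pmf M)"
    by (intro integral_mono measure_pmf.integrable_const_bound[where B = 1])
      (auto simp: pmf_le_1 split: split_indicator)
  finally show ?thesis by (simp add: pmf_bind)
qed

lemma pmf_bind_le_alive:
  assumes "pmf (K 0) g = 0" "\<And>h. 0 < h \<Longrightarrow> pmf (K h) g \<le> S"
  shows "pmf (bind_pmf M K) g \<le> S * alive M"
proof -
  have "(\<integral>h. pmf (K h) g \<partial>measure_pmf M) \<le> (\<integral>h. S * indicator {0<..} h \<partial>measure_pmf M)"
  proof (rule integral_mono)
    show "integrable (measure_pmf M) (\<lambda>h. pmf (K h) g)"
      by (rule measure_pmf.integrable_const_bound[where B = 1]) (auto simp: pmf_le_1)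
    show "integrable (measure_pmf M) (\<lambda>h. S * indicator {0<..} h)"
      by (rule measure_pmf.integrable_const_bound[where B = "\<bar>S\<bar>"]) (auto split: split_indicator)
    show "pmf (K h) g \<le> S * indicator {0<..} h" for h
      using assms by (cases "h = 0") auto
  qed
  then show ?thesis by (simp add: pmf_bind alive_def)
qed

text \<open>The living part of a killed walk, extended to the integers for comparison with a free
  walk, which may be negative.\<close>

definition alive_weight :: "nat pmf \<Rightarrow> int \<Rightarrow> real" where
  "alive_weight K g = (if 0 < g then pmf K (nat g) else 0)"

text \<open>Both laws have mass 1 and the living part of \<open>K\<close> lies below
  \<open>Q\<close> everywhere. The excess over all integers is therefore \<open>pmf K 0\<close>, and
  a restriction to \<open>I\<close> can only lower it.\<close>

lemma lost_mass_le:
  fixes K :: "nat pmf" and Q :: "int pmf"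
  assumes le: "\<And>g. 0 < g \<Longrightarrow> pmf K g \<le> pmf Q (int g)" and "finite I"
  shows "(\<Sum>g\<in>I. pmf Q g - alive_weight K g) \<le> pmf K 0"
proof -
  let ?K = "map_pmf int K" and ?J = "{g. 0 < g \<and> g \<notin> I}"
  have pK: "pmf ?K g = pmf K (nat g)" if "0 \<le> g" for g
    using pmf_map_inj'[of int K "nat g"] that by simp
  have "emeasure ?K ?J \<le> emeasure Q ?J"
    unfolding nn_integral_pmf[symmetric] using pK le
    by (intro nn_integral_mono ennreal_leI) (auto, metis zero_less_nat_eq int_nat_eq less_imp_le)
  then have J: "measure ?K ?J \<le> measure Q (- I)"
    unfolding measure_pmf.emeasure_eq_measure
    using measure_pmf.finite_measure_mono[of ?J "- I" Q] by (auto intro: order_trans)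
  have 1: "(\<Sum>g\<in>I. pmf Q g) = 1 - measure Q (- I)"
    using assms(2) measure_pmf.prob_compl[of I Q] by (simp add: measure_measure_pmf_finite Compl_eq_Diff_UNIV)
  have "(\<Sum>g\<in>I. alive_weight K g) = (\<Sum>g\<in>{g \<in> I. 0 < g}. pmf ?K g)"
    using assms(2) by (auto simp: alive_weight_def sum.inter_filter[symmetric] pK intro!: sum.cong)
  also have "\<dots> = measure ?K {g \<in> I. 0 < g}"
    using assms(2) by (simp add: measure_measure_pmf_finite del: measure_map_pmf)
  finally have 2: "(\<Sum>g\<in>I. alive_weight K g) = measure ?K {g \<in> I. 0 < g}" .
  have "measure ?K ({g \<in> I. 0 < g} \<union> ?J) = measure ?K {g \<in> I. 0 < g} + measure ?K ?J"
    by (rule measure_pmf.finite_measure_Union) auto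
  moreover have "measure ?K ({g \<in> I. 0 < g} \<union> ?J) = alive K"
    by (auto simp: alive_def intro!: arg_cong[where f = "measure_pmf.prob K"])
  ultimately have "measure ?K {g \<in> I. 0 < g} = 1 - pmf K 0 - measure ?K ?J"
    by (simp add: alive_eq)
  then show ?thesis using 1 2 J by (simp add: sum_subtractf)
qed

section \<open>Ballot bounds for monotone rates\<close>

text \<open>Conditionally on \<open>n\<close> balls in \<open>Suc m\<close> bins, the last bin receives \<open>n r / (R + r)\<close> of them on average.
  This is what drives the induction behind the ballot theorem.\<close>

lemma pois_convolution_affine:
  assumes "0 < R" "0 < r"
  shows "(\<Sum>i\<le>n. pois R i * (1 - a * real i) * pois r (n - i)) = pois (R + r) n * (1 - a * real n * R / (R + r))"
proof -
  have "(\<Sum>i\<le>n. real i * pois R i * pois r (n - i)) = real n * R / (R + r) * pois (R + r) n"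
  proof (cases n)
    case (Suc n')
    have "(\<Sum>i\<le>n. real i * pois R i * pois r (n - i)) = (\<Sum>i\<le>n'. real (Suc i) * pois R (Suc i) * pois r (n' - i))"
      unfolding Suc by (subst sum.atMost_Suc_shift) simp
    also have "\<dots> = (\<Sum>i\<le>n'. R * (pois R i * pois r (n' - i)))" by (simp only: pois_Suc mult.assoc)
    also have "\<dots> = R * pois (R + r) n'" by (simp add: sum_distrib_left[symmetric] pois_convolution)
    also have "\<dots> = real n * R / (R + r) * pois (R + r) n"
    proof -
      have "real n * pois (R + r) n = (R + r) * pois (R + r) n'" using pois_Suc[of n' "R + r"] by (simp add: Suc)
      then have "R / (R + r) * (real n * pois (R + r) n) = R * pois (R + r) n'" using assms by simp
      then show ?thesis by (simp add: mult_ac)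
    qed
    finally show ?thesis .
  qed simp
  moreover have "(\<Sum>i\<le>n. pois R i * (1 - a * real i) * pois r (n - i)) =
      (\<Sum>i\<le>n. pois R i * pois r (n - i)) - a * (\<Sum>i\<le>n. real i * pois R i * pois r (n - i))"
    by (simp add: sum_distrib_left sum_subtractf[symmetric] algebra_simps)
  ultimately show ?thesis by (simp add: pois_convolution algebra_simps)
qed

text \<open>Indexed by balls: level \<open>m - i\<close> after \<open>m\<close> steps means
  \<open>i\<close> balls so far. The case i = m would be level 0, which is dead.\<close>

lemma pmf_chain_right_step:
  assumes "0 < r m" "0 < m" "n \<le> m"
  shows "pmf (rwalk r (Suc m)) (Suc m - n) =
    (\<Sum>i\<le>n. (if i < m then pmf (rwalk r m) (m - i) else 0) * pois (r m) (n - i))"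
proof -
  have "pmf (rwalk r (Suc m)) (Suc m - n) =
      (\<Sum>f\<in>{1..m}. pmf (rwalk r m) f * poisz (r m) (int f + 1 - int (Suc m - n)))"
    using assms by (intro pmf_chain_right_Suc) auto
  also have "\<dots> = (\<Sum>f\<in>{1..m} \<inter> {m - n..m}. pmf (rwalk r m) f * poisz (r m) (int f + 1 - int (Suc m - n)))"
    using assms by (intro sum.mono_neutral_right) (auto simp: poisz_def)
  also have "\<dots> = (\<Sum>i\<in>{i. i \<le> n \<and> i < m}. pmf (rwalk r m) (m - i) * pois (r m) (n - i))"
  proof (rule sum.reindex_bij_witness[where i = "\<lambda>i. m - i" and j = "\<lambda>f. m - f"])
    fix f assume f: "f \<in> {1..m} \<inter> {m - n..m}"
    have "int f + 1 - int (Suc m - n) = int (n - (m - f))" using f assms by auto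
    then show "pmf (rwalk r m) (m - (m - f)) * pois (r m) (n - (m - f)) =
         pmf (rwalk r m) f * poisz (r m) (int f + 1 - int (Suc m - n))" using f
      by (simp only: poisz_of_nat) simp
  qed (use assms in auto)
  also have "\<dots> = (\<Sum>i\<in>{i. i \<le> n \<and> i < m}. (if i < m then pmf (rwalk r m) (m - i) else 0) * pois (r m) (n - i))"
    by (intro sum.cong) auto
  also have "\<dots> = (\<Sum>i\<le>n. (if i < m then pmf (rwalk r m) (m - i) else 0) * pois (r m) (n - i))"
    by (intro sum.mono_neutral_left) auto
  finally show ?thesis .
qed

text \<open>The convolution reproduces the slope: r 0 / R times R / (R + r m) is r 0 / (R + r m).
  Minimality of \<open>r 0\<close> makes the affine factor nonnegative at i = m, where no living
  mass is left. For equal rates the factor is 1 - n/m, as in the ballot theorem.\<close>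

lemma ballot_upper:
  assumes r: "\<And>i. i < m \<Longrightarrow> 0 < r i" "\<And>i. i < m \<Longrightarrow> r 0 \<le> r i" and m: "0 < m" "n < m"
  shows "pmf (rwalk r m) (m - n) \<le> pois (\<Sum>i<m. r i) n * (1 - r 0 / (\<Sum>i<m. r i) * real n)"
  using m(1,2) r
proof (induction m arbitrary: n rule: nat_induct_non_zero)
  case 1
  then show ?case using pmf_chain_right_1[of r 1] by (simp add: poisz_def)
next
  case (Suc m)
  define R where "R = (\<Sum>i<m. r i)"
  have R: "0 < R" unfolding R_def using Suc by (intro sum_pos) auto
  have "r 0 * real m \<le> R"
    unfolding R_def using sum_mono[of "{..<m}" "\<lambda>_. r 0" r] Suc.prems by (simp add: mult.commute)
  then have last: "0 \<le> 1 - r 0 / R * real m" using R by (simp add: field_simps)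
  have "pmf (rwalk r (Suc m)) (Suc m - n) =
      (\<Sum>i\<le>n. (if i < m then pmf (rwalk r m) (m - i) else 0) * pois (r m) (n - i))"
    using Suc by (intro pmf_chain_right_step) auto
  also have "\<dots> \<le> (\<Sum>i\<le>n. pois R i * (1 - r 0 / R * real i) * pois (r m) (n - i))"
  proof (intro sum_mono mult_right_mono pois_nonneg)
    fix i assume i: "i \<in> {..n}"
    show "(if i < m then pmf (rwalk r m) (m - i) else 0) \<le> pois R i * (1 - r 0 / R * real i)"
    proof (cases "i < m")
      case True
      then show ?thesis using Suc.IH[of i] Suc.prems by (simp add: R_def)
    next
      case False
      then have "i = m" using i Suc.prems by auto
      then show ?thesis using last pois_nonneg[of R m] R by auto
    qed
  qed (use Suc.prems in \<open>auto simp: less_imp_le\<close>)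
  also have "\<dots> = pois (R + r m) n * (1 - r 0 / R * real n * R / (R + r m))"
    using R Suc.prems by (intro pois_convolution_affine) auto
  finally show ?case using R by (simp add: R_def)
qed

text \<open>The factor 1 - i/m is zero at the dead level i = m, so nothing is lost there. Passing
  from 1/m to 1/(m + 1) needs R <= m * r m, which holds because the latest rate is the
  largest.\<close>

lemma ballot_lower:
  assumes r: "\<And>i. i < m \<Longrightarrow> 0 < r i" "\<And>i j. i \<le> j \<Longrightarrow> j < m \<Longrightarrow> r i \<le> r j" and m: "0 < m" "n < m"
  shows "pois (\<Sum>i<m. r i) n * (1 - real n / real m) \<le> pmf (rwalk r m) (m - n)"
  using m(1,2) r
proof (induction m arbitrary: n rule: nat_induct_non_zero)
  case 1
  then show ?case using pmf_chain_right_1[of r 1] by (simp add: poisz_def)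
next
  case (Suc m)
  define R where "R = (\<Sum>i<m. r i)"
  have R: "0 < R" unfolding R_def using Suc by (intro sum_pos) auto
  have rm: "0 < r m" using Suc.prems by simp
  have Rm: "R \<le> real m * r m"
    unfolding R_def using sum_mono[of "{..<m}" r "\<lambda>_. r m"] Suc.prems by simp
  have "pois (R + r m) n * (1 - real n / real (Suc m)) \<le> pois (R + r m) n * (1 - 1 / real m * real n * R / (R + r m))"
  proof (intro mult_left_mono pois_nonneg)
    have "R / (real m * (R + r m)) \<le> 1 / real (Suc m)"
      using Rm R rm Suc.hyps by (simp add: divide_simps) (simp add: algebra_simps)
    then have "real n * (R / (real m * (R + r m))) \<le> real n * (1 / real (Suc m))"
      by (intro mult_left_mono) auto
    then show "1 - real n / real (Suc m) \<le> 1 - 1 / real m * real n * R / (R + r m)" by simp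
  qed (use R rm in auto)
  also have "\<dots> = (\<Sum>i\<le>n. pois R i * (1 - 1 / real m * real i) * pois (r m) (n - i))"
    using R rm by (intro pois_convolution_affine[symmetric]) auto
  also have "\<dots> \<le> (\<Sum>i\<le>n. (if i < m then pmf (rwalk r m) (m - i) else 0) * pois (r m) (n - i))"
  proof (intro sum_mono mult_right_mono pois_nonneg)
    fix i assume i: "i \<in> {..n}"
    show "pois R i * (1 - 1 / real m * real i) \<le> (if i < m then pmf (rwalk r m) (m - i) else 0)"
    proof (cases "i < m")
      case True
      then show ?thesis using Suc.IH[of i] Suc.prems by (simp add: R_def)
    next
      case False
      then have "i = m" using i Suc.prems by auto
      then show ?thesis using Suc.hyps by simp
    qed
  qed (use rm in auto)
  also have "\<dots> = pmf (rwalk r (Suc m)) (Suc m - n)"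
    using Suc by (intro pmf_chain_right_step[symmetric]) auto
  finally show ?case by (simp add: R_def)
qed

text \<open>The right walk reads the bins backwards, so the two killed kernels are adjoint: handing
  one bin from the right walk to the left walk does not change the pairing over the meeting level.
  At j = 1 the right walk is on level 1 only if the last bin is empty, which gives the exponential
  factor.\<close>

lemma chain_duality:
  assumes r: "\<And>i. i < k \<Longrightarrow> 0 < r i" and "t + j = k" "0 < j"
  shows "(\<Sum>g\<in>{1..j}. pmf (lwalk r t) g * pmf (rwalk (\<lambda>i. r (k - 1 - i)) j) g) =
    pmf (lwalk r (k - 1)) 1 * exp (- r (k - 1))"
  using assms(3,2)
proof (induction j arbitrary: t rule: nat_induct_non_zero)
  case 1
  then have "t = k - 1" "0 < k" by auto
  then show ?case using pmf_chain_right_1[of "\<lambda>i. r (k - 1 - i)" 1] r[of "k - 1"]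
    by (simp add: poisz_def pois_def)
next
  case (Suc j)
  let ?a = "\<lambda>t. lwalk r t" and ?b = "rwalk (\<lambda>i. r (k - 1 - i))"
  have t: "k - 1 - j = t" "t < k" using Suc by auto
  have "(\<Sum>g\<in>{1..Suc j}. pmf (?a t) g * pmf (?b (Suc j)) g) =
     (\<Sum>g\<in>{1..Suc j}. \<Sum>f\<in>{1..j}. pmf (?a t) g * (pmf (?b j) f * poisz (r t) (int f + 1 - int g)))"
  proof (rule sum.cong[OF refl])
    fix g assume g: "g \<in> {1..Suc j}"
    have "pmf (?b (Suc j)) g = (\<Sum>f\<in>{1..j}. pmf (?b j) f * poisz (r t) (int f + 1 - int g))"
      using pmf_chain_right_Suc[of "\<lambda>i. r (k - 1 - i)" j g] g Suc.hyps r[of t] t by simp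
    then show "pmf (?a t) g * pmf (?b (Suc j)) g =
      (\<Sum>f\<in>{1..j}. pmf (?a t) g * (pmf (?b j) f * poisz (r t) (int f + 1 - int g)))"
      by (simp only: sum_distrib_left)
  qed
  also have "\<dots> = (\<Sum>f\<in>{1..j}. \<Sum>g\<in>{1..Suc j}. pmf (?a t) g * (pmf (?b j) f * poisz (r t) (int f + 1 - int g)))"
    by (rule sum.swap)
  also have "\<dots> = (\<Sum>f\<in>{1..j}. pmf (?a (Suc t)) f * pmf (?b j) f)"
  proof (rule sum.cong[OF refl])
    fix f assume f: "f \<in> {1..j}"
    have "pmf (?a (Suc t)) f = (\<Sum>g\<in>{1..Suc j}. pmf (?a t) g * poisz (r t) (int f + 1 - int g))"
      using f r[of t] t by (intro pmf_chain_left_Suc) auto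
    then show "(\<Sum>g\<in>{1..Suc j}. pmf (?a t) g * (pmf (?b j) f * poisz (r t) (int f + 1 - int g))) = pmf (?a (Suc t)) f * pmf (?b j) f"
      by (simp only: sum_distrib_left mult_ac)
  qed
  also have "\<dots> = pmf (lwalk r (k - 1)) 1 * exp (- r (k - 1))"
    using Suc.prems by (intro Suc.IH) auto
  finally show ?case .
qed

section \<open>Trees as parking functions\<close>

text \<open>Parking functions in which the number of balls may exceed the number \<open>t\<close> of
  bins. The value 0 outside \<open>J\<close> is no bin, so placements of different ball sets live in
  one function type.\<close>

definition parking :: "nat \<Rightarrow> nat set \<Rightarrow> (nat \<Rightarrow> nat) set" where
  "parking t J = {T \<in> PiE_dflt J 0 (\<lambda>_. {1..t}). \<forall>u\<in>{1..t}. u \<le> card {j \<in> J. T j \<le> u}}"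

text \<open>The weighted count of placements of n labelled balls, divided by n!. The last bin is
  split off with \<open>z\<close> balls; the test \<open>n < Suc t\<close> is the parking condition
  at that bin.\<close>

fun parking_weight :: "(nat \<Rightarrow> real) \<Rightarrow> nat \<Rightarrow> nat \<Rightarrow> real" where
  "parking_weight w 0 n = (if n = 0 then 1 else 0)"
| "parking_weight w (Suc t) n =
    (if n < Suc t then 0 else \<Sum>z\<le>n. parking_weight w t (n - z) * (w (Suc t) ^ z / fact z))"

lemma sum_Pow_card:
  fixes f :: "nat \<Rightarrow> real"
  assumes "finite J"
  shows "(\<Sum>I\<in>Pow J. f (card I)) = (\<Sum>z\<le>card J. real (card J choose z) * f z)"
proof -
  have "(\<Sum>z\<le>card J. \<Sum>I\<in>{I \<in> Pow J. card I = z}. f (card I)) = (\<Sum>I\<in>Pow J. f (card I))"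
    using assms by (intro sum.group) (auto intro: card_mono)
  moreover have "(\<Sum>I\<in>{I \<in> Pow J. card I = z}. f (card I)) = real (card J choose z) * f z" for z
    using n_subsets[OF assms, of z] by (simp add: Pow_def)
  ultimately show ?thesis by (simp only:)
qed

lemma finite_parking: "finite J \<Longrightarrow> finite (parking t J)"
  unfolding parking_def by (intro finite_Collect_conjI disjI1 finite_PiE_dflt) (auto simp: Collect_mem_eq)

text \<open>\<open>I\<close> is the set of balls in the last bin. The conditions up to
  \<open>t\<close> concern only the other balls, and the condition at \<open>Suc t\<close> is the
  assumption on \<open>card J\<close>.\<close>

lemma sum_parking_Suc:
  fixes w :: "nat \<Rightarrow> real"
  assumes J: "finite J" "Suc t \<le> card J"
  shows "(\<Sum>T\<in>parking (Suc t) J. \<Prod>j\<in>J. w (T j)) =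
    (\<Sum>I\<in>Pow J. w (Suc t) ^ card I * (\<Sum>T\<in>parking t (J - I). \<Prod>j\<in>J - I. w (T j)))"
proof -
  have "(\<Sum>I\<in>Pow J. w (Suc t) ^ card I * (\<Sum>T\<in>parking t (J - I). \<Prod>j\<in>J - I. w (T j))) =
      (\<Sum>(I, T)\<in>Sigma (Pow J) (\<lambda>I. parking t (J - I)). w (Suc t) ^ card I * (\<Prod>j\<in>J - I. w (T j)))"
    using J by (subst sum.Sigma[symmetric]) (auto simp: sum_distrib_left finite_parking)
  also have "\<dots> = (\<Sum>T\<in>parking (Suc t) J. \<Prod>j\<in>J. w (T j))"
  proof (rule sum.reindex_bij_witness[where
        j = "\<lambda>(I, T) j. if j \<in> I then Suc t else T j" and
        i = "\<lambda>T. ({j \<in> J. T j = Suc t}, \<lambda>j. if T j = Suc t then 0 else T j)"])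
    fix a assume a: "a \<in> Sigma (Pow J) (\<lambda>I. parking t (J - I))"
    obtain I T where IT: "a = (I, T)" "I \<subseteq> J" "T \<in> parking t (J - I)" using a by auto
    have T: "j \<in> J - I \<Longrightarrow> 1 \<le> T j \<and> T j \<le> t" "j \<notin> J - I \<Longrightarrow> T j = 0" for j
      using IT(3) by (auto simp: parking_def PiE_dflt_def)
    have neq: "T j \<noteq> Suc t" for j using T[of j] by (cases "j \<in> J - I") auto
    show "({j \<in> J. (case a of (I, T) \<Rightarrow> \<lambda>j. if j \<in> I then Suc t else T j) j = Suc t},
         \<lambda>j. if (case a of (I, T) \<Rightarrow> \<lambda>j. if j \<in> I then Suc t else T j) j = Suc t then 0
              else (case a of (I, T) \<Rightarrow> \<lambda>j. if j \<in> I then Suc t else T j) j) = a"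
      using IT neq T(2) by (auto simp: fun_eq_iff)
    have "u \<le> card {j \<in> J. (if j \<in> I then Suc t else T j) \<le> u}" if "u \<in> {1..Suc t}" for u
    proof (cases "u \<le> t")
      case True
      then have "{j \<in> J. (if j \<in> I then Suc t else T j) \<le> u} = {j \<in> J - I. T j \<le> u}" by auto
      then show ?thesis using IT(3) that True by (auto simp: parking_def)
    next
      case False
      then have "u = Suc t" using that by auto
      moreover have "{j \<in> J. (if j \<in> I then Suc t else T j) \<le> Suc t} = J"
        using T by auto (metis DiffI T(1) le_SucI)
      ultimately show ?thesis using J by simp
    qed
    then show "(case a of (I, T) \<Rightarrow> \<lambda>j. if j \<in> I then Suc t else T j) \<in> parking (Suc t) J"
      using IT T by (auto simp: parking_def PiE_dflt_def le_SucI)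
    have "(\<Prod>j\<in>J. w (if j \<in> I then Suc t else T j)) =
        (\<Prod>j\<in>J - I. w (if j \<in> I then Suc t else T j)) * (\<Prod>j\<in>I. w (if j \<in> I then Suc t else T j))"
      using IT J by (intro prod.subset_diff) auto
    also have "\<dots> = w (Suc t) ^ card I * (\<Prod>j\<in>J - I. w (T j))"
      by (simp add: mult.commute)
    finally show "(\<Prod>j\<in>J. w ((case a of (I, T) \<Rightarrow> \<lambda>j. if j \<in> I then Suc t else T j) j)) =
        (case a of (I, T) \<Rightarrow> w (Suc t) ^ card I * (\<Prod>j\<in>J - I. w (T j)))"
      using IT by simp
  next
    fix T assume T: "T \<in> parking (Suc t) J"
    then have TJ: "j \<in> J \<Longrightarrow> 1 \<le> T j \<and> T j \<le> Suc t" "j \<notin> J \<Longrightarrow> T j = 0" for j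
      by (auto simp: parking_def PiE_dflt_def)
    show "(case ({j \<in> J. T j = Suc t}, \<lambda>j. if T j = Suc t then 0 else T j) of
          (I, T) \<Rightarrow> \<lambda>j. if j \<in> I then Suc t else T j) = T"
      using TJ by (auto simp: fun_eq_iff) (metis nat.distinct(1))
    have "{j \<in> J - {j \<in> J. T j = Suc t}. (if T j = Suc t then 0 else T j) \<le> u} = {j \<in> J. T j \<le> u}"
      if "u \<in> {1..t}" for u using that by auto
    then show "({j \<in> J. T j = Suc t}, \<lambda>j. if T j = Suc t then 0 else T j)
        \<in> Sigma (Pow J) (\<lambda>I. parking t (J - I))"
      using T TJ by (auto simp: parking_def PiE_dflt_def le_Suc_eq)
  qed
  finally show ?thesis by simp
qed

lemma sum_parking:
  assumes "finite J"
  shows "(\<Sum>T\<in>parking t J. \<Prod>j\<in>J. w (T j)) = fact (card J) * parking_weight w t (card J)"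
  using assms
proof (induction t arbitrary: J)
  case 0
  have "parking 0 J = (if J = {} then {\<lambda>_. 0} else {})"
    by (auto simp: parking_def PiE_dflt_def)
  then show ?case using 0 by simp
next
  case (Suc t)
  show ?case
  proof (cases "card J < Suc t")
    case True
    have "T \<notin> parking (Suc t) J" for T
    proof
      assume "T \<in> parking (Suc t) J"
      then have "Suc t \<le> card {j \<in> J. T j \<le> Suc t}" by (auto simp: parking_def)
      moreover have "card {j \<in> J. T j \<le> Suc t} \<le> card J" using Suc.prems by (intro card_mono) auto
      ultimately show False using True by simp
    qed
    then have "parking (Suc t) J = {}" by auto
    then show ?thesis using True by simp
  next
    case False
    define n where "n = card J"
    define f where "f = (\<lambda>z. w (Suc t) ^ z * (fact (n - z) * parking_weight w t (n - z)))"
    have "(\<Sum>T\<in>parking (Suc t) J. \<Prod>j\<in>J. w (T j)) =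
      (\<Sum>I\<in>Pow J. w (Suc t) ^ card I * (\<Sum>T\<in>parking t (J - I). \<Prod>j\<in>J - I. w (T j)))"
      using Suc.prems False by (intro sum_parking_Suc) auto
    also have "\<dots> = (\<Sum>I\<in>Pow J. f (card I))"
      using Suc.prems
      by (intro sum.cong refl) (simp add: Suc.IH f_def n_def card_Diff_subset finite_subset)
    also have "\<dots> = (\<Sum>z\<le>n. real (n choose z) * f z)"
      unfolding n_def by (rule sum_Pow_card[OF Suc.prems])
    also have "\<dots> = (\<Sum>z\<le>n. fact n * (parking_weight w t (n - z) * (w (Suc t) ^ z / fact z)))"
      by (intro sum.cong refl) (simp add: f_def binomial_fact)
    also have "\<dots> = fact n * parking_weight w (Suc t) n"
      using False by (simp add: sum_distrib_left n_def)
    finally show ?thesis by (simp add: n_def)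
  qed
qed

lemma parking_weight_eq_0: "n < t \<Longrightarrow> parking_weight w t n = 0"
  by (cases t) auto

text \<open>Level \<open>g\<close> after \<open>t\<close> steps means g + t - 1 balls so far. With
  rates proportional to the weights, the power of \<open>K\<close> depends only on that number, and
  the Poisson factorials are those of the recursion.\<close>

lemma pmf_chain_left_eq_parking_weight:
  assumes w: "\<And>i. i < t \<Longrightarrow> 0 < w (Suc i)" and K: "0 < K" and r: "\<And>i. i < t \<Longrightarrow> r i = K * w (Suc i)" and g: "0 < g"
  shows "pmf (lwalk r t) g =
    exp (- (\<Sum>i<t. r i)) * K ^ (g + t - 1) * parking_weight w t (g + t - 1)"
  using w r g
proof (induction t arbitrary: g)
  case 0
  then show ?case by (auto simp: indicator_def)
next
  case (Suc t)
  define n where "n = g + t"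
  have rt: "0 < r t" "r t = K * w (Suc t)" using Suc.prems K by auto
  have "pmf (lwalk r (Suc t)) g =
      (\<Sum>f\<in>{1..g + 1}. pmf (lwalk r t) f * poisz (r t) (int g + 1 - int f))"
    using Suc.prems rt by (intro pmf_chain_left_Suc) auto
  also have "\<dots> = (\<Sum>f\<in>{1..g + 1}. exp (- (\<Sum>i<t. r i)) * K ^ (f + t - 1) * parking_weight w t (f + t - 1) * pois (r t) (g + 1 - f))"
  proof (intro sum.cong refl)
    fix f assume f: "f \<in> {1..g + 1}"
    have "int g + 1 - int f = int (g + 1 - f)" using f by auto
    then show "pmf (lwalk r t) f * poisz (r t) (int g + 1 - int f) =
      exp (- (\<Sum>i<t. r i)) * K ^ (f + t - 1) * parking_weight w t (f + t - 1) * pois (r t) (g + 1 - f)"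
      using f Suc by (simp only: poisz_of_nat) (subst Suc.IH, auto)
  qed
  also have "\<dots> = (\<Sum>z\<in>{..g}. exp (- (\<Sum>i<t. r i)) * K ^ (n - z) * parking_weight w t (n - z) * pois (r t) z)"
    by (rule sum.reindex_bij_witness[where i = "\<lambda>z. g + 1 - z" and j = "\<lambda>f. g + 1 - f"])
      (auto simp: n_def Suc_diff_le add.commute[of t])
  \<comment> \<open>For z > g fewer than \<open>t\<close> balls remain for the first
    \<open>t\<close> bins, so the added terms vanish.\<close>
  also have "\<dots> = (\<Sum>z\<in>{..n}. exp (- (\<Sum>i<t. r i)) * K ^ (n - z) * parking_weight w t (n - z) * pois (r t) z)"
    by (intro sum.mono_neutral_left) (auto simp: n_def parking_weight_eq_0)
  also have "\<dots> = (\<Sum>z\<in>{..n}. exp (- (\<Sum>i<Suc t. r i)) * K ^ n * (parking_weight w t (n - z) * (w (Suc t) ^ z / fact z)))"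
  proof (intro sum.cong refl)
    fix z assume z: "z \<in> {..n}"
    have "K ^ n = K ^ (n - z) * K ^ z" using z by (simp add: power_add[symmetric])
    moreover have "exp (- (\<Sum>i<Suc t. r i)) = exp (- (\<Sum>i<t. r i)) * exp (- r t)"
      by (simp add: exp_add[symmetric])
    ultimately show "exp (- (\<Sum>i<t. r i)) * K ^ (n - z) * parking_weight w t (n - z) * pois (r t) z =
        exp (- (\<Sum>i<Suc t. r i)) * K ^ n * (parking_weight w t (n - z) * (w (Suc t) ^ z / fact z))"
      by (simp add: pois_def rt(2) power_mult_distrib del: sum.lessThan_Suc)
  qed
  also have "\<dots> = exp (- (\<Sum>i<Suc t. r i)) * K ^ n * parking_weight w (Suc t) n"
    using Suc.prems by (simp add: sum_distrib_left n_def del: sum.lessThan_Suc)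
  finally show ?case by (simp add: n_def)
qed

lemma leftwalk_bin_count:
  assumes "\<And>j. j < k - 1 \<Longrightarrow> 1 \<le> T j"
  shows "leftwalk (bin_count k T) u = 1 + int (card {j. j < k - 1 \<and> T j \<le> u}) - int u"
proof (induction u)
  case 0
  have "{j. j < k - 1 \<and> T j = 0} = {}" using assms by fastforce
  then show ?case by simp
next
  case (Suc u)
  have "{j. j < k - 1 \<and> T j \<le> Suc u} = {j. j < k - 1 \<and> T j \<le> u} \<union> {j. j < k - 1 \<and> T j = Suc u}"
    by auto
  then have "card {j. j < k - 1 \<and> T j \<le> Suc u} = card {j. j < k - 1 \<and> T j \<le> u} + bin_count k T (Suc u)"
    by (simp add: bin_count_def card_Un_disjoint disjoint_iff)
  then show ?case using Suc by simp
qed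

section \<open>From the tree event to a walk weight\<close>

lemma set_tilted_bin:
  assumes "0 < p" "p < 1" "1 \<le> k"
  shows "set_pmf (tilted_bin_pmf p k) = {1..k}"
proof -
  have "(1 - p) ^ k < 1" using assms by (simp add: power_less_one_iff)
  then show ?thesis using assms by (auto simp: set_pmf_eq pmf_tilted_bin)
qed

lemma set_placement:
  assumes "0 < p" "p < 1" "1 \<le> k"
  shows "set_pmf (placement_pmf p k) = PiE_dflt {..<k - 1} 0 (\<lambda>_. {1..k})"
  unfolding placement_pmf_def by (simp add: set_Pi_pmf set_tilted_bin[OF assms] o_def)

lemma prob_TREE_eq_parking_weight:
  assumes p: "0 < p" "p < 1" and k: "2 \<le> k"
  shows "measure_pmf.prob (placement_pmf p k) (TREE k) =
    fact (k - 1) * parking_weight (pmf (tilted_bin_pmf p k)) (k - 1) (k - 1)"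
proof -
  have eq: "TREE k \<inter> set_pmf (placement_pmf p k) = parking (k - 1) {..<k - 1}"
  proof (intro equalityI subsetI)
    fix T assume T: "T \<in> TREE k \<inter> set_pmf (placement_pmf p k)"
    then have T1: "j < k - 1 \<Longrightarrow> 1 \<le> T j" "j \<ge> k - 1 \<Longrightarrow> T j = 0" for j
      using set_placement[OF p, of k] k by (auto simp: PiE_dflt_def)
    have le: "u \<le> card {j. j < k - 1 \<and> T j \<le> u}" if "u \<in> {1..k - 1}" for u
    proof -
      have "0 < leftwalk (bin_count k T) u" using T that by (auto simp: TREE_def)
      then show ?thesis using leftwalk_bin_count[of k T u, OF T1(1)] by simp
    qed
    \<comment> \<open>The condition at time k - 1 forces all k - 1 balls into the first k - 1 bins,
      so bin \<open>k\<close> is empty.\<close>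
    have "card {..<k - 1} \<le> card {j. j < k - 1 \<and> T j \<le> k - 1}" using le[of "k - 1"] k by simp
    then have "{j. j < k - 1 \<and> T j \<le> k - 1} = {..<k - 1}"
      by (intro card_seteq) auto
    then have "j < k - 1 \<Longrightarrow> T j \<le> k - 1" for j by auto
    then show "T \<in> parking (k - 1) {..<k - 1}"
      using T1 le by (auto simp: parking_def PiE_dflt_def)
  next
    fix T assume T: "T \<in> parking (k - 1) {..<k - 1}"
    then have T1: "j < k - 1 \<Longrightarrow> 1 \<le> T j \<and> T j \<le> k - 1" "j \<ge> k - 1 \<Longrightarrow> T j = 0" for j
      by (auto simp: parking_def PiE_dflt_def)
    have "T \<in> set_pmf (placement_pmf p k)"
      using T1 set_placement[OF p, of k] k by (fastforce simp: PiE_dflt_def)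
    moreover have "T \<in> TREE k"
      using T leftwalk_bin_count[of k T] T1 by (fastforce simp: TREE_def parking_def)
    ultimately show "T \<in> TREE k \<inter> set_pmf (placement_pmf p k)" by simp
  qed
  have "measure_pmf.prob (placement_pmf p k) (TREE k) = measure_pmf.prob (placement_pmf p k) (parking (k - 1) {..<k - 1})"
    by (metis eq measure_Int_set_pmf)
  also have "\<dots> = (\<Sum>T\<in>parking (k - 1) {..<k - 1}. pmf (placement_pmf p k) T)"
    by (rule measure_measure_pmf_finite) (simp add: finite_parking)
  also have "\<dots> = (\<Sum>T\<in>parking (k - 1) {..<k - 1}. \<Prod>j\<in>{..<k - 1}. pmf (tilted_bin_pmf p k) (T j))"
    unfolding placement_pmf_def
    by (intro sum.cong refl) (auto simp: pmf_Pi parking_def PiE_dflt_def)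
  also have "\<dots> = fact (k - 1) * parking_weight (pmf (tilted_bin_pmf p k)) (k - 1) (k - 1)"
    using sum_parking[of "{..<k - 1}" "pmf (tilted_bin_pmf p k)" "k - 1"] by simp
  finally show ?thesis .
qed

lemma rate_left_power_eq:
  assumes "0 < p" "p < 1" "1 \<le> k" "i < k"
  shows "rate_left p k * (1 - p) ^ i = (real k - 1) * pmf (tilted_bin_pmf p k) (Suc i)"
  using assms by (simp add: pmf_tilted_bin rate_left_def)

lemma sum_rates:
  assumes "0 < p" "p < 1" "1 \<le> k"
  shows "(\<Sum>i<k. rate_left p k * (1 - p) ^ i) = real k - 1"
proof -
  have "(1 - p) ^ k < 1" using assms by (simp add: power_less_one_iff)
  moreover have "p * (\<Sum>i<k. (1 - p) ^ i) = 1 - (1 - p) ^ k"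
    using assms by (simp add: one_diff_power_eq)
  moreover have "(\<Sum>i<k. rate_left p k * (1 - p) ^ i) =
      (real k - 1) * (p * (\<Sum>i<k. (1 - p) ^ i)) / (1 - (1 - p) ^ k)"
    unfolding sum_distrib_left[symmetric] by (simp add: rate_left_def)
  ultimately show ?thesis by simp
qed

lemma rate_left_pos:
  assumes "0 < p" "p < 1" "2 \<le> k"
  shows "0 < rate_left p k"
proof -
  have "(1 - p) ^ k < 1" using assms by (simp add: power_less_one_iff)
  then show ?thesis using assms by (simp add: rate_left_def)
qed

text \<open>Multinomial counts are independent Poisson variables conditioned on their sum; the
  weight of that sum stays as a factor on the left. On the right the first k - 1 bins hold all the
  balls, and the exponential is the probability that the last bin is empty.\<close>

lemma prob_TREE_chain:
  assumes p: "0 < p" "p < 1" and k: "2 \<le> k"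
  defines "r \<equiv> \<lambda>i. rate_left p k * (1 - p) ^ i"
  shows "measure_pmf.prob (placement_pmf p k) (TREE k) * pois (real (k - 1)) (k - 1) =
    pmf (lwalk r (k - 1)) 1 * exp (- r (k - 1))"
proof -
  let ?w = "pmf (tilted_bin_pmf p k)"
  have w: "0 < ?w (Suc i)" if "i < k - 1" for i
    using that p k set_tilted_bin[of p k] by (auto simp: pmf_positive_iff)
  have rw: "r i = real (k - 1) * ?w (Suc i)" if "i < k - 1" for i
    unfolding r_def using that p k by (subst rate_left_power_eq) (auto simp: of_nat_diff)
  have "(\<Sum>i<Suc (k - 1). r i) = real (k - 1)"
    unfolding r_def using sum_rates[of p k] p k by (simp add: of_nat_diff)
  then have s: "(\<Sum>i<k - 1. r i) + r (k - 1) = real (k - 1)" by simp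
  have "pmf (lwalk r (k - 1)) 1 =
      exp (- (\<Sum>i<k - 1. r i)) * real (k - 1) ^ (1 + (k - 1) - 1) * parking_weight ?w (k - 1) (1 + (k - 1) - 1)"
    using w rw k by (intro pmf_chain_left_eq_parking_weight) auto
  then have "pmf (lwalk r (k - 1)) 1 * exp (- r (k - 1)) =
      (exp (- (\<Sum>i<k - 1. r i)) * exp (- r (k - 1))) * real (k - 1) ^ (k - 1) * parking_weight ?w (k - 1) (k - 1)"
    by simp
  also have "exp (- (\<Sum>i<k - 1. r i)) * exp (- r (k - 1)) = exp (- real (k - 1))"
    unfolding s[symmetric] by (simp add: exp_add[symmetric])
  finally show ?thesis
    using prob_TREE_eq_parking_weight[OF p k] by (simp add: pois_def)
qed

section \<open>Bounds for the tree probability\<close>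

lemma alive_right_eq:
  assumes "0 < m"
  shows "alive (rwalk r m) = (\<Sum>n<m. pmf (rwalk r m) (m - n))"
proof -
  let ?M = "rwalk r m"
  have "alive ?M = measure_pmf.prob ?M ({0<..} \<inter> {..m})"
  proof -
    have "{0<..} \<inter> set_pmf ?M = {0<..} \<inter> {..m} \<inter> set_pmf ?M"
      using pmf_chain_stepR_above[of m _ r] by (auto simp: set_pmf_iff) (metis not_le)
    then show ?thesis unfolding alive_def by (metis measure_Int_set_pmf)
  qed
  also have "\<dots> = (\<Sum>g\<in>{0<..} \<inter> {..m}. pmf ?M g)" by (rule measure_measure_pmf_finite) simp
  also have "\<dots> = (\<Sum>n<m. pmf ?M (m - n))"
    by (rule sum.reindex_bij_witness[where i = "\<lambda>n. m - n" and j = "\<lambda>g. m - g"]) (use assms in auto)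
  finally show ?thesis .
qed

lemma pois_finite_sum_le:
  assumes "0 \<le> l" "finite A" "\<And>n. 0 \<le> f n" "(\<lambda>n. f n * pois l n) sums s"
  shows "(\<Sum>n\<in>A. f n * pois l n) \<le> s"
  using assms by (intro sum_le_suminf[where f = "\<lambda>n. f n * pois l n", THEN order_trans])
    (auto simp: sums_iff intro!: mult_nonneg_nonneg pois_nonneg)

text \<open>With A = r 0 the ballot factor is 1 - A + A (R - n) / R. The positive part of R - n has
  mean at most sqrt R, and R >= A m with A <= 1 turns A / sqrt R into 1 / sqrt m.\<close>

lemma alive_right_le:
  assumes r: "\<And>i. i < m \<Longrightarrow> 0 < r i" "\<And>i. i < m \<Longrightarrow> r 0 \<le> r i" and "r 0 \<le> 1" "0 < m"
  shows "alive (rwalk r m) \<le> 1 - r 0 + 1 / sqrt (real m)"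
proof -
  define R where "R = (\<Sum>i<m. r i)"
  define A where "A = r 0"
  have A: "0 < A" "A \<le> 1" using assms by (auto simp: A_def)
  have RA: "A * real m \<le> R"
    unfolding R_def A_def using sum_mono[of "{..<m}" "\<lambda>_. r 0" r] r by (simp add: mult.commute)
  have R: "0 < R" using RA A assms by (smt (verit) mult_pos_pos of_nat_0_less_iff)
  \<comment> \<open>A nonnegative majorant, so that the finite sum extends to all \<open>n\<close>.
    It bounds R - n by the arithmetic-geometric mean inequality, balanced at deviation sqrt
    R.\<close>
  define f where "f = (\<lambda>n. (1 - A) + A / R * (((0 + (real n - R))\<^sup>2 / sqrt R + sqrt R) / 2))"
  have f0: "0 \<le> f n" for n using A R by (auto simp: f_def)
  have fb: "1 - A / R * real n \<le> f n" for n
  proof -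
    have "0 \<le> ((R - real n) / sqrt (sqrt R) - sqrt (sqrt R))\<^sup>2" by simp
    also have "\<dots> = (real n - R)\<^sup>2 / sqrt R + sqrt R - 2 * (R - real n)"
      using R by (simp add: power2_diff power_divide power2_commute)
    finally have "R - real n \<le> ((0 + (real n - R))\<^sup>2 / sqrt R + sqrt R) / 2" by simp
    then have "A / R * (R - real n) \<le> A / R * (((0 + (real n - R))\<^sup>2 / sqrt R + sqrt R) / 2)"
      using A R by (intro mult_left_mono) auto
    moreover have "A / R * (R - real n) = A - A / R * real n" using R by (simp add: field_simps)
    ultimately show ?thesis by (simp add: f_def)
  qed
  have "(\<lambda>n. (1 - A + A / R * (sqrt R / 2)) * pois R n + A / R / sqrt R / 2 * ((0 + (real n - R))\<^sup>2 * pois R n)) sums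
     ((1 - A + A / R * (sqrt R / 2)) * 1 + A / R / sqrt R / 2 * (0\<^sup>2 + R))"
    by (intro sums_add sums_mult pois_sums pois_sums_variance)
  moreover have "(1 - A + A / R * (sqrt R / 2)) * pois R n + A / R / sqrt R / 2 * ((0 + (real n - R))\<^sup>2 * pois R n) = f n * pois R n" for n
    by (simp add: f_def algebra_simps add_divide_distrib)
  moreover have "(1 - A + A / R * (sqrt R / 2)) * 1 + A / R / sqrt R / 2 * (0\<^sup>2 + R) = 1 - A + A / sqrt R"
  proof -
    have "A / R * (sqrt R / 2) = A / sqrt R / 2" using R by (simp add: field_simps)
    moreover have "A / R / sqrt R / 2 * (0\<^sup>2 + R) = A / sqrt R / 2" using R by simp
    ultimately show ?thesis by (simp add: field_simps)
  qed
  ultimately have fs: "(\<lambda>n. f n * pois R n) sums (1 - A + A / sqrt R)" by (simp only:)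
  have "alive (rwalk r m) \<le> (\<Sum>n<m. pois R n * (1 - A / R * real n))"
    unfolding alive_right_eq[OF assms(4)] R_def A_def
    using assms by (intro sum_mono ballot_upper) auto
  also have "\<dots> \<le> (\<Sum>n<m. f n * pois R n)"
    using R by (subst mult.commute) (intro sum_mono mult_right_mono fb pois_nonneg, auto)
  also have "\<dots> \<le> 1 - A + A / sqrt R"
    using R f0 fs by (intro pois_finite_sum_le) auto
  also have "A / sqrt R \<le> 1 / sqrt (real m)"
  proof -
    have "A * sqrt (real m) \<le> sqrt A * sqrt (real m)"
      using A by (intro mult_right_mono) (auto simp: real_le_rsqrt power2_eq_square mult_left_le)
    also have "\<dots> \<le> sqrt R" using RA by (simp add: real_sqrt_mult[symmetric])
    finally show ?thesis using R assms by (simp add: field_simps)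
  qed
  finally show ?thesis by (simp add: A_def)
qed

text \<open>Subtracting a quadratic pushes the affine ballot factor below 0 outside the window. The
  error is then proportional to 1 - R/m, apart from R / (x m); an absolute error R / x^2 could
  exceed the escape probability.\<close>

lemma right_good_ge:
  assumes r: "\<And>i. i < m \<Longrightarrow> 0 < r i" "\<And>i j. i \<le> j \<Longrightarrow> j < m \<Longrightarrow> r i \<le> r j" and m: "0 < m"
    and x: "0 < x" and R: "R = (\<Sum>i<m. r i)" "R \<le> real m"
  shows "(1 - R / m) * (1 - R / x\<^sup>2) - R / (x * m) \<le>
    (\<Sum>n\<in>{n. n < m \<and> \<bar>real n - R\<bar> \<le> x}. pmf (rwalk r m) (m - n))"
proof -
  let ?G = "{n. n < m \<and> \<bar>real n - R\<bar> \<le> x}"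
  have R0: "0 < R" unfolding R using r m by (intro sum_pos) auto
  \<comment> \<open>At deviation d > x the first summand times d^2 covers 1 - R/m, and the second
    covers the excess d/m.\<close>
  define B where "B = (1 - R / m) / x\<^sup>2 + 1 / (x * m)"
  have B: "0 \<le> B" using R x m by (auto simp: B_def)
  define f where "f = (\<lambda>n. if n \<in> ?G then 1 - real n / m else 0)"
  have fb: "(1 - real n / m) - B * (0 + (real n - R))\<^sup>2 \<le> f n" for n
  proof (cases "\<bar>real n - R\<bar> \<le> x")
    case True
    have "0 \<le> B * (0 + (real n - R))\<^sup>2" using B by simp
    moreover have "1 - real n / m \<le> 0" if "\<not> n < m" using that m by (simp add: field_simps)
    ultimately show ?thesis using True by (auto simp: f_def)
  next
    case False
    define d where "d = \<bar>real n - R\<bar>"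
    have d: "x < d" using False by (simp add: d_def)
    then have "1 \<le> (d / x)\<^sup>2" using x by (intro one_le_power) auto
    then have 1: "(1 - R / m) * 1 \<le> (1 - R / m) * (d\<^sup>2 / x\<^sup>2)"
      using R m by (intro mult_left_mono) (auto simp: power_divide)
    have "d * 1 \<le> d * (d / x)" using d x by (intro mult_left_mono) auto
    then have "d / m \<le> d * (d / x) / m" by (intro divide_right_mono) auto
    moreover have "1 - real n / m \<le> (1 - R / m) + d / m"
    proof -
      have "(R - real n) / m \<le> d / m" by (intro divide_right_mono) (auto simp: d_def)
      then show ?thesis by (simp add: diff_divide_distrib)
    qed
    ultimately have "1 - real n / m \<le> B * d\<^sup>2"
      using 1 by (simp add: B_def distrib_right power2_eq_square)
    then show ?thesis using False by (auto simp: f_def d_def)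
  qed
  have "(\<lambda>n. 1 * pois R n - 1 / m * (real n * pois R n) - B * ((0 + (real n - R))\<^sup>2 * pois R n)) sums (1 * 1 - 1 / m * R - B * (0\<^sup>2 + R))"
    by (intro sums_diff sums_mult pois_sums pois_sums_mean pois_sums_variance)
  then have s1: "(\<lambda>n. ((1 - real n / m) - B * (0 + (real n - R))\<^sup>2) * pois R n) sums (1 - R / m - B * R)"
    by (simp add: algebra_simps)
  have s2: "(\<lambda>n. f n * pois R n) sums (\<Sum>n\<in>?G. f n * pois R n)"
    by (rule sums_finite) (auto simp: f_def)
  have "1 - R / m - B * R \<le> (\<Sum>n\<in>?G. f n * pois R n)"
    using R0 by (intro sums_le[OF _ s1 s2] mult_right_mono fb pois_nonneg) auto
  also have "\<dots> \<le> (\<Sum>n\<in>?G. pmf (rwalk r m) (m - n))"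
    using ballot_lower[of m r] assms unfolding R(1)
    by (intro sum_mono) (auto simp: f_def mult.commute)
  also have "1 - R / m - B * R = (1 - R / m) * (1 - R / x\<^sup>2) - R / (x * m)"
    by (simp add: B_def algebra_simps)
  finally show ?thesis .
qed

text \<open>The left side is the mean of 1 - n/m; terms with n >= m are nonpositive, so cutting them
  off increases the sum.\<close>

lemma alive_right_ge:
  assumes r: "\<And>i. i < m \<Longrightarrow> 0 < r i" "\<And>i j. i \<le> j \<Longrightarrow> j < m \<Longrightarrow> r i \<le> r j" and m: "0 < m"
  shows "1 - (\<Sum>i<m. r i) / m \<le> alive (rwalk r m)"
proof -
  define R where "R = (\<Sum>i<m. r i)"
  have R0: "0 < R" unfolding R_def using r m by (intro sum_pos) auto
  have "(\<lambda>n. 1 * pois R n - 1 / m * (real n * pois R n)) sums (1 * 1 - 1 / m * R)"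
    by (intro sums_diff sums_mult pois_sums pois_sums_mean)
  then have s1: "(\<lambda>n. (1 - real n / m) * pois R n) sums (1 - R / m)"
    by (simp add: algebra_simps)
  have s2: "(\<lambda>n. (if n < m then 1 - real n / m else 0) * pois R n) sums (\<Sum>n\<in>{..<m}. (if n < m then 1 - real n / m else 0) * pois R n)"
    by (rule sums_finite) auto
  have "1 - R / m \<le> (\<Sum>n\<in>{..<m}. (if n < m then 1 - real n / m else 0) * pois R n)"
    using R0 m by (intro sums_le[OF _ s1 s2] mult_right_mono pois_nonneg) auto
  also have "\<dots> \<le> alive (rwalk r m)"
    unfolding alive_right_eq[OF m] R_def
    using ballot_lower[of m r] assms by (intro sum_mono) (auto simp: mult.commute)
  finally show ?thesis by (simp add: R_def)
qed

text \<open>Chebyshev's inequality on the survivors, around the mean \<open>c\<close> of the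
  unkilled walk.\<close>

lemma left_good_ge:
  assumes r: "\<And>i. i < m \<Longrightarrow> 0 < r i" and x: "0 < x"
  defines "c \<equiv> 1 + (\<Sum>i<m. r i - 1)"
  shows "alive (lwalk r m) - (\<Sum>i<m. r i * alive (lwalk r i)) / x\<^sup>2 \<le>
    (\<Sum>h\<in>{h. 0 < h \<and> \<bar>real h - c\<bar> \<le> x}. pmf (lwalk r m) h)"
proof -
  let ?M = "lwalk r m" and ?G = "{h. 0 < h \<and> \<bar>real h - c\<bar> \<le> x}" and ?B = "{h. 0 < h \<and> x < \<bar>real h - c\<bar>}"
  have "?G \<subseteq> {..nat \<lceil>c + x\<rceil>}" by (auto simp: le_nat_iff) linarith
  then have fin: "finite ?G" by (rule finite_subset) simp
  have "ennreal (x\<^sup>2 * measure ?M ?B) = (\<integral>\<^sup>+g. ennreal (x\<^sup>2) * indicator ?B g \<partial>?M)"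
    by (simp add: nn_integral_cmult measure_pmf.emeasure_eq_measure ennreal_mult)
  also have "\<dots> \<le> (\<integral>\<^sup>+g. (if g = 0 then 0 else ennreal ((real g - c)\<^sup>2)) \<partial>?M)"
    using x by (intro nn_integral_mono) (auto simp: indicator_def abs_le_square_iff[symmetric] intro!: ennreal_leI)
  also have "\<dots> \<le> ennreal (\<Sum>i<m. r i * alive (lwalk r i))"
    unfolding c_def by (rule second_moment_left[OF r])
  finally have "x\<^sup>2 * measure ?M ?B \<le> (\<Sum>i<m. r i * alive (lwalk r i))"
    using r alive_nonneg by (subst (asm) ennreal_le_iff) (auto intro!: sum_nonneg mult_nonneg_nonneg simp: less_imp_le)
  then have 1: "measure ?M ?B \<le> (\<Sum>i<m. r i * alive (lwalk r i)) / x\<^sup>2"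
    using x by (simp add: field_simps)
  have "alive ?M = measure ?M (?G \<union> ?B)"
    unfolding alive_def by (rule arg_cong[where f = "measure_pmf.prob _"]) auto
  also have "\<dots> = measure ?M ?G + measure ?M ?B"
    by (rule measure_pmf.finite_measure_Union) auto
  finally show ?thesis using 1 fin by (simp add: measure_measure_pmf_finite)
qed

lemma poisz_le_sqrt':
  assumes "1 \<le> N" "real N \<le> l" "l \<le> real n"
  shows "poisz l i \<le> sqrt (real n / real N) * pois (real n) n"
proof -
  have "N \<le> nat \<lfloor>l\<rfloor>" using assms by (simp add: le_nat_iff le_floor_iff)
  then have "sqrt (real n / real (nat \<lfloor>l\<rfloor>)) \<le> sqrt (real n / real N)"
    using assms by (intro real_sqrt_le_mono divide_left_mono) auto
  then have "sqrt (real n / real (nat \<lfloor>l\<rfloor>)) * pois (real n) n \<le> sqrt (real n / real N) * pois (real n) n"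
    by (intro mult_right_mono pois_nonneg) auto
  then show ?thesis using poisz_le_sqrt[of l n i] assms by linarith
qed

section \<open>Splitting the walk into end blocks and a middle stretch\<close>

lemma chain_stepL_0: "chain stepL r 0 n = return_pmf 0"
  by (induction n) (simp_all add: bind_return_pmf stepL_def)

lemma sum_rev_rates:
  fixes r :: "nat \<Rightarrow> real"
  assumes "n \<le> b"
  shows "(\<Sum>i<n. r (b - 1 - i)) = (\<Sum>i\<in>{b - n..<b}. r i)"
  by (rule sum.reindex_bij_witness[where i = "\<lambda>i. b - 1 - i" and j = "\<lambda>i. b - 1 - i"]) (use assms in auto)

lemma sum_shift_rates:
  fixes r :: "nat \<Rightarrow> real"
  assumes "m \<le> s"
  shows "(\<Sum>i<s - m. r (m + i)) = (\<Sum>i\<in>{m..<s}. r i)"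
  by (rule sum.reindex_bij_witness[where i = "\<lambda>i. i - m" and j = "\<lambda>i. m + i"]) (use assms in auto)

locale tilted_rates =
  fixes r :: "nat \<Rightarrow> real" and k :: nat and P :: real
  assumes k2: "2 \<le> k" and r_pos: "\<And>i. i < k \<Longrightarrow> 0 < r i"
    and r_sum: "(\<Sum>i\<in>{0..<k}. r i) = real k - 1"
    and P_eq: "P * pois (real (k - 1)) (k - 1) = pmf (lwalk r (k - 1)) 1 * exp (- r (k - 1))"
begin

definition rr :: "nat \<Rightarrow> real" where "rr i = r (k - 1 - i)"

lemma pi_pos: "0 < pois (real (k - 1)) (k - 1)"
  using k2 by (intro pois_pos) auto

lemma P_duality:
  assumes "t + j = k" "0 < j"
  shows "P * pois (real (k - 1)) (k - 1) = (\<Sum>g\<in>{1..j}. pmf (lwalk r t) g * pmf (rwalk rr j) g)"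
proof -
  have "rr = (\<lambda>i. r (k - 1 - i))" by (simp add: rr_def fun_eq_iff)
  then show ?thesis using chain_duality[of k r t j] r_pos assms P_eq by simp
qed

lemma sum_le_total: "a \<le> b \<Longrightarrow> b \<le> k \<Longrightarrow> (\<Sum>i\<in>{a..<b}. r i) \<le> real (k - 1)"
proof -
  assume "a \<le> b" "b \<le> k"
  then have "(\<Sum>i\<in>{a..<b}. r i) \<le> (\<Sum>i\<in>{0..<k}. r i)"
    using r_pos by (intro sum_mono2) (auto simp: less_imp_le)
  then show ?thesis using r_sum k2 by (simp add: of_nat_diff)
qed

text \<open>Whatever the levels at its two ends, the middle stretch has transition weight at most
  the mode of a Poisson law with its mean. This uniform bound decouples the two survival
  probabilities.\<close>

lemma P_upper:
  assumes m: "0 < m" "2 * m \<le> k" and N: "1 \<le> N" "real N \<le> (\<Sum>i\<in>{m..<k - m}. r i)"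
  shows "P \<le> sqrt (real (k - 1) / real N) * alive (lwalk r m) * alive (rwalk rr m)"
proof -
  let ?\<pi> = "pois (real (k - 1)) (k - 1)"
  define S where "S = sqrt (real (k - 1) / real N) * ?\<pi>"
  have a: "pmf (lwalk r (k - m)) g \<le> S * alive (lwalk r m)" if "0 < g" for g
  proof -
    have "k - m = m + (k - m - m)" using m by auto
    then have "lwalk r (k - m) = bind_pmf (lwalk r m) (\<lambda>h. chain (\<lambda>i. stepL (m + i)) (\<lambda>i. r (m + i)) h (k - m - m))"
      by (metis chain_add)
    also have "(\<lambda>i. stepL (m + i)) = stepL" by (simp add: fun_eq_iff stepL_def)
    finally have e: "lwalk r (k - m) = bind_pmf (lwalk r m) (\<lambda>h. chain stepL (\<lambda>i. r (m + i)) h (k - m - m))" .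
    show ?thesis unfolding e
    proof (rule pmf_bind_le_alive)
      show "pmf (chain stepL (\<lambda>i. r (m + i)) 0 (k - m - m)) g = 0"
        using that by (simp add: chain_stepL_0)
      fix h :: nat
      have "pmf (chain stepL (\<lambda>i. r (m + i)) h (k - m - m)) g \<le>
          poisz (\<Sum>i<k - m - m. r (m + i)) (int g + int (k - m - m) - int h)"
        using that r_pos by (intro pmf_chain_left_le) auto
      also have "(\<Sum>i<k - m - m. r (m + i)) = (\<Sum>i\<in>{m..<k - m}. r i)"
        using m by (intro sum_shift_rates) auto
      also have "poisz (\<Sum>i\<in>{m..<k - m}. r i) (int g + int (k - m - m) - int h) \<le> S"
        unfolding S_def using N m sum_le_total[of m "k - m"] by (intro poisz_le_sqrt') auto
      finally show "pmf (chain stepL (\<lambda>i. r (m + i)) h (k - m - m)) g \<le> S" .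
    qed
  qed
  have "P * ?\<pi> = (\<Sum>g\<in>{1..m}. pmf (lwalk r (k - m)) g * pmf (rwalk rr m) g)"
    using m by (intro P_duality) auto
  also have "\<dots> \<le> (\<Sum>g\<in>{1..m}. (S * alive (lwalk r m)) * pmf (rwalk rr m) g)"
    by (intro sum_mono mult_right_mono a) auto
  also have "\<dots> = S * alive (lwalk r m) * measure_pmf.prob (rwalk rr m) {1..m}"
    by (simp add: sum_distrib_left measure_measure_pmf_finite)
  also have "\<dots> \<le> S * alive (lwalk r m) * alive (rwalk rr m)"
    unfolding alive_def[of "rwalk rr m"] S_def using pi_pos
    by (intro mult_left_mono measure_pmf.finite_measure_mono mult_nonneg_nonneg alive_nonneg) auto
  finally have "P * ?\<pi> \<le> (sqrt (real (k - 1) / real N) * alive (lwalk r m) * alive (rwalk rr m)) * ?\<pi>"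
    by (simp add: S_def mult_ac)
  then show ?thesis using pi_pos by (simp only: mult_le_cancel_right_pos)
qed

text \<open>The walks meet at \<open>s\<close>, where the rates cross 1. The left walk drifts
  upwards until \<open>s\<close>, and so does the reversed walk from the right, so the maximal
  inequality applies from both ends. Killed weights are traded for free ones, whose convolution is
  known; the loss is at most the lost mass times the largest weight.\<close>

lemma P_lower:
  assumes m: "0 < m" "m \<le> s" "s \<le> k - m" "m \<le> k"
    and r1: "\<And>i. i < s \<Longrightarrow> 1 \<le> r i" "\<And>i. s \<le> i \<Longrightarrow> i < k \<Longrightarrow> r i \<le> 1"
    and N: "1 \<le> N" "real N \<le> (\<Sum>i\<in>{m..<s}. r i)" "real N \<le> (\<Sum>i\<in>{s..<k - m}. r i)"
    and c: "c = 1 + (\<Sum>i<m. r i - 1)" and R: "R = (\<Sum>i<m. rr i)"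
    and X: "0 < X" "X \<le> c - x" "X \<le> real m - R - x"
    and \<mu>: "\<mu> = (\<Sum>i\<in>{m..<k - m}. r i)" and x: "0 < x" "2 * x \<le> \<mu>"
  shows "(\<Sum>h\<in>{h. 0 < h \<and> \<bar>real h - c\<bar> \<le> x}. pmf (lwalk r m) h) *
     (\<Sum>n\<in>{n. n < m \<and> \<bar>real n - R\<bar> \<le> x}. pmf (rwalk rr m) (m - n)) *
     (exp (- 4 * x\<^sup>2 / \<mu>) - real k / X\<^sup>2 * sqrt (real k / real N)) \<le> P"
proof -
  let ?\<pi> = "pois (real (k - 1)) (k - 1)"
  let ?HL = "{h. 0 < h \<and> \<bar>real h - c\<bar> \<le> x}" and ?HR = "{n. n < m \<and> \<bar>real n - R\<bar> \<le> x}"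
  let ?a = "\<lambda>h. pmf (lwalk r m) h" and ?b = "\<lambda>n. pmf (rwalk rr m) (m - n)"
  define \<mu>1 where "\<mu>1 = (\<Sum>i\<in>{m..<s}. r i)"
  define \<mu>2 where "\<mu>2 = (\<Sum>i\<in>{s..<k - m}. r i)"
  define KL where "KL = (\<lambda>h. chain stepL (\<lambda>i. r (m + i)) h (s - m))"
  define KR where "KR = (\<lambda>f. chain stepD (\<lambda>i. rr (m + i)) f (k - s - m))"
  define S where "S = sqrt (real k / real N) * ?\<pi>"
  define I where "I = {- int k..int k}"
  \<comment> \<open>\<open>U\<close> and \<open>V\<close> are the free weights from the two block
    ends to the meeting level \<open>g\<close>, which may be negative here.\<close>
  define U where "U = (\<lambda>h g. poisz \<mu>1 (g - (int h - int (s - m))))"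
  define V where "V = (\<lambda>n g. poisz \<mu>2 ((int (m - n) + int (k - s - m)) - g))"
  have "?HL \<subseteq> {..nat \<lceil>c + x\<rceil>}" by (auto simp: le_nat_iff) linarith
  then have finL: "finite ?HL" by (rule finite_subset) simp
  have finR: "finite ?HR" by simp
  have \<mu>12: "\<mu>1 + \<mu>2 = \<mu>"
    unfolding \<mu>1_def \<mu>2_def \<mu> using m by (intro sum.atLeastLessThan_concat) auto
  have \<mu>pos: "0 < \<mu>1" "0 < \<mu>2" using N by (auto simp: \<mu>1_def \<mu>2_def)
  have \<mu>le: "\<mu>1 \<le> real (k - 1)" "\<mu>2 \<le> real (k - 1)" "\<mu> \<le> real (k - 1)"
    unfolding \<mu>1_def \<mu>2_def \<mu>
    using m sum_le_total[of m s] sum_le_total[of s "k - m"] sum_le_total[of m "k - m"] by auto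
  have sumL: "(\<Sum>i<s - m. r (m + i)) = \<mu>1"
    unfolding \<mu>1_def using m by (intro sum_shift_rates) auto
  have sumR: "(\<Sum>i<k - s - m. rr (m + i)) = \<mu>2"
  proof -
    have "(\<Sum>i<k - s - m. rr (m + i)) = (\<Sum>i<k - s - m. r ((k - m) - 1 - i))"
      by (intro sum.cong refl arg_cong[where f = r]) (auto simp: rr_def)
    also have "\<dots> = (\<Sum>i\<in>{(k - m) - (k - s - m)..<k - m}. r i)"
      using m by (intro sum_rev_rates) auto
    also have "(k - m) - (k - s - m) = s" using m by auto
    finally show ?thesis by (simp add: \<mu>2_def)
  qed
  have R': "R = (\<Sum>i\<in>{k - m..<k}. r i)"
    unfolding R rr_def using m by (intro sum_rev_rates) auto
  \<comment> \<open>Expresses the middle mean through the expected levels c and m - R at the block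
    ends, to be compared with the actual levels h and m - n.\<close>
  have total: "\<mu> = real k - c - real m - R"
  proof -
    have "(\<Sum>i\<in>{0..<m}. r i) + \<mu> = (\<Sum>i\<in>{0..<k - m}. r i)"
      unfolding \<mu> using m by (intro sum.atLeastLessThan_concat) auto
    moreover have "(\<Sum>i\<in>{0..<k - m}. r i) + R = (\<Sum>i\<in>{0..<k}. r i)"
      unfolding R' by (intro sum.atLeastLessThan_concat) auto
    moreover have "c = 1 + (\<Sum>i\<in>{0..<m}. r i) - real m"
      unfolding c by (simp add: sum_subtractf atLeast0LessThan)
    ultimately show ?thesis using r_sum by linarith
  qed
  have S: "0 \<le> S" unfolding S_def using pi_pos by simp
  have "sqrt (real (k - 1) / real N) \<le> sqrt (real k / real N)"
    by (intro real_sqrt_le_mono divide_right_mono) auto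
  then have S': "sqrt (real (k - 1) / real N) * ?\<pi> \<le> S"
    unfolding S_def using pi_pos by (intro mult_right_mono) auto
  have US: "U h g \<le> S" for h g
    using poisz_le_sqrt'[of N \<mu>1 "k - 1"] N \<mu>le S' by (force simp: U_def \<mu>1_def intro: order_trans)
  have VS: "V n g \<le> S" for n g
    using poisz_le_sqrt'[of N \<mu>2 "k - 1"] N \<mu>le S' by (force simp: V_def \<mu>2_def intro: order_trans)
  have U0: "0 \<le> U h g" and V0: "0 \<le> V n g" for h n g
    using \<mu>pos by (auto simp: U_def V_def intro!: poisz_nonneg)
  have KLU: "pmf (KL h) g \<le> U h (int g)" if "0 < g" for h g
  proof -
    have "pmf (KL h) g \<le> poisz (\<Sum>i<s - m. r (m + i)) (int g + int (s - m) - int h)"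
      unfolding KL_def using that r_pos m by (intro pmf_chain_left_le) auto
    then show ?thesis unfolding sumL U_def by (simp add: algebra_simps)
  qed
  have KRV: "pmf (KR (m - n)) g \<le> V n (int g)" if "0 < g" for n g
  proof -
    have "pmf (KR (m - n)) g \<le> poisz (\<Sum>i<k - s - m. rr (m + i)) (int (m - n) + int (k - s - m) - int g)"
      unfolding KR_def using that r_pos m by (intro pmf_chain_stepD_le) (auto simp: rr_def)
    then show ?thesis unfolding sumR V_def .
  qed
  have resU: "alive_weight (KL h) g \<le> U h g" and resV: "alive_weight (KR (m - n)) g \<le> V n g" for h n g
    using KLU[of "nat g" h] KRV[of "nat g" n] U0 V0 by (auto simp: alive_weight_def)
  have DL: "(\<Sum>g\<in>I. U h g - alive_weight (KL h) g) \<le> \<mu>1 / X\<^sup>2" if h: "h \<in> ?HL" for h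
  proof -
    define Q where "Q = map_pmf (\<lambda>z. int z + (int h - int (s - m))) (poisson_pmf \<mu>1)"
    have Q: "pmf Q g = U h g" for g
      unfolding Q_def U_def by (rule pmf_map_poisson_up[OF \<mu>pos(1)])
    have "(\<Sum>g\<in>I. pmf Q g - alive_weight (KL h) g) \<le> pmf (KL h) 0"
      using KLU by (intro lost_mass_le) (auto simp: Q I_def)
    moreover have "pmf (KL h) 0 * X\<^sup>2 \<le> (\<Sum>i<s - m. r (m + i))"
      unfolding KL_def using h X r1 m by (intro dead_left_le) auto
    ultimately have "(\<Sum>g\<in>I. pmf Q g - alive_weight (KL h) g) \<le> \<mu>1 / X\<^sup>2"
      using X unfolding sumL by (meson order_trans pos_le_divide_eq zero_less_power)
    then show ?thesis by (simp only: Q)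
  qed
  have DR: "(\<Sum>g\<in>I. V n g - alive_weight (KR (m - n)) g) \<le> \<mu>2 / X\<^sup>2" if n: "n \<in> ?HR" for n
  proof -
    define Q where "Q = map_pmf (\<lambda>z. (int (m - n) + int (k - s - m)) - int z) (poisson_pmf \<mu>2)"
    have Q: "pmf Q g = V n g" for g
      unfolding Q_def V_def by (rule pmf_map_poisson_down[OF \<mu>pos(2)])
    have "(\<Sum>g\<in>I. pmf Q g - alive_weight (KR (m - n)) g) \<le> pmf (KR (m - n)) 0"
      using KRV by (intro lost_mass_le) (auto simp: Q I_def)
    moreover have "pmf (KR (m - n)) 0 * X\<^sup>2 \<le> (\<Sum>i<k - s - m. rr (m + i))"
      unfolding KR_def using n X r1 r_pos m
      by (intro dead_right_le) (auto simp: rr_def of_nat_diff)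
    ultimately have "(\<Sum>g\<in>I. pmf Q g - alive_weight (KR (m - n)) g) \<le> \<mu>2 / X\<^sup>2"
      using X unfolding sumR by (meson order_trans pos_le_divide_eq zero_less_power)
    then show ?thesis by (simp only: Q)
  qed
  have conv: "?\<pi> * exp (- 4 * x\<^sup>2 / \<mu>) \<le> (\<Sum>g\<in>I. U h g * V n g)" if h: "h \<in> ?HL" and n: "n \<in> ?HR" for h n
  proof -
    \<comment> \<open>The number of balls that the middle stretch has to receive. Both end levels
      are within \<open>x\<close> of their means, so \<open>d\<close> is within 2x of
      \<open>\<mu>\<close>.\<close>
    define d where "d = (int (m - n) + int (k - s - m)) - (int h - int (s - m))"
    have d: "d = int k - int m - int n - int h" unfolding d_def using n m by auto
    have dmu: "\<bar>\<mu> - real_of_int d\<bar> \<le> 2 * x"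
    proof -
      have "\<mu> - real_of_int d = (real n - R) + (real h - c)" using total d by simp
      then show ?thesis using h n by (auto simp: abs_le_iff)
    qed
    have d0: "0 \<le> d" using dmu x(2) by linarith
    define D where "D = nat d"
    have D: "int D = d" "real D = real_of_int d" "D \<le> k - 1" using d0 d h by (auto simp: D_def)
    have "(\<Sum>g\<in>I. U h g * V n g) = poisz (\<mu>1 + \<mu>2) d"
      unfolding U_def V_def d_def using n m by (intro poisz_convolution) (auto simp: I_def)
    also have "\<dots> = pois \<mu> D" using D(1) \<mu>12 by (metis poisz_of_nat)
    also have "\<dots> \<ge> pois (real D) D * exp (- (\<mu> - real D)\<^sup>2 / \<mu>)"
      using \<mu>12 \<mu>pos by (intro pois_ge_diag) auto
    moreover have "?\<pi> * exp (- 4 * x\<^sup>2 / \<mu>) \<le> pois (real D) D * exp (- (\<mu> - real D)\<^sup>2 / \<mu>)"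
    proof (intro mult_mono)
      show "?\<pi> \<le> pois (real D) D" using D by (intro pois_diag_antimono)
      have "(\<mu> - real D)\<^sup>2 \<le> (2 * x)\<^sup>2" using dmu D x by (subst abs_le_square_iff[symmetric]) auto
      then show "exp (- 4 * x\<^sup>2 / \<mu>) \<le> exp (- (\<mu> - real D)\<^sup>2 / \<mu>)"
        using \<mu>12 \<mu>pos by (simp add: divide_right_mono power_mult_distrib)
    qed (auto intro: pois_nonneg)
    ultimately show ?thesis by simp
  qed
  define E where "E = ?\<pi> * (exp (- 4 * x\<^sup>2 / \<mu>) - real k / X\<^sup>2 * sqrt (real k / real N))"
  have pair: "E \<le> (\<Sum>g\<in>I. alive_weight (KL h) g * alive_weight (KR (m - n)) g)" if h: "h \<in> ?HL" and n: "n \<in> ?HR" for h n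
  proof -
    \<comment> \<open>The factors are replaced one at a time: each replacement costs at most
      \<open>S\<close> times the deficit of that factor.\<close>
    have "U h g * V n g - S * (U h g - alive_weight (KL h) g) - S * (V n g - alive_weight (KR (m - n)) g) \<le> alive_weight (KL h) g * alive_weight (KR (m - n)) g" for g
    proof -
      have "V n g * (U h g - alive_weight (KL h) g) \<le> S * (U h g - alive_weight (KL h) g)"
        using VS resU by (intro mult_right_mono) auto
      moreover have "alive_weight (KL h) g * (V n g - alive_weight (KR (m - n)) g) \<le> S * (V n g - alive_weight (KR (m - n)) g)"
        using US[of h g] resU[of h g] resV by (intro mult_right_mono) (auto intro: order_trans)
      ultimately show ?thesis by (simp add: algebra_simps)
    qed
    then have "(\<Sum>g\<in>I. U h g * V n g - S * (U h g - alive_weight (KL h) g) - S * (V n g - alive_weight (KR (m - n)) g)) \<le>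
        (\<Sum>g\<in>I. alive_weight (KL h) g * alive_weight (KR (m - n)) g)"
      by (intro sum_mono)
    moreover have "(\<Sum>g\<in>I. U h g * V n g - S * (U h g - alive_weight (KL h) g) - S * (V n g - alive_weight (KR (m - n)) g)) =
       (\<Sum>g\<in>I. U h g * V n g) - S * (\<Sum>g\<in>I. U h g - alive_weight (KL h) g) - S * (\<Sum>g\<in>I. V n g - alive_weight (KR (m - n)) g)"
      unfolding sum_distrib_left by (simp only: sum_subtractf)
    moreover have "S * (\<Sum>g\<in>I. U h g - alive_weight (KL h) g) \<le> S * (\<mu>1 / X\<^sup>2)"
      using DL[OF h] S by (intro mult_left_mono)
    moreover have "S * (\<Sum>g\<in>I. V n g - alive_weight (KR (m - n)) g) \<le> S * (\<mu>2 / X\<^sup>2)"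
      using DR[OF n] S by (intro mult_left_mono)
    moreover have "S * (\<mu>1 / X\<^sup>2) + S * (\<mu>2 / X\<^sup>2) \<le> S * (real k / X\<^sup>2)"
    proof -
      have "S * (\<mu>1 / X\<^sup>2) + S * (\<mu>2 / X\<^sup>2) = S * (\<mu> / X\<^sup>2)"
        using \<mu>12 by (simp add: distrib_left[symmetric] add_divide_distrib[symmetric])
      also have "\<dots> \<le> S * (real k / X\<^sup>2)"
        using S \<mu>le by (intro mult_left_mono divide_right_mono) auto
      finally show ?thesis .
    qed
    moreover have "E = ?\<pi> * exp (- 4 * x\<^sup>2 / \<mu>) - S * (real k / X\<^sup>2)"
      by (simp add: E_def S_def algebra_simps)
    ultimately show ?thesis using conv[OF h n] by linarith
  qed
  have aKL: "(\<Sum>h\<in>?HL. ?a h * pmf (KL h) g) \<le> pmf (lwalk r s) g" for g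
  proof -
    have "lwalk r s = bind_pmf (lwalk r m) KL"
      using chain_add[of stepL r 1 m "s - m"] m
      by (simp add: KL_def stepL_def[abs_def])
    then show ?thesis using pmf_bind_ge[OF finL] by simp
  qed
  have bKR: "(\<Sum>n\<in>?HR. ?b n * pmf (KR (m - n)) g) \<le> pmf (rwalk rr (k - s)) g" for g
  proof -
    have "(\<lambda>i. stepR (m + i)) = stepD"
    proof
      fix i show "stepR (m + i) = stepD i" using m by (intro stepR_eq_stepD) auto
    qed
    then have "rwalk rr (k - s) = bind_pmf (rwalk rr m) KR"
      using chain_add[of stepR rr 0 m "k - s - m"] m by (simp add: KR_def)
    moreover have "(\<Sum>n\<in>?HR. ?b n * pmf (KR (m - n)) g) = (\<Sum>f\<in>(\<lambda>n. m - n) ` ?HR. pmf (rwalk rr m) f * pmf (KR f) g)"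
      by (subst sum.reindex) (auto simp: inj_on_def)
    ultimately show ?thesis using pmf_bind_ge[of "(\<lambda>n. m - n) ` ?HR"] by simp
  qed
  have "(\<Sum>h\<in>?HL. ?a h) * (\<Sum>n\<in>?HR. ?b n) * E = (\<Sum>h\<in>?HL. \<Sum>n\<in>?HR. ?a h * ?b n * E)"
    unfolding sum_product by (simp only: sum_distrib_right)
  also have "\<dots> \<le> (\<Sum>h\<in>?HL. \<Sum>n\<in>?HR. ?a h * ?b n * (\<Sum>g\<in>I. alive_weight (KL h) g * alive_weight (KR (m - n)) g))"
    by (intro sum_mono mult_left_mono pair) auto
  also have "\<dots> = (\<Sum>h\<in>?HL. \<Sum>n\<in>?HR. \<Sum>g\<in>I. (?a h * alive_weight (KL h) g) * (?b n * alive_weight (KR (m - n)) g))"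
    by (simp add: sum_distrib_left mult_ac)
  also have "\<dots> = (\<Sum>h\<in>?HL. \<Sum>g\<in>I. \<Sum>n\<in>?HR. (?a h * alive_weight (KL h) g) * (?b n * alive_weight (KR (m - n)) g))"
    by (intro sum.cong refl sum.swap)
  also have "\<dots> = (\<Sum>g\<in>I. \<Sum>h\<in>?HL. \<Sum>n\<in>?HR. (?a h * alive_weight (KL h) g) * (?b n * alive_weight (KR (m - n)) g))"
    by (rule sum.swap)
  also have "\<dots> = (\<Sum>g\<in>I. (\<Sum>h\<in>?HL. ?a h * alive_weight (KL h) g) * (\<Sum>n\<in>?HR. ?b n * alive_weight (KR (m - n)) g))"
    by (simp only: sum_product)
  \<comment> \<open>Only positive levels carry living mass, and the right walk cannot exceed level k
    - s after k - s steps.\<close>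
  also have "\<dots> = (\<Sum>g\<in>int ` {1..k - s}. (\<Sum>h\<in>?HL. ?a h * alive_weight (KL h) g) * (\<Sum>n\<in>?HR. ?b n * alive_weight (KR (m - n)) g))"
  proof (rule sum.mono_neutral_right)
    show "\<forall>g\<in>I - int ` {1..k - s}. (\<Sum>h\<in>?HL. ?a h * alive_weight (KL h) g) * (\<Sum>n\<in>?HR. ?b n * alive_weight (KR (m - n)) g) = 0"
    proof
      fix g assume g: "g \<in> I - int ` {1..k - s}"
      show "(\<Sum>h\<in>?HL. ?a h * alive_weight (KL h) g) * (\<Sum>n\<in>?HR. ?b n * alive_weight (KR (m - n)) g) = 0"
      proof (cases "0 < g")
        case True
        have "k - s < nat g"
        proof (rule ccontr)
          assume "\<not> k - s < nat g"
          then have "g = int (nat g)" "nat g \<in> {1..k - s}" using True by auto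
          then show False using g by blast
        qed
        then have "alive_weight (KR (m - n)) g = 0" for n
          using m pmf_chain_stepD_above[of "m - n" "k - s - m" "nat g"] by (auto simp: alive_weight_def KR_def)
        then show ?thesis by simp
      qed (simp add: alive_weight_def)
    qed
  qed (auto simp: I_def)
  also have "\<dots> = (\<Sum>g\<in>{1..k - s}. (\<Sum>h\<in>?HL. ?a h * pmf (KL h) g) * (\<Sum>n\<in>?HR. ?b n * pmf (KR (m - n)) g))"
    by (subst sum.reindex) (auto simp: alive_weight_def)
  also have "\<dots> \<le> (\<Sum>g\<in>{1..k - s}. pmf (lwalk r s) g * pmf (rwalk rr (k - s)) g)"
    by (intro sum_mono mult_mono aKL bKR sum_nonneg) auto
  also have "\<dots> = P * ?\<pi>"
    using m by (intro P_duality[symmetric]) auto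
  finally have "((\<Sum>h\<in>?HL. ?a h) * (\<Sum>n\<in>?HR. ?b n) * (exp (- 4 * x\<^sup>2 / \<mu>) - real k / X\<^sup>2 * sqrt (real k / real N))) * ?\<pi> \<le> P * ?\<pi>"
    by (simp add: E_def mult_ac)
  then show ?thesis using pi_pos by (simp only: mult_le_cancel_right_pos)
qed

end

section \<open>Escape probabilities\<close>

text \<open>The right side times 1 + t + t^2/2 equals 1 + t^4/4, and the second factor is at most
  exp t.\<close>

lemma exp_minus_le_quadratic: "0 \<le> t \<Longrightarrow> exp (- t) \<le> 1 - t + t\<^sup>2 / 2" for t :: real
proof -
  assume t: "0 \<le> t"
  have "(1 - t + t\<^sup>2 / 2) * (1 + t + t\<^sup>2 / 2) = 1 + t ^ 4 / 4"
    by (simp add: power2_eq_square power4_eq_xxxx algebra_simps)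
  then have "1 \<le> (1 - t + t\<^sup>2 / 2) * (1 + t + t\<^sup>2 / 2)" by simp
  also have "\<dots> \<le> (1 - t + t\<^sup>2 / 2) * exp t"
  proof (intro mult_left_mono exp_lower_Taylor_quadratic t)
    have "0 \<le> (1 - t)\<^sup>2 / 2 + 1 / 2" by (intro add_nonneg_nonneg) auto
    then show "0 \<le> 1 - t + t\<^sup>2 / 2" by (simp add: power2_diff field_simps)
  qed
  finally show ?thesis by (simp add: exp_minus field_simps)
qed

lemma one_minus_le_exp_quadratic:
  fixes w :: real
  assumes "0 \<le> w" "w \<le> 1"
  shows "1 - w \<le> exp (- w - w\<^sup>2 / 2)"
proof -
  define f where "f = (\<lambda>w::real. - (exp (w + w\<^sup>2 / 2) * (1 - w)))"
  have "f 0 \<le> f w"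
  proof (rule DERIV_nonneg_imp_nondecreasing[OF assms(1)])
    fix t :: real
    have "(f has_real_derivative (exp (t + t\<^sup>2 / 2) * t\<^sup>2)) (at t)"
      unfolding f_def by (auto intro!: derivative_eq_intros simp: power2_eq_square algebra_simps)
    then show "\<exists>y. (f has_real_derivative y) (at t) \<and> 0 \<le> y" by (intro exI conjI) auto
  qed
  then have "exp (w + w\<^sup>2 / 2) * (1 - w) \<le> 1" by (simp add: f_def)
  moreover have "exp (- w - w\<^sup>2 / 2) = 1 / exp (w + w\<^sup>2 / 2)"
    by (simp add: exp_minus[symmetric] inverse_eq_divide[symmetric])
  moreover have "1 - w \<le> 1 / exp (w + w\<^sup>2 / 2)"
    using \<open>exp (w + w\<^sup>2 / 2) * (1 - w) \<le> 1\<close> by (simp add: pos_le_divide_eq mult.commute)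
  ultimately show ?thesis by (simp only:)
qed

lemma survival_exists:
  fixes l :: real
  assumes "1 < l"
  obtains y where "0 < y" "y < 1" "1 - y = exp (- l * y)" "2 * (l - 1) / l\<^sup>2 \<le> y"
proof -
  define f where "f = (\<lambda>y. exp (- l * y) - (1 - y))"
  \<comment> \<open>Chosen so that (l a)^2 / 2 = (l - 1) a; the quadratic bound for exp(- l a) is
    then exactly 1 - a.\<close>
  define a where "a = 2 * (l - 1) / l\<^sup>2"
  have a0: "0 < a" using assms by (simp add: a_def)
  have "0 \<le> (l - 1)\<^sup>2" by simp
  then have "2 * (l - 1) \<le> l\<^sup>2" by (simp add: power2_diff)
  then have a1: "a \<le> 1" using assms by (simp add: a_def)
  have "exp (- (l * a)) \<le> 1 - l * a + (l * a)\<^sup>2 / 2"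
    using assms a0 by (intro exp_minus_le_quadratic) auto
  also have "(l * a)\<^sup>2 / 2 = (l - 1) * a"
    using assms by (simp add: a_def power2_eq_square field_simps)
  finally have fa: "f a \<le> 0" by (simp add: f_def algebra_simps)
  have f1: "0 \<le> f 1" by (simp add: f_def)
  have "\<exists>y\<ge>a. y \<le> 1 \<and> f y = 0"
    by (rule IVT') (use fa f1 a1 in \<open>auto simp: f_def intro!: continuous_intros\<close>)
  then obtain y where y: "a \<le> y" "y \<le> 1" "f y = 0" by auto
  have eq: "1 - y = exp (- l * y)" using y(3) by (simp add: f_def)
  have y1: "y < 1"
  proof -
    have "0 < exp (- l * y)" by simp
    then show ?thesis using eq by linarith
  qed
  show ?thesis
    by (rule that[of y]) (use y(1) y1 a0 eq in \<open>simp_all add: a_def\<close>)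
qed

text \<open>A Poisson branching process conditioned on extinction has offspring mean l (1 - y),
  which is at most 1.\<close>

lemma survival_ge:
  fixes y :: real
  assumes y: "0 < y" "y < 1" "1 - y = exp (- l * y)"
  shows "l * (1 - y) \<le> 1"
proof -
  have "1 + l * y \<le> exp (l * y)" by simp
  also have "exp (l * y) = 1 / (1 - y)" using y by (simp add: exp_minus field_simps)
  finally have "(1 + l * y) * (1 - y) \<le> 1" using y(2) by (simp add: pos_le_divide_eq)
  then have "y * (l * (1 - y)) \<le> y * 1" by (simp add: algebra_simps)
  then show ?thesis using y(1) by (simp only: mult_le_cancel_left_pos)
qed

text \<open>The base 1 - y - z lies below the extinction probability, which leaves room for the
  discount exp(- z^2/2). The bound is useful once \<open>z\<close> is well above m^(-1/2).\<close>

lemma alive_left_le_survival: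
  assumes y: "0 < y" "y < 1" "1 - y = exp (- l * y)" and z: "0 < z" and l: "0 < l"
    and r: "\<And>i. i < m \<Longrightarrow> 0 < r i" "\<And>i. i < m \<Longrightarrow> r i \<le> l"
  shows "alive (lwalk r m) * (1 - exp (- (real m * z\<^sup>2 / 2))) \<le> y + z"
proof (cases "y + z < 1")
  case False
  have "alive (lwalk r m) * (1 - exp (- (real m * z\<^sup>2 / 2))) \<le> 1 * 1"
    using alive_le_1 alive_nonneg by (intro mult_mono) auto
  then show ?thesis using False by simp
next
  case True
  \<comment> \<open>The relative decrease of 1 - y. It is at least l z by \<open>survival_ge\<close>
    and at least z, so its linear term pays for l z and its quadratic term for the discount.\<close>
  define w where "w = z / (1 - y)"
  have "l * (1 - y) * z \<le> 1 * z" using z survival_ge[OF y] by (intro mult_right_mono) auto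
  then have lw: "l * z \<le> w" using y(2) by (simp add: w_def pos_le_divide_eq mult_ac)
  have zw: "z \<le> w" using y z by (simp add: w_def field_simps)
  have w1: "0 \<le> w" "w \<le> 1" using True y z by (auto simp: w_def)
  have "1 - y - z = (1 - y) * (1 - w)" using y by (simp add: w_def field_simps)
  also have "\<dots> \<le> (1 - y) * exp (- w - w\<^sup>2 / 2)"
    using y w1 by (intro mult_left_mono one_minus_le_exp_quadratic) auto
  also have "\<dots> \<le> (1 - y) * exp (- (l * z) - z\<^sup>2 / 2)"
  proof -
    have "z\<^sup>2 \<le> w\<^sup>2" using zw z by (intro power_mono) auto
    then show ?thesis using lw y by (intro mult_left_mono) auto
  qed
  also have "\<dots> = exp (- l * y) * exp (- (l * z) - z\<^sup>2 / 2)"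
    by (simp only: y(3))
  also have "\<dots> = exp (- (z\<^sup>2 / 2)) * exp (l * ((1 - y - z) - 1))"
    by (simp add: exp_add[symmetric] algebra_simps)
  finally have "1 - y - z \<le> exp (- (z\<^sup>2 / 2)) * exp (l * ((1 - y - z) - 1))" .
  then have "alive (lwalk r m) * (1 - exp (- (z\<^sup>2 / 2)) ^ m) \<le> 1 - (1 - y - z)"
    using True y z r by (intro alive_left_le[where l = l]) auto
  then show ?thesis by (simp add: exp_of_nat_mult[symmetric])
qed

text \<open>The function h(u) = - ln (1 - u) - u has a nonnegative power series starting at u^2, so
  h(\<theta> u) <= \<theta>^2 h(u), while h(y) = (l - 1) y. Hence 1 - \<theta> y is a valid
  supermartingale base at rate \<open>l'\<close>. The comparison is multiplicative, so it remains
  useful as l approaches 1.\<close>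

lemma alive_left_ge_survival:
  assumes y: "0 < y" "y < 1" "1 - y = exp (- l * y)" and \<theta>: "0 < \<theta>" "\<theta> \<le> 1"
    and l': "1 + \<theta> * (l - 1) \<le> l'"
    and r: "\<And>i. i < m \<Longrightarrow> 0 < r i" "\<And>i. i < m \<Longrightarrow> l' \<le> r i"
  shows "\<theta> * y \<le> alive (lwalk r m)"
proof -
  define f where "f = (\<lambda>u::real. \<theta>\<^sup>2 * (- ln (1 - u) - u) - (- ln (1 - \<theta> * u) - \<theta> * u))"
  have ty: "\<theta> * u \<le> u" if "0 \<le> u" for u using \<theta> that by (simp add: mult_left_le_one_le)
  have "f 0 \<le> f y"
  proof (rule DERIV_nonneg_imp_nondecreasing[of 0 y f])
    fix u :: real assume u: "0 \<le> u" "u \<le> y"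
    have u1: "u < 1" "\<theta> * u < 1" using u y ty[of u] by auto
    have "(f has_real_derivative (\<theta>\<^sup>2 * (1 / (1 - u) - 1) - (\<theta> / (1 - \<theta> * u) - \<theta>))) (at u)"
      unfolding f_def using u1 by (auto intro!: derivative_eq_intros)
    moreover have "\<theta>\<^sup>2 * (1 / (1 - u) - 1) - (\<theta> / (1 - \<theta> * u) - \<theta>) = \<theta>\<^sup>2 * u * (1 / (1 - u) - 1 / (1 - \<theta> * u))"
      using u1 by (simp add: divide_simps power2_eq_square) (simp add: algebra_simps)
    moreover have "0 \<le> \<theta>\<^sup>2 * u * (1 / (1 - u) - 1 / (1 - \<theta> * u))"
      using u1 u ty[of u] by (intro mult_nonneg_nonneg) (auto intro!: divide_left_mono)
    ultimately show "\<exists>d. (f has_real_derivative d) (at u) \<and> 0 \<le> d" by metis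
  qed (use y in simp)
  then have f: "- ln (1 - \<theta> * y) \<le> \<theta> * y + \<theta>\<^sup>2 * (- ln (1 - y) - y)" by (simp add: f_def)
  have "ln (1 - y) = - l * y" using y(3) by simp
  then have "- ln (1 - \<theta> * y) \<le> (1 + \<theta> * (l - 1)) * (\<theta> * y)"
    using f by (simp add: power2_eq_square algebra_simps)
  also have "\<dots> \<le> l' * (\<theta> * y)" using l' y \<theta> by (intro mult_right_mono) auto
  finally have "- (l' * (\<theta> * y)) \<le> ln (1 - \<theta> * y)" by simp
  moreover have pos: "0 < 1 - \<theta> * y" using ty[OF less_imp_le[OF y(1)]] y(2) by linarith
  ultimately have "exp (- (l' * (\<theta> * y))) \<le> 1 - \<theta> * y" by (simp add: ln_ge_iff)
  then have "1 - (1 - \<theta> * y) \<le> alive (lwalk r m)"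
    using r pos y \<theta> by (intro alive_left_ge[where l = l']) auto
  then show ?thesis by simp
qed

section \<open>Killed chains on the infinite product space\<close>

primrec walk_state :: "(nat \<Rightarrow> nat \<Rightarrow> nat \<Rightarrow> nat) \<Rightarrow> nat \<Rightarrow> (nat \<Rightarrow> nat) \<Rightarrow> nat \<Rightarrow> nat" where
  "walk_state F s Z 0 = s"
| "walk_state F s Z (Suc n) = F n (walk_state F s Z n) (Z (Suc n))"

lemma walk_state_cong:
  "(\<And>i. i \<in> {1..n} \<Longrightarrow> Z i = Z' i) \<Longrightarrow> walk_state F s Z n = walk_state F s Z' n"
  by (induction n) auto

lemma measurable_walk_state:
  assumes "{1..n} \<subseteq> I"
  shows "(\<lambda>Z. walk_state F s Z n) \<in> measurable (PiM I (\<lambda>_. measure_pmf Q)) (count_space UNIV)"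
  using assms
proof (induction n)
  case (Suc n)
  have "(\<lambda>Z. Z (Suc n)) \<in> measurable (PiM I (\<lambda>_. measure_pmf Q)) (measure_pmf Q)"
    using Suc.prems by (intro measurable_component_singleton) auto
  then have Z: "(\<lambda>Z. Z (Suc n)) \<in> measurable (PiM I (\<lambda>_. measure_pmf Q)) (count_space UNIV)"
    by (simp add: measurable_def)
  have "(\<lambda>Z. F n g (Z (Suc n))) \<in> measurable (PiM I (\<lambda>_. measure_pmf Q)) (count_space UNIV)" for g
    by (rule measurable_compose[OF Z]) simp
  moreover have "(\<lambda>Z. walk_state F s Z n) \<in> measurable (PiM I (\<lambda>_. measure_pmf Q)) (count_space UNIV)"
    using Suc.prems by (intro Suc.IH) auto
  ultimately show ?case unfolding walk_state.simps by (rule measurable_compose_countable)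
qed simp

lemma nn_integral_walk_state:
  "(\<integral>\<^sup>+Z. f (walk_state F s Z n) \<partial>PiM {1..n} (\<lambda>_. measure_pmf (poisson_pmf l))) =
    (\<integral>\<^sup>+x. f x \<partial>chain F (\<lambda>_. l) s n)"
proof (induction n arbitrary: f)
  case 0
  show ?case by (simp add: nn_integral_count_space_finite PiM_empty)
next
  case (Suc n)
  interpret product_sigma_finite "\<lambda>_::nat. measure_pmf (poisson_pmf l)" ..
  have ins: "{1..Suc n} = insert (Suc n) {1..n}" by auto
  have "(\<integral>\<^sup>+Z. f (walk_state F s Z (Suc n)) \<partial>PiM (insert (Suc n) {1..n}) (\<lambda>_. measure_pmf (poisson_pmf l))) =
      (\<integral>\<^sup>+Z. (\<integral>\<^sup>+z. f (walk_state F s (Z(Suc n := z)) (Suc n)) \<partial>poisson_pmf l)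
        \<partial>PiM {1..n} (\<lambda>_. measure_pmf (poisson_pmf l)))"
  proof (rule product_nn_integral_insert)
    show "(\<lambda>Z. f (walk_state F s Z (Suc n))) \<in> borel_measurable (PiM (insert (Suc n) {1..n}) (\<lambda>_. measure_pmf (poisson_pmf l)))"
      by (rule measurable_compose[OF measurable_walk_state]) auto
  qed auto
  also have "\<dots> = (\<integral>\<^sup>+Z. (\<integral>\<^sup>+z. f (F n (walk_state F s Z n) z) \<partial>poisson_pmf l)
        \<partial>PiM {1..n} (\<lambda>_. measure_pmf (poisson_pmf l)))"
  proof (intro nn_integral_cong)
    fix Z :: "nat \<Rightarrow> nat" and z
    have "walk_state F s (Z(Suc n := z)) n = walk_state F s Z n" by (rule walk_state_cong) auto
    then show "f (walk_state F s (Z(Suc n := z)) (Suc n)) = f (F n (walk_state F s Z n) z)" by simp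
  qed
  also have "\<dots> = (\<integral>\<^sup>+x. (\<integral>\<^sup>+z. f (F n x z) \<partial>poisson_pmf l) \<partial>chain F (\<lambda>_. l) s n)"
    by (rule Suc.IH)
  finally show ?case unfolding ins by simp
qed

lemma prob_space_poisson_steps: "prob_space (poisson_steps l)"
  unfolding poisson_steps_def by (rule prob_space_PiM) (rule prob_space_measure_pmf)

lemma measure_walk_state:
  "measure (poisson_steps l) {Z \<in> space (poisson_steps l). 0 < walk_state F s Z n} = alive (chain F (\<lambda>_. l) s n)"
proof -
  let ?M = "\<lambda>_::nat. measure_pmf (poisson_pmf l)"
  interpret product_prob_space ?M "{1..}" ..
  let ?E = "{Z \<in> space (PiM {1..n} ?M). 0 < walk_state F s Z n}"
  have E: "?E \<in> sets (PiM {1..n} ?M)"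
    using measurable_sets[OF measurable_walk_state[of n "{1..n}" F s "poisson_pmf l"], of "{0<..}"]
    by (simp add: vimage_def Int_def conj_commute)
  have "emeasure (PiM {1..n} ?M) ?E = emeasure (distr (PiM {1..} ?M) (PiM {1..n} ?M) (\<lambda>x. restrict x {1..n})) ?E"
    by (subst distr_PiM_restrict_finite) auto
  also have "\<dots> = emeasure (PiM {1..} ?M) ((\<lambda>x. restrict x {1..n}) -` ?E \<inter> space (PiM {1..} ?M))"
    using E by (intro emeasure_distr measurable_restrict_subset) auto
  also have "(\<lambda>x. restrict x {1..n}) -` ?E \<inter> space (PiM {1..} ?M) = {Z \<in> space (PiM {1..} ?M). 0 < walk_state F s Z n}"
  proof -
    have "walk_state F s (restrict Z {1..n}) n = walk_state F s Z n" for Z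
      by (rule walk_state_cong) auto
    then show ?thesis by (auto simp: space_PiM)
  qed
  finally have 1: "emeasure (poisson_steps l) {Z \<in> space (poisson_steps l). 0 < walk_state F s Z n} = emeasure (PiM {1..n} ?M) ?E"
    by (simp add: poisson_steps_def)
  have "emeasure (PiM {1..n} ?M) ?E = (\<integral>\<^sup>+Z. indicator {0<..} (walk_state F s Z n) \<partial>PiM {1..n} ?M)"
    unfolding nn_integral_indicator[OF E, symmetric]
    by (intro nn_integral_cong) (auto split: split_indicator)
  also have "\<dots> = emeasure (chain F (\<lambda>_. l) s n) {0<..}"
    unfolding nn_integral_walk_state by simp
  finally show ?thesis using 1 by (simp add: measure_def alive_def)
qed

text \<open>Continuity from above. The shift to \<open>Suc n\<close> is for the rightwalk, which
  starts at 0 and has to be positive only from time 1 on.\<close>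

lemma measure_escape_limit:
  assumes esc: "\<And>Z n. Q Z n \<longleftrightarrow> 0 < walk_state F s Z (Suc n)"
    and dec: "\<And>Z n. Q Z (Suc n) \<Longrightarrow> Q Z n"
  shows "(\<lambda>n. alive (chain F (\<lambda>_. l) s (Suc n))) \<longlonglongrightarrow>
    measure (poisson_steps l) {Z \<in> space (poisson_steps l). \<forall>n. Q Z n}"
proof -
  interpret prob_space "poisson_steps l" by (rule prob_space_poisson_steps)
  define A where "A = (\<lambda>n. {Z \<in> space (poisson_steps l). Q Z n})"
  have sets: "A n \<in> sets (poisson_steps l)" for n
    unfolding A_def esc poisson_steps_def
    using measurable_sets[OF measurable_walk_state[of "Suc n" "{1..}" F s "poisson_pmf l"], of "{0<..}"]
    by (simp add: vimage_def Int_def conj_commute)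
  have "(\<lambda>n. measure (poisson_steps l) (A n)) \<longlonglongrightarrow> measure (poisson_steps l) (\<Inter>n. A n)"
    by (rule finite_Lim_measure_decseq) (auto simp: sets, auto simp: A_def intro!: decseq_SucI dec)
  moreover have "(\<Inter>n. A n) = {Z \<in> space (poisson_steps l). \<forall>n. Q Z n}" by (auto simp: A_def)
  moreover have "measure (poisson_steps l) (A n) = alive (chain F (\<lambda>_. l) s (Suc n))" for n
    unfolding A_def esc by (rule measure_walk_state)
  ultimately show ?thesis by simp
qed

text \<open>The state follows the path while the path has stayed positive and is 0 ever after; the
  second conjunct is what the induction needs.\<close>

lemma walk_state_left:
  "(0 < walk_state stepL 1 Z n \<longleftrightarrow> (\<forall>i\<in>{1..n}. 0 < leftwalk Z i)) \<and>
   (0 < walk_state stepL 1 Z n \<longrightarrow> int (walk_state stepL 1 Z n) = leftwalk Z n)"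
proof (induction n)
  case (Suc n)
  then show ?case
    by (cases "0 < walk_state stepL 1 Z n") (auto simp: stepL_def atLeastAtMostSuc_conv)
qed simp

lemma walk_state_right:
  "(0 < walk_state stepR 0 Z (Suc n) \<longleftrightarrow> (\<forall>i\<in>{1..Suc n}. 0 < rightwalk Z i)) \<and>
   (0 < walk_state stepR 0 Z (Suc n) \<longrightarrow> int (walk_state stepR 0 Z (Suc n)) = rightwalk Z (Suc n))"
proof (induction n)
  case 0
  then show ?case by (auto simp: stepR_def)
next
  case (Suc n)
  define g where "g = walk_state stepR 0 Z (Suc n)"
  have e: "walk_state stepR 0 Z (Suc (Suc n)) = stepR (Suc n) g (Z (Suc (Suc n)))" by (simp add: g_def)
  have b: "(\<forall>i\<in>{1..Suc (Suc n)}. 0 < rightwalk Z i) \<longleftrightarrow>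
      (\<forall>i\<in>{1..Suc n}. 0 < rightwalk Z i) \<and> 0 < rightwalk Z (Suc (Suc n))"
    by (auto simp: le_Suc_eq simp del: rightwalk.simps)
  have c: "rightwalk Z (Suc (Suc n)) = rightwalk Z (Suc n) + 1 - int (Z (Suc (Suc n)))" by simp
  show ?case unfolding e b c using Suc unfolding g_def[symmetric]
    by (cases "0 < g") (auto simp: stepR_def simp del: rightwalk.simps)
qed

lemma ESC_limit: "(\<lambda>n. alive (lwalk (\<lambda>_. l) (Suc n))) \<longlonglongrightarrow> measure (poisson_steps l) (ESC l)"
proof -
  have "ESC l = {Z \<in> space (poisson_steps l). \<forall>n. \<forall>i\<in>{1..Suc n}. 0 < leftwalk Z i}"
    unfolding ESC_def by (auto, metis Suc_le_mono le0 Suc_pred' atLeastAtMost_iff le_SucI order_refl One_nat_def)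
  moreover have "(\<lambda>n. alive (lwalk (\<lambda>_. l) (Suc n))) \<longlonglongrightarrow>
      measure (poisson_steps l) {Z \<in> space (poisson_steps l). \<forall>n. \<forall>i\<in>{1..Suc n}. 0 < leftwalk Z i}"
  proof (rule measure_escape_limit)
    show "(\<forall>i\<in>{1..Suc n}. 0 < leftwalk Z i) \<longleftrightarrow> 0 < walk_state stepL 1 Z (Suc n)" for Z n
      using walk_state_left[of Z "Suc n"] by blast
  qed auto
  ultimately show ?thesis by (simp only:)
qed

lemma ESC_R_limit: "(\<lambda>n. alive (rwalk (\<lambda>_. l) (Suc n))) \<longlonglongrightarrow> measure (poisson_steps l) (ESC\<^sub>R l)"
proof -
  have "ESC\<^sub>R l = {Z \<in> space (poisson_steps l). \<forall>n. \<forall>i\<in>{1..Suc n}. 0 < rightwalk Z i}"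
    unfolding ESC\<^sub>R_def by (auto, metis Suc_le_mono le0 Suc_pred' atLeastAtMost_iff le_SucI order_refl One_nat_def)
  moreover have "(\<lambda>n. alive (rwalk (\<lambda>_. l) (Suc n))) \<longlonglongrightarrow>
      measure (poisson_steps l) {Z \<in> space (poisson_steps l). \<forall>n. \<forall>i\<in>{1..Suc n}. 0 < rightwalk Z i}"
  proof (rule measure_escape_limit)
    show "(\<forall>i\<in>{1..Suc n}. 0 < rightwalk Z i) \<longleftrightarrow> 0 < walk_state stepR 0 Z (Suc n)" for Z n
      using walk_state_right[of Z n] by blast
  qed auto
  ultimately show ?thesis by (simp only:)
qed

text \<open>The lower bound is the rate comparison at \<theta> = 1. For the upper bound the horizon
  grows with the slack \<open>z\<close> fixed, and \<open>z\<close> is arbitrary.\<close>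

lemma measure_ESC:
  assumes y: "0 < y" "y < 1" "1 - y = exp (- l * y)" and l: "0 < l"
  shows "measure (poisson_steps l) (ESC l) = y"
proof (rule antisym)
  show "y \<le> measure (poisson_steps l) (ESC l)"
    using alive_left_ge_survival[OF y, of 1 l _ "\<lambda>_. l"] l
    by (intro LIMSEQ_le_const[OF ESC_limit]) (auto simp del: chain.simps)
  show "measure (poisson_steps l) (ESC l) \<le> y"
  proof (rule field_le_epsilon)
    fix z :: real assume z: "0 < z"
    have "filterlim (\<lambda>n. real (Suc n) * (z\<^sup>2 / 2)) at_top sequentially"
      using z by (intro filterlim_tendsto_pos_mult_at_top[OF tendsto_const] filterlim_compose[OF filterlim_real_sequentially filterlim_Suc]
         filterlim_at_top_mult_tendsto_pos[OF tendsto_const]) auto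
    then have "(\<lambda>n. exp (- (real (Suc n) * (z\<^sup>2 / 2)))) \<longlonglongrightarrow> 0"
      by (rule filterlim_compose[OF exp_at_bot filterlim_compose[OF filterlim_uminus_at_bot_at_top]])
    then have "(\<lambda>n. alive (lwalk (\<lambda>_. l) (Suc n)) * (1 - exp (- (real (Suc n) * (z\<^sup>2 / 2))))) \<longlonglongrightarrow>
        measure (poisson_steps l) (ESC l) * (1 - 0)"
      by (intro tendsto_intros ESC_limit)
    moreover have "alive (lwalk (\<lambda>_. l) (Suc n)) * (1 - exp (- (real (Suc n) * (z\<^sup>2 / 2)))) \<le> y + z" for n
      using alive_left_le_survival[OF y z l, of "Suc n" "\<lambda>_. l"] l by (simp only: times_divide_eq_right)
    ultimately have "measure (poisson_steps l) (ESC l) * (1 - 0) \<le> y + z"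
      by (intro LIMSEQ_le_const2) (auto simp del: chain.simps of_nat_Suc)
    then show "measure (poisson_steps l) (ESC l) \<le> y + z" by simp
  qed
qed

lemma measure_ESC_R:
  assumes l: "0 < l" "l \<le> 1"
  shows "measure (poisson_steps l) (ESC\<^sub>R l) = 1 - l"
proof (rule antisym)
  show "1 - l \<le> measure (poisson_steps l) (ESC\<^sub>R l)"
    using alive_right_ge[of "Suc _" "\<lambda>_. l"] l
    by (intro LIMSEQ_le_const[OF ESC_R_limit]) (auto simp del: chain.simps)
  have "(\<lambda>n. 1 - l + 1 / sqrt (real (Suc n))) \<longlonglongrightarrow> 1 - l + 0"
    by (intro tendsto_add tendsto_const tendsto_divide_0[OF tendsto_const]
      filterlim_at_top_imp_at_infinity filterlim_compose[OF sqrt_at_top] filterlim_compose[OF filterlim_real_sequentially filterlim_Suc])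
  then show "measure (poisson_steps l) (ESC\<^sub>R l) \<le> 1 - l"
    using alive_right_le[of "Suc _" "\<lambda>_. l"] l
    by (intro LIMSEQ_le[OF ESC_R_limit, of _ "1 - l"]) (auto simp del: chain.simps)
qed

section \<open>The tilted rates\<close>

text \<open>For the geometric sum S this says S k + (k - 1) (1 - q^k) / 2 <= k; each induction step
  uses S n >= n q^n.\<close>

lemma one_diff_power_upper:
  fixes p :: real
  assumes "0 \<le> p" "p \<le> 1" "1 \<le> k"
  shows "(1 - (1 - p) ^ k) * (1 + (real k - 1) * p / 2) \<le> real k * p"
proof -
  define q where "q = 1 - p"
  have q: "0 \<le> q" "q \<le> 1" "p = 1 - q" using assms by (auto simp: q_def)
  define S where "S = (\<lambda>n. \<Sum>i<n. q ^ i)"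
  have Sq: "(1 - q) * S n = 1 - q ^ n" for n by (simp add: S_def one_diff_power_eq)
  have "S k + (real k - 1) / 2 * (1 - q ^ k) \<le> real k" using assms(3)
  proof (induction k rule: dec_induct)
    case base
    then show ?case by (simp add: S_def)
  next
    case (step n)
    have "(\<Sum>i<n. q ^ n) \<le> S n"
      unfolding S_def using q by (intro sum_mono power_decreasing) auto
    then have "0 \<le> (1 - q) * (S n - real n * q ^ n)" using q by (intro mult_nonneg_nonneg) auto
    also have "\<dots> = (1 - q ^ n) - (1 - q) * real n * q ^ n"
      using Sq[of n] by (simp add: algebra_simps)
    finally have "0 \<le> (1 - q ^ n) - (1 - q) * real n * q ^ n" .
    moreover have "S (Suc n) = S n + q ^ n" by (simp add: S_def)
    ultimately show ?case using step by (simp add: field_simps)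
  qed
  then have "(1 - q) * (S k + (real k - 1) / 2 * (1 - q ^ k)) \<le> (1 - q) * real k"
    using q by (intro mult_left_mono) auto
  then show ?thesis unfolding q(3) using Sq[of k] by (simp add: algebra_simps)
qed

context
  fixes p :: real and k :: nat
  assumes p: "0 < p" "p < 1" and k: "2 \<le> k"
begin

lemma one_diff_power_pos: "0 < 1 - (1 - p) ^ k"
  using p k by (simp add: power_less_one_iff)

lemma rate_left_lower: "(1 - 1 / k) * (1 + (real k - 1) * p / 2) \<le> rate_left p k"
proof -
  have "1 + (real k - 1) * p / 2 \<le> real k * p / (1 - (1 - p) ^ k)"
    using one_diff_power_upper[of p k] one_diff_power_pos p k by (simp add: pos_le_divide_eq mult.commute)
  then have "(1 - 1 / k) * (1 + (real k - 1) * p / 2) \<le> (1 - 1 / k) * (real k * p / (1 - (1 - p) ^ k))"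
    using k by (intro mult_left_mono) auto
  also have "\<dots> = ((1 - 1 / k) * real k) * (p / (1 - (1 - p) ^ k))" by simp
  also have "(1 - 1 / k) * real k = real k - 1" using k by (simp add: field_simps)
  also have "(real k - 1) * (p / (1 - (1 - p) ^ k)) = rate_left p k" by (simp add: rate_left_def)
  finally show ?thesis .
qed

text \<open>Reduces to (1 - p)^k (1 + k p) <= 1: Bernoulli bounds the second factor by (1 + p)^k,
  and the product is (1 - p^2)^k.\<close>

lemma rate_left_upper: "rate_left p k \<le> 1 + p * real k"
proof -
  have "(1 - p) ^ k * (1 + real k * p) \<le> 1"
  proof -
    have "1 + real k * p \<le> (1 + p) ^ k" using p by (intro Bernoulli_inequality) auto
    then have "(1 - p) ^ k * (1 + real k * p) \<le> (1 - p) ^ k * (1 + p) ^ k"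
      using p by (intro mult_left_mono) auto
    also have "\<dots> = (1 - p\<^sup>2) ^ k" by (simp add: power_mult_distrib[symmetric] power2_eq_square algebra_simps)
    also have "\<dots> \<le> 1" using p by (intro power_le_one) (auto simp: power_le_one)
    finally show ?thesis .
  qed
  then have "real k * p \<le> (1 + real k * p) * (1 - (1 - p) ^ k)" by (simp add: algebra_simps)
  moreover have "(real k - 1) * p \<le> real k * p" using p by (intro mult_right_mono) auto
  ultimately have "(real k - 1) * p \<le> (1 + real k * p) * (1 - (1 - p) ^ k)" by simp
  then have "(real k - 1) * p / (1 - (1 - p) ^ k) \<le> 1 + real k * p"
    using one_diff_power_pos by (simp add: pos_divide_le_eq)
  then show ?thesis by (simp add: rate_left_def mult.commute)
qed

lemma rate_right_eq: "rate_right p k = rate_left p k * (1 - p) ^ (k - 1)"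
  by (simp add: rate_left_def rate_right_def)

lemma rate_right_pos: "0 < rate_right p k"
  unfolding rate_right_eq using rate_left_pos[OF p k] p by simp

lemma rate_right_upper: "rate_right p k \<le> 1 / (1 + (real k - 1) * p / 2)"
proof -
  define q where "q = 1 - p"
  have q: "0 < q" "q < 1" "p = 1 - q" using p by (auto simp: q_def)
  have "real k * (1 - q) * q ^ (k - 1) * (1 + (real k - 1) * (1 - q) / 2) \<le> 1 - q ^ k"
    using order_trans[OF one_le_numeral k]
  proof (induction k rule: dec_induct)
    case (step n)
    define N where "N = real n"
    define d where "d = 1 - q"
    have d: "0 < d" "q = 1 - d" using q by (auto simp: d_def)
    have qn: "q ^ n = q * q ^ (n - 1)" using step by (simp add: power_eq_if)
    \<comment> \<open>The induction step has exactly the cubic term on the right to spare.\<close>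
    have "N * d * (1 + (N - 1) * d / 2) + d * q - (N + 1) * d * (1 + N * d / 2) * q = N * (N + 1) * d ^ 3 / 2"
      unfolding d(2) by (simp add: power2_eq_square power3_eq_cube field_simps)
    moreover have "0 \<le> N * (N + 1) * d ^ 3 / 2" using d by (simp add: N_def)
    ultimately have "(N + 1) * d * (1 + N * d / 2) * q \<le> N * d * (1 + (N - 1) * d / 2) + d * q" by linarith
    then have "(N + 1) * d * (1 + N * d / 2) * q * q ^ (n - 1) \<le> (N * d * (1 + (N - 1) * d / 2) + d * q) * q ^ (n - 1)"
      using q by (intro mult_right_mono) auto
    also have "\<dots> = N * d * q ^ (n - 1) * (1 + (N - 1) * d / 2) + d * q ^ n"
      unfolding qn by (simp add: algebra_simps)
    also have "\<dots> \<le> 1 - q ^ n + d * q ^ n"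
      using step.IH by (simp add: N_def d_def)
    also have "\<dots> = 1 - q ^ Suc n" by (simp add: d_def algebra_simps)
    finally show ?case using qn by (simp add: N_def d_def mult_ac add.commute)
  qed simp
  moreover have "(real k - 1) * ((1 - q) * q ^ (k - 1) * (1 + (real k - 1) * (1 - q) / 2)) \<le>
      real k * ((1 - q) * q ^ (k - 1) * (1 + (real k - 1) * (1 - q) / 2))"
    using q k by (intro mult_right_mono mult_nonneg_nonneg add_nonneg_nonneg) auto
  ultimately have main: "(real k - 1) * (1 - q) * q ^ (k - 1) * (1 + (real k - 1) * (1 - q) / 2) \<le> 1 - q ^ k"
    by (simp only: mult.assoc)
  have t: "0 < 1 + (real k - 1) * p / 2" using p k by (intro add_pos_nonneg) auto
  have "(real k - 1) * p * (1 - p) ^ (k - 1) / (1 - (1 - p) ^ k) \<le> 1 / (1 + (real k - 1) * p / 2)"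
    using main t one_diff_power_pos unfolding q_def by (simp add: pos_divide_le_eq pos_le_divide_eq mult_ac)
  then show ?thesis by (simp add: rate_right_def mult_ac)
qed

end

section \<open>Quantitative bounds in the window of bounded tilt\<close>

text \<open>Controls the survival-weighted variance of the left block: survival to time m is at most
  2 y + 3 / sqrt m, and such terms sum to order m y + sqrt m.\<close>

lemma sum_alive_left_le:
  assumes y: "0 < y" "y < 1" "1 - y = exp (- l * y)" and l: "0 < l"
    and r: "\<And>i. i < m \<Longrightarrow> 0 < r i" "\<And>i. i < m \<Longrightarrow> r i \<le> l"
  shows "(\<Sum>i<m. alive (lwalk r i)) \<le> 2 * real m * y + 12 * sqrt (real m)"
  using r
proof (induction m)
  case (Suc m)
  have IH: "(\<Sum>i<m. alive (lwalk r i)) \<le> 2 * real m * y + 12 * sqrt (real m)"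
    using Suc by auto
  show ?case
  proof (cases "m = 0")
    case True
    then show ?thesis using y alive_le_1[of "return_pmf 1"] by (simp add: add_increasing)
  next
    case False
    define v where "v = alive (lwalk r m)"
    \<comment> \<open>The slack sqrt (2/m) makes the exponent 1, and 1 - exp(-1) >= 1/2.\<close>
    have "v * (1 - exp (- (real m * (sqrt (2 / m))\<^sup>2 / 2))) \<le> y + sqrt (2 / m)"
      unfolding v_def using False Suc.prems by (intro alive_left_le_survival[OF y _ l]) auto
    also have "real m * (sqrt (2 / m))\<^sup>2 / 2 = 1" using False by simp
    finally have "v * (1 - exp (- 1)) \<le> y + sqrt (2 / m)" .
    moreover have "exp (- 1) \<le> (1 / 2 :: real)" using exp_minus_le_quadratic[of 1] by simp
    then have "v * (1 / 2) \<le> v * (1 - exp (- 1))"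
      using alive_nonneg by (intro mult_left_mono) (auto simp: v_def)
    moreover have "sqrt (2 / m) \<le> 3 / 2 / sqrt m"
    proof -
      have "sqrt 2 \<le> 3 / 2" by (rule real_le_lsqrt) (auto simp: power2_eq_square)
      then show ?thesis unfolding real_sqrt_divide by (intro divide_right_mono) auto
    qed
    ultimately have v: "v \<le> 2 * y + 3 / sqrt m" by simp
    \<comment> \<open>Telescoping: sqrt (m + 1) - sqrt m >= 1 / (4 sqrt m), so the increment of 12
      sqrt m absorbs 3 / sqrt m.\<close>
    define a where "a = sqrt (real m)"
    define b where "b = sqrt (real m + 1)"
    have a: "0 < a" "a\<^sup>2 = real m" using False by (auto simp: a_def)
    have b: "0 < b" "b\<^sup>2 = real m + 1" by (auto simp: b_def)
    have "a \<le> b" by (simp add: a_def b_def)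
    have "b\<^sup>2 \<le> (2 * a)\<^sup>2" using False a b by (simp add: power_mult_distrib)
  then have "b \<le> 2 * a" by (rule power2_le_imp_le) (use a in simp)
    then have "b + a \<le> 4 * a" using a by simp
    have "(b - a) * (b + a) = 1" using a b by (simp add: power2_eq_square algebra_simps)
    then have "1 \<le> (b - a) * (4 * a)"
      using \<open>b + a \<le> 4 * a\<close> \<open>a \<le> b\<close> by (metis diff_ge_0_iff_ge mult_left_mono)
    then have "3 / a \<le> 12 * (b - a)" using a by (simp add: field_simps)
    then have "12 * sqrt (real m) + 3 / sqrt m \<le> 12 * sqrt (real (Suc m))"
      by (simp add: a_def b_def add.commute)
    then show ?thesis using IH v by (simp add: v_def algebra_simps)
  qed
qed simp

text \<open>The factor 1 - 1/k lowers the rate by about 1/k; the assumption \<open>C\<close> gives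
  pk >= 7/k, so the drift absorbs this.\<close>

lemma rate_left_minus_1_ge:
  assumes p: "0 < p" "p < 1" and k64: "64 \<le> real k" and C: "7 \<le> p * real k * sqrt (real k)"
  shows "p * real k / 4 \<le> rate_left p k - 1"
proof -
  have k2: "2 \<le> k" using k64 by simp
  define c where "c = p * real k"
  define u where "u = 1 / real k"
  have u: "0 < u" "u \<le> 1 / 64" using k64 by (auto simp: u_def field_simps)
  have ck: "7 * u \<le> c"
  proof -
    have "7 \<le> c * sqrt (real k)" using C by (simp add: c_def)
    also have "\<dots> \<le> c * real k"
      using p k64 by (intro mult_left_mono) (auto simp: c_def intro!: real_le_lsqrt power_increasing[of 1 2, simplified] self_le_power)
    finally show ?thesis using k64 by (simp add: u_def field_simps)
  qed
  have "(1 - 1 / k) * (1 + (real k - 1) * p / 2) = (1 - u) * (1 + (1 - u) * c / 2)"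
    using k64 by (simp add: u_def c_def field_simps)
  then have "(1 - u) * (1 + (1 - u) * c / 2) \<le> rate_left p k" using rate_left_lower[OF p k2] by simp
  moreover have "(1 - u) * (1 + (1 - u) * c / 2) = 1 - u + (1 - u)\<^sup>2 * c / 2"
    by (simp add: power2_eq_square algebra_simps)
  moreover have "(63 / 64)\<^sup>2 * c \<le> (1 - u)\<^sup>2 * c"
    using u ck by (intro mult_right_mono power_mono) auto
  moreover have "(63 / 64)\<^sup>2 * c = 3969 / 4096 * c" by (simp add: power2_eq_square)
  ultimately show ?thesis using ck u unfolding c_def[symmetric] by linarith
qed

text \<open>\<open>B\<close> bounds 1 + pk and with it every rate; \<open>y\<close> and
  \<open>e\<close> are the escape probabilities in explicit form. The bounds on \<eta> keep the
  blocks nonempty and short and the tolerance \<eta> sqrt k at most k/4.\<close>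

locale window =
  fixes p :: real and k :: nat and B \<eta> :: real and m :: nat and y e :: real
  assumes p: "0 < p" "p < 1" and B: "1 + p * real k \<le> B" and k: "64 * B \<le> real k"
    and \<eta>: "0 < \<eta>" "16 * B * \<eta> ^ 4 \<le> 1" "2 \<le> \<eta> ^ 4 * real k" "4 * \<eta> \<le> sqrt (real k)"
    and C: "7 \<le> p * real k * sqrt (real k)"
    and m: "m = nat \<lfloor>\<eta> ^ 4 * real k\<rfloor>"
    and y: "0 < y" "y < 1" "1 - y = exp (- rate_left p k * y)"
    and e: "e = 1 - rate_right p k"
begin

abbreviation (input) "r \<equiv> \<lambda>i. rate_left p k * (1 - p) ^ i"
abbreviation (input) "lam \<equiv> rate_left p k"
abbreviation (input) "PT \<equiv> measure_pmf.prob (placement_pmf p k) (TREE k)"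

text \<open>A lower bound for the fraction of the outermost drift that persists throughout an end
  block, on either side.\<close>

definition "\<theta> = 1 - 4 * B * \<eta> ^ 4"

lemma k64: "64 \<le> real k" and B1: "1 < B" and k2: "2 \<le> k"
proof -
  have "0 < p * real k"
  proof -
    have "k \<noteq> 0" using C by (intro notI) simp
    then show ?thesis using p by simp
  qed
  then show "1 < B" using B by simp
  then show "64 \<le> real k" using k by simp
  then show "2 \<le> k" by simp
qed

lemma m_bounds: "real m \<le> \<eta> ^ 4 * real k" "\<eta> ^ 4 * real k / 2 \<le> real m" "0 < m" "16 * B * real m \<le> real k"
proof -
  have m1: "real m \<le> \<eta> ^ 4 * real k" "\<eta> ^ 4 * real k - 1 \<le> real m"
    unfolding m using \<eta> by auto
  then show "real m \<le> \<eta> ^ 4 * real k" by simp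
  show m2: "\<eta> ^ 4 * real k / 2 \<le> real m" using m1 \<eta> by simp
  then show "0 < m" using \<eta> by (intro gr0I) simp
  have "16 * B * real m \<le> 16 * B * (\<eta> ^ 4 * real k)" using m1 B1 by (intro mult_left_mono) auto
  also have "\<dots> = (16 * B * \<eta> ^ 4) * real k" by simp
  also have "\<dots> \<le> 1 * real k" using \<eta> by (intro mult_right_mono) auto
  finally show "16 * B * real m \<le> real k" by simp
qed

lemma lam_le: "lam \<le> B"
  using rate_left_upper[OF p k2] B by simp

lemma lam_pos: "0 < lam"
  by (rule rate_left_pos[OF p k2])

lemma lam_ge: "p * real k / 4 \<le> lam - 1"
  by (rule rate_left_minus_1_ge[OF p k64 C])

lemma e_ge: "p * real k \<le> 4 * B * e" and e_pos: "0 < e" and e_lt: "e < 1"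
proof -
  define c where "c = p * real k"
  define t where "t = (real k - 1) * p / 2"
  have c: "0 < c" "1 + c \<le> B" using p k64 B by (auto simp: c_def)
  have t: "c / 4 \<le> t" using k64 p by (simp add: c_def t_def field_simps)
  have "1 - 1 / (1 + t) \<le> e" unfolding e t_def using rate_right_upper[OF p k2] by simp
  moreover have "1 - 1 / (1 + t) = t / (1 + t)" using t c by (simp add: field_simps)
  moreover have "(c / 4) / (1 + c / 4) \<le> t / (1 + t)" using t c by (simp add: divide_simps) (simp add: algebra_simps)
  moreover have "c / 4 / B \<le> (c / 4) / (1 + c / 4)" using c by (intro divide_left_mono) auto
  ultimately have "c / 4 / B \<le> e" by linarith
  then show "p * real k \<le> 4 * B * e" using B1 unfolding c_def[symmetric] by (simp add: field_simps)
  show "0 < e" using \<open>c / 4 / B \<le> e\<close> c B1 by (smt (verit) divide_pos_pos)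
  show "e < 1" unfolding e using rate_right_pos[OF p k2] by simp
qed

lemma theta_bounds: "1 / 2 \<le> \<theta>" "\<theta> \<le> 1"
  using \<eta> B1 by (auto simp: \<theta>_def)

lemma r_le_lam: "r i \<le> lam" and r_gt0: "0 < r i"
  using lam_pos p by (auto intro!: mult_left_le power_le_one)

lemma r_antimono: "i \<le> j \<Longrightarrow> r j \<le> r i"
  using lam_pos p by (intro mult_left_mono power_decreasing) auto

lemma r_ge: "lam - lam * (real i * p) \<le> r i"
proof -
  have "1 + real i * (- p) \<le> (1 + (- p)) ^ i" using p by (intro Bernoulli_inequality) auto
  then have "lam * (1 - real i * p) \<le> lam * (1 - p) ^ i" using lam_pos by (intro mult_left_mono) auto
  then show ?thesis by (simp add: algebra_simps)
qed

lemma mp_le: "real m * p \<le> \<eta> ^ 4 * (p * real k)"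
  using mult_right_mono[OF m_bounds(1), of p] p by (simp add: mult_ac)

lemma left_rates_ge:
  assumes "i < m"
  shows "1 + \<theta> * (lam - 1) \<le> r i"
proof -
  have "lam * (real i * p) \<le> B * (real m * p)"
    using assms lam_le lam_pos p by (intro mult_mono) auto
  also have "\<dots> \<le> B * (\<eta> ^ 4 * (p * real k))" using mp_le B1 by (intro mult_left_mono) auto
  also have "\<dots> = B * \<eta> ^ 4 * (p * real k)" by simp
  also have "\<dots> \<le> B * \<eta> ^ 4 * (4 * (lam - 1))"
    using lam_ge B1 by (intro mult_left_mono) auto
  finally have "lam * (real i * p) \<le> 4 * B * \<eta> ^ 4 * (lam - 1)" by (simp only: mult_ac)
  then show ?thesis using r_ge[of i] by (simp add: \<theta>_def algebra_simps)
qed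

sublocale tilted_rates r k PT
proof
  show "(\<Sum>i\<in>{0..<k}. r i) = real k - 1"
    using sum_rates[OF p, of k] k2 by (simp add: atLeast0LessThan)
  show "PT * pois (real (k - 1)) (k - 1) = pmf (lwalk r (k - 1)) 1 * exp (- r (k - 1))"
    by (rule prob_TREE_chain[OF p k2])
qed (use k2 r_gt0 in auto)

lemma rr_0: "rr 0 = 1 - e"
  by (simp add: rr_def e rate_right_eq[OF p k2])

lemma rr_mono: "i \<le> j \<Longrightarrow> rr i \<le> rr j"
  unfolding rr_def by (rule r_antimono) auto

lemma rr_pos: "0 < rr i"
  unfolding rr_def by (rule r_gt0)

lemma rr_le:
  assumes "j \<le> k - 1" "real j * p < 1"
  shows "rr j * (1 - real j * p) \<le> 1 - e"
proof -
  have "1 + real j * (- p) \<le> (1 + (- p)) ^ j" using p by (intro Bernoulli_inequality) auto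
  then have "rr j * (1 - real j * p) \<le> rr j * (1 - p) ^ j" using rr_pos[of j] by (intro mult_left_mono) auto
  also have "\<dots> = 1 - e"
  proof -
    have "rr j * (1 - p) ^ j = lam * (1 - p) ^ (k - 1 - j + j)" by (simp add: rr_def power_add)
    also have "k - 1 - j + j = k - 1" using assms by simp
    finally show ?thesis by (simp add: e rate_right_eq[OF p k2])
  qed
  finally show ?thesis .
qed

text \<open>The meeting time: as the rates are nonincreasing, the left walk has nonnegative drift
  before it and the reversed walk positive drift beyond it.\<close>

definition "s = (LEAST i. r i < 1)"

lemma r_last: "r (k - 1) < 1"
  using rr_0 e_pos by (simp add: rr_def)

lemma s_less: "i < s \<Longrightarrow> 1 \<le> r i"
  using not_less_Least[of i "\<lambda>i. r i < 1"] by (simp add: s_def)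

lemma s_ge: "s \<le> i \<Longrightarrow> r i < 1"
proof -
  have "r s < 1" unfolding s_def by (rule LeastI[where P = "\<lambda>i. r i < 1", OF r_last])
  then show "s \<le> i \<Longrightarrow> r i < 1" using r_antimono[of s i] by simp
qed

text \<open>At least \<open>J\<close> bins separate the crossing index from either block, and
  \<open>N\<close> will bound the mean of each half of the middle from below. With m <= k / (16 B),
  a block and \<open>J\<close> bins together stay below k / (4 B).\<close>

definition "J = nat \<lfloor>real k / (8 * B)\<rfloor>"
definition "N = nat \<lfloor>real k / (32 * B)\<rfloor>"

lemma J_bounds: "real J \<le> real k / (8 * B)" "real k / (8 * B) - 1 \<le> real J"
  unfolding J_def using B1 k64 by auto

lemma N_bounds: "1 \<le> N" "2 * real N \<le> real J" "real k / real N \<le> 64 * B"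
proof -
  define t where "t = real k / (32 * B)"
  have t: "2 \<le> t" using k B1 by (simp add: t_def field_simps)
  have N: "real N \<le> t" "t - 1 \<le> real N" unfolding N_def t_def[symmetric] using t by auto
  show "1 \<le> N" using N t by linarith
  have "real k / (8 * B) = 4 * t" by (simp add: t_def)
  then show "2 * real N \<le> real J" using J_bounds N t by linarith
  have "t / 2 \<le> real N" using N t by linarith
  then have "real k \<le> 64 * B * real N" using B1 by (simp add: t_def field_simps)
  then show "real k / real N \<le> 64 * B" using \<open>1 \<le> N\<close> by (simp add: field_simps)
qed

lemma mJ_less: "real (m + J) < real k / (4 * B)"
proof -
  have "real m \<le> real k / (16 * B)" using m_bounds(4) B1 by (simp add: field_simps)
  moreover have "real k / (4 * B) = 4 * (real k / (16 * B))" "real k / (8 * B) = 2 * (real k / (16 * B))" by auto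
  moreover have "0 < real k / (16 * B)" using k64 B1 by simp
  ultimately show ?thesis using J_bounds(1) by simp
qed

lemma small_index_p: "real j \<le> real k / (4 * B) \<Longrightarrow> real j * p \<le> p * real k / (4 * B)"
  using mult_right_mono[of "real j" "real k / (4 * B)" p] p by (simp add: mult_ac)

text \<open>Over the first k / (4 B) bins a rate falls by at most pk / 4, which is at most lam - 1,
  so it stays at least 1.\<close>

lemma s_lower: "m + J \<le> s"
proof (rule ccontr)
  assume "\<not> m + J \<le> s"
  then have s: "real s \<le> real k / (4 * B)" using mJ_less by simp
  have "lam * (real s * p) \<le> B * (p * real k / (4 * B))"
    using small_index_p[OF s] lam_le lam_pos p by (intro mult_mono) auto
  also have "\<dots> \<le> lam - 1" using lam_ge B1 by simp
  finally have "1 \<le> r s" using r_ge[of s] by simp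
  then show False using s_ge[of s] by simp
qed

text \<open>Read backwards, the rates start at 1 - e and grow by at most the factor 1 / (1 - j p);
  while j p < e they stay below 1.\<close>

lemma s_upper: "s + (m + J) \<le> k - 1"
proof -
  define j where "j = m + J"
  have jk: "real j < real k / (4 * B)" using mJ_less by (simp add: j_def)
  have "real k / (4 * B) \<le> real k / 4" using B1 k64 by (intro divide_left_mono) auto
  then have j: "j \<le> k - 1" using jk k64 by linarith
  have "real j * p < p * real k / (4 * B)"
    using mult_strict_right_mono[OF jk, of p] p by (simp add: mult_ac)
  also have "\<dots> \<le> e" using e_ge B1 by (simp add: field_simps)
  finally have jp: "real j * p < e" .
  have "rr j * (1 - real j * p) < 1 * (1 - real j * p)"
    by (rule le_less_trans[OF rr_le[OF j less_trans[OF jp e_lt]]]) (use jp in simp)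
  then have "rr j < 1" using jp e_lt by (simp only: mult_less_cancel_right_pos)
  then have "\<not> k - 1 - j < s" using s_less[of "k - 1 - j"] by (auto simp: rr_def)
  then show ?thesis using j by (simp add: j_def)
qed

text \<open>The block lies beyond the crossing, so \<open>rr j < 1\<close>; the growth over j bins
  is then at most j p, a small multiple of \<open>e\<close>.\<close>

lemma right_rates_le:
  assumes "j < m"
  shows "rr j \<le> 1 - \<theta> * e"
proof -
  have j: "j \<le> k - 1" "s \<le> k - 1 - j" using s_upper assms by auto
  then have r1: "rr j < 1" unfolding rr_def by (intro s_ge)
  have jp: "real j * p \<le> \<eta> ^ 4 * (p * real k)"
    using mp_le assms p by (smt (verit) mult_right_mono of_nat_less_iff less_imp_le)
  also have "\<dots> \<le> \<eta> ^ 4 * (4 * B * e)" using e_ge by (intro mult_left_mono) auto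
  finally have jp4: "real j * p \<le> 4 * B * \<eta> ^ 4 * e" by (simp only: mult_ac)
  also have "\<dots> \<le> (1 - \<theta>) * 1" unfolding \<theta>_def using e_lt B1 by (simp add: mult_left_le)
  finally have "real j * p < 1" using theta_bounds by simp
  then have "rr j \<le> 1 - e + rr j * (real j * p)" using rr_le[OF j(1)] by (simp add: algebra_simps)
  also have "rr j * (real j * p) \<le> 1 * (real j * p)" using r1 p by (intro mult_right_mono) auto
  finally show ?thesis using jp4 by (simp add: \<theta>_def algebra_simps)
qed

lemma right_sum_le: "(\<Sum>i<m. rr i) \<le> real m * (1 - \<theta> * e)"
  using sum_mono[of "{..<m}" rr "\<lambda>_. 1 - \<theta> * e"] right_rates_le by simp

lemma middle_ge: "real k * (1 - (B + 1) * \<eta> ^ 4) - 1 \<le> (\<Sum>i\<in>{m..<k - m}. r i)"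
proof -
  have mk: "m \<le> k - m" "k - m \<le> k" using s_upper s_lower by auto
  have "(\<Sum>i\<in>{0..<m}. r i) + (\<Sum>i\<in>{m..<k - m}. r i) = (\<Sum>i\<in>{0..<k - m}. r i)"
    using mk by (intro sum.atLeastLessThan_concat) auto
  moreover have "(\<Sum>i\<in>{0..<k - m}. r i) + (\<Sum>i\<in>{k - m..<k}. r i) = (\<Sum>i\<in>{0..<k}. r i)"
    using mk by (intro sum.atLeastLessThan_concat) auto
  moreover have "(\<Sum>i\<in>{0..<m}. r i) \<le> real m * B"
  proof -
    have "(\<Sum>i\<in>{0..<m}. r i) \<le> (\<Sum>i\<in>{0..<m}. B)"
      by (intro sum_mono order_trans[OF r_le_lam lam_le])
    then show ?thesis by simp
  qed
  moreover have "(\<Sum>i\<in>{k - m..<k}. r i) \<le> real m"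
  proof -
    have "(\<Sum>i\<in>{k - m..<k}. r i) \<le> (\<Sum>i\<in>{k - m..<k}. 1)"
      using s_ge s_upper by (intro sum_mono) (auto intro!: less_imp_le)
    then show ?thesis using mk by simp
  qed
  moreover have "real m * (B + 1) \<le> \<eta> ^ 4 * real k * (B + 1)"
    using m_bounds(1) B1 by (intro mult_right_mono) auto
  ultimately show ?thesis using r_sum by (simp add: algebra_simps)
qed

lemma eta_small: "(B + 1) * \<eta> ^ 4 \<le> 1 / 8"
proof -
  have "(B + 1) * \<eta> ^ 4 \<le> 2 * B * \<eta> ^ 4" using B1 by (intro mult_right_mono) auto
  moreover have "2 * B * \<eta> ^ 4 \<le> 1 / 8" using \<eta>(2) by simp
  ultimately show ?thesis by linarith
qed

text \<open>\<open>z\<close> is the slack relative to \<open>y\<close>. For fixed \<eta> and z all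
  k-dependent errors go through 1/k, y sqrt k and e sqrt k, the last two of which will tend to
  infinity.\<close>

lemma upper_bound:
  assumes z: "0 < z" and t: "0 < 1 - (B + 1) * \<eta> ^ 4 - 2 / k"
  shows "PT * (1 - exp (- (\<eta> ^ 4 / 4 * (z * (y * sqrt (real k)))\<^sup>2))) \<le>
     sqrt (1 / (1 - (B + 1) * \<eta> ^ 4 - 2 / k)) * (y * (1 + z)) * (e * (1 + 1 / (sqrt (\<eta> ^ 4 / 2) * (e * sqrt (real k)))))"
proof -
  define \<mu> where "\<mu> = (\<Sum>i\<in>{m..<k - m}. r i)"
  define M where "M = nat \<lfloor>\<mu>\<rfloor>"
  have k0: "0 < real k" using k64 by simp
  have t': "real k * (1 - (B + 1) * \<eta> ^ 4) - 2 = real k * (1 - (B + 1) * \<eta> ^ 4 - 2 / k)"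
    using k64 by (simp add: field_simps)
  have "1 / 2 \<le> 1 - (B + 1) * \<eta> ^ 4" using eta_small by simp
  then have "real k * (1 / 2) \<le> real k * (1 - (B + 1) * \<eta> ^ 4)" by (intro mult_left_mono) auto
  then have \<mu>1: "1 \<le> \<mu>" using middle_ge k64 unfolding \<mu>_def by linarith
  have M: "real M \<le> \<mu>" "\<mu> - 1 \<le> real M" unfolding M_def using \<mu>1 by auto
  have M1: "1 \<le> M" using \<mu>1 by (simp add: M_def le_nat_iff)
  have Mk: "real k * (1 - (B + 1) * \<eta> ^ 4 - 2 / k) \<le> real M"
    using M middle_ge t' by (simp add: \<mu>_def)
  have sq: "sqrt (real (k - 1) / real M) \<le> sqrt (1 / (1 - (B + 1) * \<eta> ^ 4 - 2 / k))"
  proof (rule real_sqrt_le_mono)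
    have "real (k - 1) / real M \<le> real k / real M" by (intro divide_right_mono) auto
    also have "\<dots> \<le> real k / (real k * (1 - (B + 1) * \<eta> ^ 4 - 2 / k))"
      using Mk M1 t k0 by (intro divide_left_mono mult_pos_pos) auto
    also have "\<dots> = 1 / (1 - (B + 1) * \<eta> ^ 4 - 2 / k)" using k0 by simp
    finally show "real (k - 1) / real M \<le> 1 / (1 - (B + 1) * \<eta> ^ 4 - 2 / k)" .
  qed
  let ?vL = "alive (lwalk r m)" and ?vR = "alive (rwalk rr m)"
  define E where "E = exp (- (\<eta> ^ 4 / 4 * (z * (y * sqrt (real k)))\<^sup>2))"
  have E: "0 \<le> 1 - E" by (simp add: E_def)
  have vL: "?vL * (1 - E) \<le> y * (1 + z)"
  proof -
    have "\<eta> ^ 4 / 4 * (z * (y * sqrt (real k)))\<^sup>2 = (\<eta> ^ 4 * real k / 2) * ((z * y)\<^sup>2 / 2)"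
      using k0 by (simp add: power_mult_distrib)
    also have "\<dots> \<le> real m * ((z * y)\<^sup>2 / 2)" using m_bounds(2) by (intro mult_right_mono) auto
    finally have "1 - E \<le> 1 - exp (- (real m * (z * y)\<^sup>2 / 2))" by (simp add: E_def)
    then have "?vL * (1 - E) \<le> ?vL * (1 - exp (- (real m * (z * y)\<^sup>2 / 2)))"
      using alive_nonneg by (intro mult_left_mono) auto
    also have "\<dots> \<le> y + z * y"
      using z y(1) r_gt0 r_le_lam lam_pos by (intro alive_left_le_survival[OF y]) auto
    finally show ?thesis by (simp add: algebra_simps)
  qed
  have vR: "?vR \<le> e * (1 + 1 / (sqrt (\<eta> ^ 4 / 2) * (e * sqrt (real k))))"
  proof -
    have "?vR \<le> 1 - rr 0 + 1 / sqrt (real m)"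
      using m_bounds(3) rr_0 e_pos rr_pos by (intro alive_right_le rr_mono) auto
    also have "1 / sqrt (real m) \<le> 1 / sqrt (\<eta> ^ 4 * real k / 2)"
      using m_bounds \<eta> k0 by (intro divide_left_mono real_sqrt_le_mono) auto
    also have "\<eta> ^ 4 * real k / 2 = \<eta> ^ 4 / 2 * real k" by simp
    also have "1 / sqrt (\<eta> ^ 4 / 2 * real k) = e * (1 / (sqrt (\<eta> ^ 4 / 2) * (e * sqrt (real k))))"
      using e_pos by (simp only: real_sqrt_mult) simp
    finally show ?thesis using rr_0 by (simp add: distrib_left)
  qed
  have "PT \<le> sqrt (real (k - 1) / real M) * ?vL * ?vR"
    using m_bounds(3) s_upper s_lower M1 M(1) by (intro P_upper) (auto simp: \<mu>_def)
  then have "PT * (1 - E) \<le> sqrt (real (k - 1) / real M) * ?vL * ?vR * (1 - E)"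
    using E by (intro mult_right_mono)
  also have "\<dots> = sqrt (real (k - 1) / real M) * (?vL * (1 - E)) * ?vR" by simp
  also have "\<dots> \<le> sqrt (1 / (1 - (B + 1) * \<eta> ^ 4 - 2 / k)) * (y * (1 + z)) * (e * (1 + 1 / (sqrt (\<eta> ^ 4 / 2) * (e * sqrt (real k)))))"
    by (rule mult_mono[OF mult_mono[OF sq vL] vR]) (use t y(1) z E alive_nonneg in \<open>auto intro!: mult_nonneg_nonneg\<close>)
  finally show ?thesis by (simp add: E_def)
qed

text \<open>\<open>A1\<close>, \<open>A2\<close> and \<open>A3\<close> are the relative factors kept
  by the left block, the right block and the middle stretch.\<close>

lemma lower_bound:
  assumes X: "0 < \<eta> ^ 4 * (p * real k * sqrt (real k)) / (16 * B) - \<eta>"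
    and t: "0 < 1 - (B + 1) * \<eta> ^ 4 - 1 / k"
    and A1: "A1 = \<theta> - 2 * B * \<eta>\<^sup>2 - 12 * B / (y * sqrt (real k))" "0 \<le> A1"
    and A2: "A2 = \<theta> * (1 - \<eta>\<^sup>2) - 1 / (\<eta> * (e * sqrt (real k)))" "0 \<le> A2"
    and A3: "A3 = exp (- 4 * \<eta>\<^sup>2 / (1 - (B + 1) * \<eta> ^ 4 - 1 / k)) -
       1 / (\<eta> ^ 4 * (p * real k * sqrt (real k)) / (16 * B) - \<eta>)\<^sup>2 * sqrt (64 * B)" "0 \<le> A3"
  shows "(y * A1) * (e * A2) * A3 \<le> PT"
proof -
  have k0: "0 < real k" using k64 by simp
  define \<mu> where "\<mu> = (\<Sum>i\<in>{m..<k - m}. r i)"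
  define x where "x = \<eta> * sqrt (real k)"
  define c where "c = 1 + (\<Sum>i<m. r i - 1)"
  define R where "R = (\<Sum>i<m. rr i)"
  define D where "D = \<eta> ^ 4 * (p * real k * sqrt (real k)) / (16 * B) - \<eta>"
  \<comment> \<open>A common lower bound for the heights at the inner ends of both blocks: a
    guaranteed part of the drift, less the tolerance \<open>x\<close>.\<close>
  define X where "X = sqrt (real k) * D"
  have x: "0 < x" "x\<^sup>2 = \<eta>\<^sup>2 * real k" using \<eta> k0 by (auto simp: x_def power_mult_distrib)
  have \<mu>k: "real k * (1 - (B + 1) * \<eta> ^ 4 - 1 / k) \<le> \<mu>"
  proof -
    have "real k * (1 - (B + 1) * \<eta> ^ 4 - 1 / k) = real k * (1 - (B + 1) * \<eta> ^ 4) - 1"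
      using k0 by (simp add: right_diff_distrib)
    then show ?thesis using middle_ge by (simp only: \<mu>_def)
  qed
  have \<mu>0: "0 < real k * (1 - (B + 1) * \<eta> ^ 4 - 1 / k)" using t k0 by simp
  have "1 / real k \<le> 1 / 64" using k64 by (intro divide_left_mono) auto
  then have t2: "1 / 2 \<le> 1 - (B + 1) * \<eta> ^ 4 - 1 / k" using eta_small by linarith
  have "2 * x \<le> real k / 2"
  proof -
    have "4 * \<eta> * sqrt (real k) \<le> sqrt (real k) * sqrt (real k)" using \<eta> by (intro mult_right_mono) auto
    then show ?thesis by (simp add: x_def)
  qed
  also have "\<dots> \<le> real k * (1 - (B + 1) * \<eta> ^ 4 - 1 / k)" using t2 mult_left_mono[OF t2, of "real k"] by simp
  finally have x\<mu>: "2 * x \<le> \<mu>" using \<mu>k by simp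
  have Dk: "X = \<eta> ^ 4 * real k / 2 * (p * real k / (8 * B)) - x"
  proof -
    have "sqrt (real k) * (\<eta> ^ 4 * (p * real k * sqrt (real k)) / (16 * B)) = \<eta> ^ 4 * real k / 2 * (p * real k / (8 * B))"
      using real_sqrt_mult_self[of "real k"] by (simp add: mult_ac)
    then show ?thesis by (simp add: X_def D_def x_def algebra_simps)
  qed
  have pk: "0 \<le> p * real k / (8 * B)" using p B1 by simp
  have X0: "0 < X" using X k0 by (simp add: X_def D_def)
  have Xc: "X \<le> c - x"
  proof -
    have "p * real k / (8 * B) \<le> p * real k / 8" using B1 p k0 by (intro divide_left_mono) auto
    also have "\<dots> \<le> (1 / 2) * (lam - 1)" using lam_ge by simp
    also have "\<dots> \<le> \<theta> * (lam - 1)" using theta_bounds lam_ge p by (intro mult_right_mono order_trans[OF _ lam_ge]) auto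
    finally have "\<eta> ^ 4 * real k / 2 * (p * real k / (8 * B)) \<le> real m * (\<theta> * (lam - 1))"
      using m_bounds(2) pk by (intro mult_mono) auto
    moreover have "real m * (\<theta> * (lam - 1)) \<le> (\<Sum>i<m. r i - 1)"
      using sum_mono[of "{..<m}" "\<lambda>_. \<theta> * (lam - 1)" "\<lambda>i. r i - 1"] left_rates_ge by force
    ultimately show ?thesis using Dk by (simp add: c_def)
  qed
  have XR: "X \<le> real m - R - x"
  proof -
    have "p * real k / (8 * B) \<le> (1 / 2) * e" using e_ge B1 by (simp add: field_simps)
    also have "\<dots> \<le> \<theta> * e" using theta_bounds e_pos by (intro mult_right_mono) auto
    finally have "\<eta> ^ 4 * real k / 2 * (p * real k / (8 * B)) \<le> real m * (\<theta> * e)"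
      using m_bounds(2) pk by (intro mult_mono) auto
    then show ?thesis using Dk right_sum_le by (simp add: R_def algebra_simps)
  qed
  let ?VL = "\<Sum>h\<in>{h. 0 < h \<and> \<bar>real h - c\<bar> \<le> x}. pmf (lwalk r m) h"
  let ?VR = "\<Sum>n\<in>{n. n < m \<and> \<bar>real n - R\<bar> \<le> x}. pmf (rwalk rr m) (m - n)"
  have NL: "real N \<le> (\<Sum>i\<in>{m..<s}. r i)"
  proof -
    have "real N \<le> real (s - m)" using N_bounds(2) s_lower by linarith
    also have "\<dots> \<le> (\<Sum>i\<in>{m..<s}. r i)"
      using sum_mono[of "{m..<s}" "\<lambda>_. 1" r] s_less by simp
    finally show ?thesis .
  qed
  have NR: "real N \<le> (\<Sum>i\<in>{s..<k - m}. r i)"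
  proof -
    \<comment> \<open>Beyond the crossing the rates stay at least 1/2 for \<open>J\<close> bins: r
      (s - 1) >= 1, and the decay over J bins is at most J p <= 1/2.\<close>
    have half: "1 / 2 \<le> r i" if i: "i \<in> {s..<s + J}" for i
    proof -
      have s0: "0 < s" using s_lower m_bounds by simp
      define j where "j = i - (s - 1)"
      have "j \<le> J" using i s0 by (auto simp: j_def)
      then have "real j * p \<le> real J * p" using p by (intro mult_right_mono) auto
      also have "\<dots> \<le> real k / (8 * B) * p" using J_bounds p by (intro mult_right_mono) auto
      also have "\<dots> \<le> 1 / 2" using B B1 by (simp add: field_simps)
      finally have "1 / 2 \<le> 1 + real j * (- p)" by simp
      also have "\<dots> \<le> (1 + (- p)) ^ j" using p by (intro Bernoulli_inequality) auto
      also have "\<dots> \<le> r (s - 1) * (1 - p) ^ j"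
        using s_less[of "s - 1"] s0 p mult_right_mono[of 1 "r (s - 1)" "(1 - p) ^ j"] by simp
      also have "\<dots> = r i" using i s0 by (simp add: j_def power_add[symmetric])
      finally show ?thesis .
    qed
    have "real N \<le> (\<Sum>i\<in>{s..<s + J}. 1 / 2)" using N_bounds by simp
    also have "\<dots> \<le> (\<Sum>i\<in>{s..<s + J}. r i)" by (intro sum_mono half)
    also have "\<dots> \<le> (\<Sum>i\<in>{s..<k - m}. r i)"
      using s_upper r_gt0 by (intro sum_mono2) (auto intro!: less_imp_le)
    finally show ?thesis .
  qed
  have main: "?VL * ?VR * (exp (- 4 * x\<^sup>2 / \<mu>) - real k / X\<^sup>2 * sqrt (real k / real N)) \<le> PT"
    using m_bounds(3) s_lower s_upper s_less s_ge N_bounds(1) NL NR X0 Xc XR x x\<mu>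
    by (intro P_lower[where s = s]) (auto simp: c_def R_def \<mu>_def intro!: less_imp_le)
  have VL: "y * A1 \<le> ?VL"
  proof -
    have "\<theta> * y \<le> alive (lwalk r m)"
      using theta_bounds r_gt0 left_rates_ge by (intro alive_left_ge_survival[OF y]) auto
    \<comment> \<open>With x^2 = \<eta>^2 k, the variance of order B (\<eta>^4 k y + \<eta>^2 sqrt
      k) becomes an error relative to \<open>y\<close>.\<close>
    moreover have "(\<Sum>i<m. r i * alive (lwalk r i)) / x\<^sup>2 \<le> y * (2 * B * \<eta>\<^sup>2 + 12 * B / (y * sqrt (real k)))"
    proof -
      have "(\<Sum>i<m. r i * alive (lwalk r i)) \<le> (\<Sum>i<m. B * alive (lwalk r i))"
        by (intro sum_mono mult_right_mono order_trans[OF r_le_lam lam_le] alive_nonneg)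
      also have "\<dots> \<le> B * (2 * real m * y + 12 * sqrt (real m))"
        unfolding sum_distrib_left[symmetric]
        using B1 r_gt0 r_le_lam lam_pos by (intro mult_left_mono sum_alive_left_le[OF y]) auto
      also have "\<dots> \<le> B * (2 * (\<eta> ^ 4 * real k) * y + 12 * (\<eta>\<^sup>2 * sqrt (real k)))"
      proof -
        have "sqrt (real m) \<le> sqrt (\<eta> ^ 4 * real k)" using m_bounds by simp
        also have "\<dots> = \<eta>\<^sup>2 * sqrt (real k)"
          using real_sqrt_abs[of "\<eta>\<^sup>2"] by (simp add: real_sqrt_mult power_mult[symmetric])
        finally show ?thesis using m_bounds(1) y B1
          by (intro mult_left_mono add_mono mult_right_mono) auto
      qed
      finally have "(\<Sum>i<m. r i * alive (lwalk r i)) / x\<^sup>2 \<le> B * (2 * (\<eta> ^ 4 * real k) * y + 12 * (\<eta>\<^sup>2 * sqrt (real k))) / x\<^sup>2"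
        using x by (intro divide_right_mono) auto
      also have "\<dots> = y * (2 * B * \<eta>\<^sup>2 + 12 * B / (y * sqrt (real k)))"
      proof -
        have "B * (2 * (\<eta> ^ 4 * real k) * y) / x\<^sup>2 = y * (2 * B * \<eta>\<^sup>2)"
          unfolding x(2) using \<eta> k0 by (simp add: power4_eq_xxxx power2_eq_square)
        moreover have "B * (12 * (\<eta>\<^sup>2 * sqrt (real k))) / x\<^sup>2 = 12 * B / sqrt (real k)"
        proof -
          have "sqrt (real k) / real k = 1 / sqrt (real k)" using k0 by (simp add: field_simps)
          moreover have "B * (12 * (\<eta>\<^sup>2 * sqrt (real k))) / (\<eta>\<^sup>2 * real k) = 12 * B * (sqrt (real k) / real k)"
            using \<eta> by simp
          ultimately show ?thesis unfolding x(2) by simp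
        qed
        moreover have "12 * B / sqrt (real k) = y * (12 * B / (y * sqrt (real k)))" using y by simp
        ultimately show ?thesis by (simp only: distrib_left add_divide_distrib)
      qed
      finally show ?thesis .
    qed
    moreover have "alive (lwalk r m) - (\<Sum>i<m. r i * alive (lwalk r i)) / x\<^sup>2 \<le> ?VL"
      unfolding c_def using x r_gt0 by (intro left_good_ge) auto
    ultimately have "\<theta> * y - y * (2 * B * \<eta>\<^sup>2 + 12 * B / (y * sqrt (real k))) \<le> ?VL" by linarith
    moreover have "\<theta> * y - y * (2 * B * \<eta>\<^sup>2 + 12 * B / (y * sqrt (real k))) = y * A1"
      unfolding A1(1) by (simp only: algebra_simps)
    ultimately show ?thesis by (simp only:)
  qed
  have VR: "e * A2 \<le> ?VR"
  proof -
    have Rm: "R \<le> real m"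
    proof -
      have "real m * (1 - \<theta> * e) \<le> real m * 1" using theta_bounds e_pos by (intro mult_left_mono) auto
      then show ?thesis using right_sum_le by (simp add: R_def)
    qed
    have R0: "0 \<le> R" unfolding R_def using rr_pos by (intro sum_nonneg) (auto intro: less_imp_le)
    have "R / x\<^sup>2 \<le> \<eta> ^ 4 * real k / x\<^sup>2" using Rm m_bounds by (intro divide_right_mono) auto
    also have "\<dots> = \<eta>\<^sup>2" unfolding x(2) using \<eta> k0 by (simp add: power4_eq_xxxx power2_eq_square)
    finally have Rx: "R / x\<^sup>2 \<le> \<eta>\<^sup>2" .
    have "\<eta>\<^sup>2 \<le> 1"
    proof (rule ccontr)
      assume "\<not> \<eta>\<^sup>2 \<le> 1"
      then have "1 < \<eta>\<^sup>2" by linarith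
      then have "1 < (\<eta>\<^sup>2)\<^sup>2" by (rule one_less_power) simp
      then have "16 * B * 1 < 16 * B * \<eta> ^ 4" using B1 by (intro mult_strict_left_mono) (auto simp: power_mult[symmetric])
      then show False using \<eta>(2) B1 by linarith
    qed
    then have "\<theta> * e * (1 - \<eta>\<^sup>2) \<le> (1 - R / m) * (1 - R / x\<^sup>2)"
      using Rx right_sum_le m_bounds(3) Rm theta_bounds e_pos
      by (intro mult_mono) (auto simp: R_def field_simps)
    moreover have "R / (x * m) \<le> 1 / x" using Rm x m_bounds(3) by (simp add: field_simps)
    moreover have "1 / x = e * (1 / (\<eta> * (e * sqrt (real k))))" using e_pos by (simp add: x_def)
    moreover have "(1 - R / m) * (1 - R / x\<^sup>2) - R / (x * m) \<le> ?VR"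
      using x Rm m_bounds(3) rr_pos rr_mono by (intro right_good_ge) (auto simp: R_def)
    moreover have "e * A2 = \<theta> * e * (1 - \<eta>\<^sup>2) - e * (1 / (\<eta> * (e * sqrt (real k))))"
      unfolding A2(1) by (simp only: algebra_simps)
    ultimately show ?thesis by linarith
  qed
  have T: "A3 \<le> exp (- 4 * x\<^sup>2 / \<mu>) - real k / X\<^sup>2 * sqrt (real k / real N)"
  proof -
    have "4 * x\<^sup>2 / \<mu> \<le> 4 * x\<^sup>2 / (real k * (1 - (B + 1) * \<eta> ^ 4 - 1 / k))"
    proof (rule divide_left_mono[OF \<mu>k])
      show "0 < \<mu> * (real k * (1 - (B + 1) * \<eta> ^ 4 - 1 / k))"
        using \<mu>k \<mu>0 by (intro mult_pos_pos[OF _ \<mu>0]) linarith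
    qed simp
    also have "\<dots> = 4 * \<eta>\<^sup>2 / (1 - (B + 1) * \<eta> ^ 4 - 1 / k)"
      unfolding x(2) using k0 by simp
    finally have "exp (- 4 * \<eta>\<^sup>2 / (1 - (B + 1) * \<eta> ^ 4 - 1 / k)) \<le> exp (- 4 * x\<^sup>2 / \<mu>)" by simp
    moreover have "real k / X\<^sup>2 * sqrt (real k / real N) \<le> 1 / D\<^sup>2 * sqrt (64 * B)"
    proof (rule mult_mono)
      show "real k / X\<^sup>2 \<le> 1 / D\<^sup>2" using k0 by (simp add: X_def power_mult_distrib)
    qed (use N_bounds(3) in auto)
    ultimately show ?thesis unfolding A3(1) D_def by linarith
  qed
  have "(y * A1) * (e * A2) * A3 \<le> ?VL * ?VR * (exp (- 4 * x\<^sup>2 / \<mu>) - real k / X\<^sup>2 * sqrt (real k / real N))"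
    by (rule mult_mono[OF mult_mono[OF VL VR] T])
      (use A1(2) A2(2) A3(2) y(1) e_pos in \<open>auto intro!: mult_nonneg_nonneg sum_nonneg\<close>)
  then show ?thesis using main by linarith
qed

end

section \<open>Asymptotics\<close>

lemma sum_single_crossing_mono:
  fixes v w f :: "nat \<Rightarrow> real"
  assumes fin: "finite A" and sums: "sum v A = sum w A"
    and cross: "\<And>i j. i \<in> A \<Longrightarrow> j \<in> A \<Longrightarrow> i < j \<Longrightarrow> v j \<le> w j \<Longrightarrow> v i \<le> w i"
    and anti: "\<And>i j. i \<in> A \<Longrightarrow> j \<in> A \<Longrightarrow> i \<le> j \<Longrightarrow> f j \<le> f i"
  shows "(\<Sum>i\<in>A. f i * v i) \<le> (\<Sum>i\<in>A. f i * w i)"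
proof (cases "\<exists>i\<in>A. v i \<le> w i")
  case False
  then have "A = {}" using sum_strict_mono[OF fin, of w v] sums by force
  then show ?thesis by simp
next
  case True
  \<comment> \<open>At the last index with v <= w, both w - v and f - f c change sign from
    nonnegative to nonpositive. Subtracting the constant \<open>f c\<close> is harmless because the
    sums agree.\<close>
  define c where "c = Max {i \<in> A. v i \<le> w i}"
  have c: "c \<in> A" "v c \<le> w c" using Max_in[of "{i \<in> A. v i \<le> w i}"] fin True by (auto simp: c_def)
  have "0 \<le> (w i - v i) * (f i - f c)" if i: "i \<in> A" for i
  proof (cases "i \<le> c")
    case True
    then have "v i \<le> w i" using c cross[of i c] i by (cases "i = c") auto
    then show ?thesis using anti[OF i c(1) True] by (intro mult_nonneg_nonneg) auto
  next
    case False
    then have "w i < v i" using Max_ge[of "{i \<in> A. v i \<le> w i}" i] fin i by (force simp: c_def)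
    then show ?thesis using anti[OF c(1) i] False by (intro mult_nonpos_nonpos) auto
  qed
  then have "0 \<le> (\<Sum>i\<in>A. (w i - v i) * (f i - f c))" by (intro sum_nonneg)
  also have "\<dots> = (\<Sum>i\<in>A. f i * w i) - (\<Sum>i\<in>A. f i * v i) - f c * (sum w A - sum v A)"
    by (simp add: algebra_simps sum.distrib sum_subtractf sum_distrib_left)
  finally show ?thesis using sums by simp
qed

text \<open>The ratio of the two geometric weights is monotone in the bin, so they cross only once.
  The bound 1 on \<open>f\<close> makes its values finite, so that real sums apply.\<close>

lemma tilted_bin_mono:
  fixes f :: "nat \<Rightarrow> ennreal"
  assumes p: "0 < p" "p \<le> p'" "p' < 1" and k: "1 \<le> k"
    and anti: "\<And>i j. i \<le> j \<Longrightarrow> f j \<le> f i" and le1: "\<And>i. f i \<le> 1"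
  shows "(\<integral>\<^sup>+i. f i \<partial>tilted_bin_pmf p k) \<le> (\<integral>\<^sup>+i. f i \<partial>tilted_bin_pmf p' k)"
proof -
  let ?v = "pmf (tilted_bin_pmf p k)" and ?w = "pmf (tilted_bin_pmf p' k)"
  have set: "set_pmf (tilted_bin_pmf p k) = {1..k}" "set_pmf (tilted_bin_pmf p' k) = {1..k}"
    using set_tilted_bin[of p k] set_tilted_bin[of p' k] p k by simp_all
  define g where "g = (\<lambda>i. enn2real (f i))"
  have fg: "f i = ennreal (g i)" for i
    using le1[of i] by (simp add: g_def ennreal_enn2real_if) (metis ennreal_one_neq_top top.extremum_uniqueI)
  have g: "i \<le> j \<Longrightarrow> g j \<le> g i" "0 \<le> g i" for i j
    using anti[of i j] le1[of i] unfolding g_def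
    by (auto intro!: enn2real_mono) (meson ennreal_one_less_top le_less_trans)
  have int: "(\<integral>\<^sup>+i. f i \<partial>measure_pmf M) = ennreal (\<Sum>i\<in>{1..k}. g i * pmf M i)" if "set_pmf M = {1..k}" for M
    using that g(2) by (subst nn_integral_measure_pmf_finite) (auto simp: fg ennreal_mult[symmetric] sum_ennreal)
  have "(\<Sum>i\<in>{1..k}. g i * ?v i) \<le> (\<Sum>i\<in>{1..k}. g i * ?w i)"
  proof (rule sum_single_crossing_mono)
    show "sum ?v {1..k} = sum ?w {1..k}"
      using sum_pmf_eq_1[of "{1..k}" "tilted_bin_pmf p k"] sum_pmf_eq_1[of "{1..k}" "tilted_bin_pmf p' k"] set by simp
    fix i j assume ij: "i \<in> {1..k}" "j \<in> {1..k}" "i < j" and le: "?v j \<le> ?w j"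
    define a where "a = p / (1 - (1 - p) ^ k)"
    define b where "b = p' / (1 - (1 - p') ^ k)"
    have ab: "0 < a" "0 < b"
      using one_diff_power_pos[of p k] one_diff_power_pos[of p' k] p k
      by (auto simp: a_def b_def power_less_one_iff)
    have v: "?v l = a * (1 - p) ^ (l - 1)" and w: "?w l = b * (1 - p') ^ (l - 1)" if "l \<in> {1..k}" for l
      using that p k by (auto simp: pmf_tilted_bin a_def b_def)
    have split: "x ^ (j - 1) = x ^ (i - 1) * x ^ (j - i)" for x :: real
      using ij by (simp add: power_add[symmetric])
    have "(a * (1 - p) ^ (i - 1)) * (1 - p) ^ (j - i) \<le> (b * (1 - p') ^ (i - 1)) * (1 - p') ^ (j - i)"
      using le v[OF ij(2)] w[OF ij(2)] split by simp
    also have "\<dots> \<le> (b * (1 - p') ^ (i - 1)) * (1 - p) ^ (j - i)"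
      using p ab by (intro mult_left_mono power_mono) auto
    finally have "a * (1 - p) ^ (i - 1) \<le> b * (1 - p') ^ (i - 1)"
      using p by (simp add: mult_le_cancel_right_pos)
    then show "?v i \<le> ?w i" using v[OF ij(1)] w[OF ij(1)] by simp
  qed (use g in auto)
  then show ?thesis unfolding int[OF set(1)] int[OF set(2)] by (rule ennreal_leI)
qed

text \<open>The coordinates are independent, so the laws are exchanged one at a time; the inner
  integral is again antitone and bounded by 1.\<close>

lemma Pi_pmf_antimono:
  fixes F :: "(nat \<Rightarrow> nat) \<Rightarrow> ennreal"
  assumes fin: "finite A"
    and dom: "\<And>f :: nat \<Rightarrow> ennreal. (\<And>i j. i \<le> j \<Longrightarrow> f j \<le> f i) \<Longrightarrow> (\<And>i. f i \<le> 1) \<Longrightarrow>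
      (\<integral>\<^sup>+i. f i \<partial>measure_pmf v) \<le> (\<integral>\<^sup>+i. f i \<partial>measure_pmf w)"
    and anti: "\<And>T T'. (\<And>j. T j \<le> T' j) \<Longrightarrow> F T' \<le> F T" and le1: "\<And>T. F T \<le> 1"
  shows "(\<integral>\<^sup>+T. F T \<partial>Pi_pmf A d (\<lambda>_. v)) \<le> (\<integral>\<^sup>+T. F T \<partial>Pi_pmf A d (\<lambda>_. w))"
  using fin anti le1
proof (induction A arbitrary: F rule: finite_induct)
  case (insert x A)
  have "(\<integral>\<^sup>+T. F T \<partial>Pi_pmf (insert x A) d (\<lambda>_. v)) =
      (\<integral>\<^sup>+y. \<integral>\<^sup>+T. F (T(x := y)) \<partial>Pi_pmf A d (\<lambda>_. v) \<partial>measure_pmf v)"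
    using insert.hyps by (subst Pi_pmf_insert') auto
  also have "\<dots> \<le> (\<integral>\<^sup>+y. \<integral>\<^sup>+T. F (T(x := y)) \<partial>Pi_pmf A d (\<lambda>_. w) \<partial>measure_pmf v)"
    by (intro nn_integral_mono insert.IH insert.prems) auto
  also have "\<dots> \<le> (\<integral>\<^sup>+y. \<integral>\<^sup>+T. F (T(x := y)) \<partial>Pi_pmf A d (\<lambda>_. w) \<partial>measure_pmf w)"
  proof (rule dom)
    show "(\<integral>\<^sup>+T. F (T(x := j)) \<partial>Pi_pmf A d (\<lambda>_. w)) \<le> (\<integral>\<^sup>+T. F (T(x := i)) \<partial>Pi_pmf A d (\<lambda>_. w))"
      if "i \<le> j" for i j using that by (intro nn_integral_mono insert.prems) auto
    show "(\<integral>\<^sup>+T. F (T(x := i)) \<partial>Pi_pmf A d (\<lambda>_. w)) \<le> 1" for i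
    proof -
      have "(\<integral>\<^sup>+T. F (T(x := i)) \<partial>Pi_pmf A d (\<lambda>_. w)) \<le> (\<integral>\<^sup>+T. 1 \<partial>Pi_pmf A d (\<lambda>_. w))"
        by (intro nn_integral_mono insert.prems)
      then show ?thesis by simp
    qed
  qed
  also have "\<dots> = (\<integral>\<^sup>+T. F T \<partial>Pi_pmf (insert x A) d (\<lambda>_. w))"
    using insert.hyps by (subst Pi_pmf_insert') auto
  finally show ?case .
qed simp

lemma prob_TREE_mono:
  assumes p: "0 < p" "p \<le> p'" "p' < 1" and k: "1 \<le> k"
  shows "measure_pmf.prob (placement_pmf p k) (TREE k) \<le> measure_pmf.prob (placement_pmf p' k) (TREE k)"
proof -
  \<comment> \<open>\<open>TREE\<close> does not count balls at the default value 0, so it need not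
    be closed under lowering values. \<open>S\<close> counts them, is closed in this sense, and
    agrees with \<open>TREE\<close> on the support.\<close>
  define S where "S = {T. \<forall>u\<in>{1..k - 1}. u \<le> card {j. j < k - 1 \<and> T j \<le> u}}"
  have S: "measure_pmf.prob (placement_pmf x k) (TREE k) = measure_pmf.prob (placement_pmf x k) S"
    if "0 < x" "x < 1" for x
  proof -
    have "TREE k \<inter> set_pmf (placement_pmf x k) = S \<inter> set_pmf (placement_pmf x k)"
    proof -
      have "T \<in> TREE k \<longleftrightarrow> T \<in> S" if "T \<in> set_pmf (placement_pmf x k)" for T
      proof -
        have "leftwalk (bin_count k T) u = 1 + int (card {j. j < k - 1 \<and> T j \<le> u}) - int u" for u
          using that set_placement[OF \<open>0 < x\<close> \<open>x < 1\<close> k]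
          by (intro leftwalk_bin_count) (auto simp: PiE_dflt_def)
        then show ?thesis by (auto simp: TREE_def S_def)
      qed
      then show ?thesis by auto
    qed
    then show ?thesis by (metis measure_Int_set_pmf)
  qed
  have "(\<integral>\<^sup>+T. indicator S T \<partial>placement_pmf p k) \<le> (\<integral>\<^sup>+T. indicator S T \<partial>placement_pmf p' k)"
    unfolding placement_pmf_def
  proof (rule Pi_pmf_antimono)
    fix T T' :: "nat \<Rightarrow> nat" assume le: "\<And>j. T j \<le> T' j"
    have "T \<in> S" if T': "T' \<in> S"
      unfolding S_def
    proof (intro CollectI ballI)
      fix u assume "u \<in> {1..k - 1}"
      then have "u \<le> card {j. j < k - 1 \<and> T' j \<le> u}" using T' by (simp add: S_def)
      also have "\<dots> \<le> card {j. j < k - 1 \<and> T j \<le> u}"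
        using le by (intro card_mono) (auto intro: order_trans)
      finally show "u \<le> card {j. j < k - 1 \<and> T j \<le> u}" .
    qed
    then show "indicator S T' \<le> (indicator S T :: ennreal)" by (auto split: split_indicator)
  next
    show "indicator S T \<le> (1 :: ennreal)" for T by (auto split: split_indicator)
  qed (use tilted_bin_mono[OF p k] in auto)
  then have "measure_pmf.prob (placement_pmf p k) S \<le> measure_pmf.prob (placement_pmf p' k) S"
    by (simp add: measure_pmf.emeasure_eq_measure)
  then show ?thesis using S p by simp
qed

section \<open>Bounded tilt\<close>

lemma measure_ESC_properties:
  assumes "1 < l"
  defines "y \<equiv> measure (poisson_steps l) (ESC l)"
  shows "0 < y" "y < 1" "1 - y = exp (- l * y)" "2 * (l - 1) / l\<^sup>2 \<le> y"
proof -
  obtain z where z: "0 < z" "z < 1" "1 - z = exp (- l * z)" "2 * (l - 1) / l\<^sup>2 \<le> z"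
    using survival_exists[OF assms(1)] .
  have "y = z" unfolding y_def by (rule measure_ESC[OF z(1-3)]) (use assms in simp)
  then show "0 < y" "y < 1" "1 - y = exp (- l * y)" "2 * (l - 1) / l\<^sup>2 \<le> y" using z by auto
qed

lemma const_divide_mult_at_top_tendsto_0:
  fixes f :: "nat \<Rightarrow> real"
  assumes "filterlim f at_top sequentially" "0 < b"
  shows "(\<lambda>k. a / (b * f k)) \<longlonglongrightarrow> 0"
  by (intro tendsto_divide_0[OF tendsto_const] filterlim_at_top_imp_at_infinity
      filterlim_tendsto_pos_mult_at_top[OF tendsto_const assms(2,1)])

abbreviation (input) tree_prob :: "real \<Rightarrow> nat \<Rightarrow> real" where
  "tree_prob p k \<equiv> measure_pmf.prob (placement_pmf p k) (TREE k)"

abbreviation (input) esc_prob :: "real \<Rightarrow> nat \<Rightarrow> real" where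
  "esc_prob p k \<equiv> measure (poisson_steps (rate_left p k)) (ESC (rate_left p k))"

abbreviation (input) esc_prob_right :: "real \<Rightarrow> nat \<Rightarrow> real" where
  "esc_prob_right p k \<equiv> measure (poisson_steps (rate_right p k)) (ESC\<^sub>R (rate_right p k))"

text \<open>For fixed \<eta> the finite bounds converge in k to explicit functions of \<eta>. These
  tend to 1 as \<eta> decreases to 0, so a suitable \<eta> exists for every tolerance.\<close>

lemma TREE_asymptotic_bounded:
  fixes p :: "nat \<Rightarrow> real"
  assumes lim: "filterlim (\<lambda>k. p k * real k powr (3/2)) at_top sequentially"
    and bd: "\<forall>\<^sub>F k in sequentially. p k * real k \<le> C\<^sub>0"
  shows "(\<lambda>k. tree_prob (p k) k / (esc_prob (p k) k * esc_prob_right (p k) k)) \<longlonglongrightarrow> 1"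
proof -
  define B where "B = 2 + \<bar>C\<^sub>0\<bar>"
  have B: "2 \<le> B" by (simp add: B_def)
  define C where "C = (\<lambda>k. p k * real k * sqrt (real k))"
  define T where "T = (\<lambda>k. tree_prob (p k) k)"
  define y where "y = (\<lambda>k. esc_prob (p k) k)"
  define e where "e = (\<lambda>k. esc_prob_right (p k) k)"
  define Y where "Y = (\<lambda>k. y k * sqrt (real k))"
  define E where "E = (\<lambda>k. e k * sqrt (real k))"
  have C_eq: "p k * real k powr (3/2) = C k" if "0 < k" for k
  proof -
    have "real k powr (1 + 1/2) = real k powr 1 * real k powr (1/2)" by (rule powr_add)
    then show ?thesis using that by (simp add: C_def powr_half_sqrt)
  qed
  have C_lim: "filterlim C at_top sequentially"
    using lim by (rule filterlim_mono_eventually[OF _ order_refl order_refl])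
      (auto simp: C_eq intro!: eventually_mono[OF eventually_gt_at_top[of 0]])
  have C_ge: "\<forall>\<^sub>F k in sequentially. c < C k" for c
    using C_lim by (simp add: filterlim_at_top_dense)
  have k_ge: "\<forall>\<^sub>F k in sequentially. c \<le> real k" for c
    using filterlim_real_sequentially by (simp add: filterlim_at_top)
  have sqrt_ge: "\<forall>\<^sub>F k in sequentially. c \<le> sqrt (real k)" for c
    using filterlim_compose[OF sqrt_at_top filterlim_real_sequentially] by (simp add: filterlim_at_top)
  have basic: "\<forall>\<^sub>F k in sequentially. 0 < p k \<and> p k < 1 \<and> 1 + p k * real k \<le> B \<and> 64 * B \<le> real k \<and> 7 \<le> C k"
    using C_ge[of 7] k_ge[of "64 * B"] bd
  proof eventually_elim
    case (elim k)
    have k0: "0 < real k" using elim B by linarith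
    have "0 < p k"
    proof (rule ccontr)
      assume "\<not> 0 < p k"
      then have "C k \<le> 0" by (simp add: C_def mult_nonpos_nonneg)
      then show False using elim by simp
    qed
    moreover have "p k < 1"
    proof (rule ccontr)
      assume "\<not> p k < 1"
      then have "1 * real k \<le> p k * real k" by (intro mult_right_mono) auto
      then show False using elim by (simp add: B_def)
    qed
    ultimately show ?case using elim by (simp add: B_def)
  qed
  have ye: "\<forall>\<^sub>F k in sequentially. 0 < y k \<and> y k < 1 \<and> 1 - y k = exp (- rate_left (p k) k * y k) \<and>
      e k = 1 - rate_right (p k) k \<and> 1 / (2 * B\<^sup>2) * C k \<le> Y k \<and> 1 / (4 * B) * C k \<le> E k \<and> 0 < e k"
    using basic
  proof eventually_elim
    case (elim k)
    have k64: "64 \<le> real k" using elim B by linarith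
    then have k2: "2 \<le> k" by simp
    have p: "0 < p k" "p k < 1" using elim by auto
    define c where "c = p k * real k"
    define t where "t = (real k - 1) * p k / 2"
    have c: "0 < c" "1 + c \<le> B" using elim k64 by (auto simp: c_def)
    let ?l = "rate_left (p k) k"
    have l: "c / 4 \<le> ?l - 1" using rate_left_minus_1_ge[OF p k64] elim by (simp add: c_def C_def)
    have lB: "?l \<le> B" using rate_left_upper[OF p k2] c by (simp add: c_def)
    have l1: "1 < ?l" using l c by simp
    have t: "c / 4 \<le> t" using k64 p by (simp add: c_def t_def field_simps)
    have rR: "rate_right (p k) k \<le> 1 / (1 + t)" unfolding t_def by (rule rate_right_upper[OF p k2])
    also have "\<dots> \<le> 1" using t c by simp
    finally have e: "e k = 1 - rate_right (p k) k"
      unfolding e_def by (intro measure_ESC_R rate_right_pos[OF p k2])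
    have "c / (4 * B) \<le> (c / 4) / (1 + c / 4)" using c by (simp add: frac_le)
    also have "\<dots> \<le> t / (1 + t)" using t c by (simp add: divide_simps) (simp add: algebra_simps)
    also have "\<dots> = 1 - 1 / (1 + t)" using t c by (simp add: field_simps)
    also have "\<dots> \<le> e k" using rR e by simp
    finally have ec: "c / (4 * B) \<le> e k" .
    then have "c / (4 * B) * sqrt (real k) \<le> E k" unfolding E_def by (intro mult_right_mono) auto
    moreover have "c / (4 * B) * sqrt (real k) = 1 / (4 * B) * C k" by (simp add: C_def c_def)
    moreover have "c / (2 * B\<^sup>2) \<le> y k"
    proof -
      have "c / (2 * B\<^sup>2) = 2 * (c / 4) / B\<^sup>2" by simp
      also have "\<dots> \<le> 2 * (?l - 1) / B\<^sup>2" using l by (intro divide_right_mono) auto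
      also have "\<dots> \<le> 2 * (?l - 1) / ?l\<^sup>2"
        using l1 lB by (intro divide_left_mono power_mono) auto
      also have "\<dots> \<le> y k" unfolding y_def by (rule measure_ESC_properties(4)[OF l1])
      finally show ?thesis .
    qed
    then have "c / (2 * B\<^sup>2) * sqrt (real k) \<le> Y k" unfolding Y_def by (intro mult_right_mono) auto
    moreover have "c / (2 * B\<^sup>2) * sqrt (real k) = 1 / (2 * B\<^sup>2) * C k" by (simp add: C_def c_def)
    moreover have "0 < e k" using ec c B by (smt (verit) divide_pos_pos)
    ultimately show ?case
      using measure_ESC_properties(1-3)[OF l1] e B by (auto simp: y_def)
  qed
  have Y_lim: "filterlim Y at_top sequentially"
    by (rule filterlim_at_top_mono[OF filterlim_tendsto_pos_mult_at_top[OF tendsto_const _ C_lim, of "1 / (2 * B\<^sup>2)"]])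
      (use B eventually_mono[OF ye] in auto)
  have E_lim: "filterlim E at_top sequentially"
    by (rule filterlim_at_top_mono[OF filterlim_tendsto_pos_mult_at_top[OF tendsto_const _ C_lim, of "1 / (4 * B)"]])
      (use B eventually_mono[OF ye] in auto)
  have win: "\<forall>\<^sub>F k in sequentially. window (p k) k B \<eta> (nat \<lfloor>\<eta> ^ 4 * real k\<rfloor>) (y k) (e k)"
    if \<eta>: "0 < \<eta>" "16 * B * \<eta> ^ 4 \<le> 1" for \<eta>
    using basic ye k_ge[of "2 / \<eta> ^ 4"] sqrt_ge[of "4 * \<eta>"]
  proof eventually_elim
    case (elim k)
    have "2 \<le> \<eta> ^ 4 * real k" using elim \<eta> by (simp add: field_simps)
    then show ?case using elim \<eta> by (unfold_locales) (auto simp: C_def)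
  qed
  \<comment> \<open>\<open>U\<close> is the limit in k of the upper bound; \<open>a1\<close>,
    \<open>a2\<close>, \<open>a3\<close> are the limits of the three factors of the lower
    bound.\<close>
  define U where "U = (\<lambda>\<eta>::real. sqrt (1 / (1 - (B + 1) * \<eta> ^ 4)) * (1 + \<eta>))"
  define a1 where "a1 = (\<lambda>\<eta>::real. 1 - 4 * B * \<eta> ^ 4 - 2 * B * \<eta>\<^sup>2)"
  define a2 where "a2 = (\<lambda>\<eta>::real. (1 - 4 * B * \<eta> ^ 4) * (1 - \<eta>\<^sup>2))"
  define a3 where "a3 = (\<lambda>\<eta>::real. exp (- 4 * \<eta>\<^sup>2 / (1 - (B + 1) * \<eta> ^ 4)))"
  have id: "((\<lambda>\<eta>. \<eta>) \<longlongrightarrow> 0) (at_right (0::real))" by (simp add: filterlim_at)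
  have U_lim: "(U \<longlongrightarrow> 1) (at_right 0)"
    unfolding U_def by (rule tendsto_eq_intros id refl | simp)+
  have a1_lim: "(a1 \<longlongrightarrow> 1) (at_right 0)"
    unfolding a1_def by (rule tendsto_eq_intros id refl | simp)+
  have a2_lim: "(a2 \<longlongrightarrow> 1) (at_right 0)"
    unfolding a2_def by (rule tendsto_eq_intros id refl | simp)+
  have a3_lim: "(a3 \<longlongrightarrow> 1) (at_right 0)"
    unfolding a3_def by (rule tendsto_eq_intros id refl | simp)+
  have prod_lim: "((\<lambda>\<eta>. a1 \<eta> * a2 \<eta> * a3 \<eta>) \<longlongrightarrow> 1) (at_right 0)"
    using tendsto_mult[OF tendsto_mult[OF a1_lim a2_lim] a3_lim] by simp
  have small: "\<forall>\<^sub>F \<eta> in at_right 0. 16 * B * \<eta> ^ 4 < 1"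
  proof -
    have "((\<lambda>\<eta>. 16 * B * \<eta> ^ 4) \<longlongrightarrow> 0) (at_right 0)" by (rule tendsto_eq_intros id refl | simp)+
    then show ?thesis by (rule order_tendstoD) simp
  qed
  have inv0: "(\<lambda>k. c / real k) \<longlonglongrightarrow> 0" for c by (rule lim_const_over_n)
  show ?thesis
  proof (rule order_tendstoI)
    fix a :: real assume a: "1 < a"
    have "\<forall>\<^sub>F \<eta> in at_right 0. 0 < \<eta> \<and> 16 * B * \<eta> ^ 4 < 1 \<and> U \<eta> < a"
      using eventually_at_right_less[of "0::real"] small order_tendstoD(2)[OF U_lim a] by eventually_elim auto
    then obtain \<eta> :: real where \<eta>: "0 < \<eta>" "16 * B * \<eta> ^ 4 < 1" "U \<eta> < a"
      using eventually_happens[of _ "at_right (0::real)"] by (auto simp: trivial_limit_at_right_real)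
    have small\<eta>: "(B + 1) * \<eta> ^ 4 < 1"
    proof -
      have "(B + 1) * \<eta> ^ 4 \<le> 16 * B * \<eta> ^ 4" using B by (intro mult_right_mono) auto
      then show ?thesis using \<eta> by linarith
    qed
    define h where "h = (\<lambda>k. exp (- (\<eta> ^ 4 / 4 * (\<eta> * Y k)\<^sup>2)))"
    define W where "W = (\<lambda>k. sqrt (1 / (1 - (B + 1) * \<eta> ^ 4 - 2 / real k)) * (1 + \<eta>) * (1 + 1 / (sqrt (\<eta> ^ 4 / 2) * E k)) / (1 - h k))"
    have "filterlim (\<lambda>k. \<eta> ^ 4 / 4 * (\<eta> * Y k)\<^sup>2) at_top sequentially"
      using \<eta> by (intro filterlim_tendsto_pos_mult_at_top[OF tendsto_const] filterlim_pow_at_top Y_lim) auto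
    then have h_lim: "h \<longlonglongrightarrow> 0"
      unfolding h_def by (rule filterlim_compose[OF exp_at_bot filterlim_compose[OF filterlim_uminus_at_bot_at_top]])
    have E0: "(\<lambda>k. 1 / (sqrt (\<eta> ^ 4 / 2) * E k)) \<longlonglongrightarrow> 0"
      using \<eta> by (intro const_divide_mult_at_top_tendsto_0 E_lim) auto
    have "W \<longlonglongrightarrow> sqrt (1 / (1 - (B + 1) * \<eta> ^ 4 - 0)) * (1 + \<eta>) * (1 + 0) / (1 - 0)"
      unfolding W_def by (intro tendsto_intros h_lim E0 inv0) (use small\<eta> in auto)
    then have W_lim: "W \<longlonglongrightarrow> U \<eta>" by (simp add: U_def)
    have "(\<lambda>k. 1 - (B + 1) * \<eta> ^ 4 - 2 / real k) \<longlonglongrightarrow> 1 - (B + 1) * \<eta> ^ 4 - 0"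
      by (intro tendsto_intros inv0)
    then have t_pos: "\<forall>\<^sub>F k in sequentially. 0 < 1 - (B + 1) * \<eta> ^ 4 - 2 / real k"
      by (rule order_tendstoD) (use small\<eta> in simp)
    have "\<forall>\<^sub>F k in sequentially. h k < 1" using h_lim by (rule order_tendstoD) simp
    then show "\<forall>\<^sub>F k in sequentially. tree_prob (p k) k / (esc_prob (p k) k * esc_prob_right (p k) k) < a"
      using win[OF \<eta>(1) less_imp_le[OF \<eta>(2)]] ye t_pos order_tendstoD(2)[OF W_lim \<eta>(3)]
    proof eventually_elim
      case (elim k)
      interpret window "p k" k B \<eta> "nat \<lfloor>\<eta> ^ 4 * real k\<rfloor>" "y k" "e k" by (rule elim)
      have "T k * (1 - h k) \<le> sqrt (1 / (1 - (B + 1) * \<eta> ^ 4 - 2 / k)) * (y k * (1 + \<eta>)) * (e k * (1 + 1 / (sqrt (\<eta> ^ 4 / 2) * E k)))"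
        unfolding T_def h_def Y_def E_def by (rule upper_bound) (use elim \<eta> in auto)
      also have "\<dots> = W k * (1 - h k) * (y k * e k)" using elim by (simp add: W_def)
      finally have "T k * (1 - h k) \<le> W k * (y k * e k) * (1 - h k)" by (simp only: mult_ac)
      then have "T k \<le> W k * (y k * e k)" using elim by (simp add: mult_le_cancel_right_pos)
      then have "T k / (y k * e k) \<le> W k" using elim by (simp add: pos_divide_le_eq)
      then show ?case using elim by (simp add: T_def y_def e_def)
    qed
  next
    fix a :: real assume a: "a < 1"
    have "\<forall>\<^sub>F \<eta> in at_right 0. 0 < \<eta> \<and> 16 * B * \<eta> ^ 4 < 1 \<and> a < a1 \<eta> * a2 \<eta> * a3 \<eta> \<and> 0 < a1 \<eta> \<and> 0 < a2 \<eta>"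
      using eventually_at_right_less[of "0::real"] small order_tendstoD(1)[OF prod_lim a]
        order_tendstoD(1)[OF a1_lim zero_less_one] order_tendstoD(1)[OF a2_lim zero_less_one]
      by eventually_elim auto
    then obtain \<eta> :: real where \<eta>: "0 < \<eta>" "16 * B * \<eta> ^ 4 < 1" "a < a1 \<eta> * a2 \<eta> * a3 \<eta>" "0 < a1 \<eta>" "0 < a2 \<eta>"
      using eventually_happens[of _ "at_right (0::real)"] by (auto simp: trivial_limit_at_right_real)
    have small\<eta>: "(B + 1) * \<eta> ^ 4 < 1"
    proof -
      have "(B + 1) * \<eta> ^ 4 \<le> 16 * B * \<eta> ^ 4" using B by (intro mult_right_mono) auto
      then show ?thesis using \<eta> by linarith
    qed
    define A1 where "A1 = (\<lambda>k. 1 - 4 * B * \<eta> ^ 4 - 2 * B * \<eta>\<^sup>2 - 12 * B / (1 * Y k))"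
    define A2 where "A2 = (\<lambda>k. (1 - 4 * B * \<eta> ^ 4) * (1 - \<eta>\<^sup>2) - 1 / (\<eta> * E k))"
    define D where "D = (\<lambda>k. \<eta> ^ 4 * C k / (16 * B) - \<eta>)"
    define A3 where "A3 = (\<lambda>k. exp (- 4 * \<eta>\<^sup>2 / (1 - (B + 1) * \<eta> ^ 4 - 1 / real k)) - 1 / (D k)\<^sup>2 * sqrt (64 * B))"
    have "A1 \<longlonglongrightarrow> 1 - 4 * B * \<eta> ^ 4 - 2 * B * \<eta>\<^sup>2 - 0"
      unfolding A1_def by (intro tendsto_intros const_divide_mult_at_top_tendsto_0 Y_lim) auto
    then have A1_lim: "A1 \<longlonglongrightarrow> a1 \<eta>" by (simp add: a1_def)
    have "A2 \<longlonglongrightarrow> (1 - 4 * B * \<eta> ^ 4) * (1 - \<eta>\<^sup>2) - 0"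
      unfolding A2_def using \<eta> by (intro tendsto_intros const_divide_mult_at_top_tendsto_0 E_lim) auto
    then have A2_lim: "A2 \<longlonglongrightarrow> a2 \<eta>" by (simp add: a2_def)
    have "filterlim (\<lambda>k. - \<eta> + \<eta> ^ 4 / (16 * B) * C k) at_top sequentially"
      using \<eta> B by (intro filterlim_tendsto_add_at_top[OF tendsto_const] filterlim_tendsto_pos_mult_at_top[OF tendsto_const] C_lim) auto
    then have D_lim: "filterlim D at_top sequentially" by (simp add: D_def)
    have "(\<lambda>k. 1 / (1 * (D k)\<^sup>2)) \<longlonglongrightarrow> 0"
      by (intro const_divide_mult_at_top_tendsto_0 filterlim_pow_at_top D_lim) auto
    then have D0: "(\<lambda>k. 1 / (D k)\<^sup>2) \<longlonglongrightarrow> 0" by simp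
    have "A3 \<longlonglongrightarrow> exp (- 4 * \<eta>\<^sup>2 / (1 - (B + 1) * \<eta> ^ 4 - 0)) - 0 * sqrt (64 * B)"
      unfolding A3_def by (intro tendsto_intros inv0 D0) (use small\<eta> in auto)
    then have A3_lim: "A3 \<longlonglongrightarrow> a3 \<eta>" by (simp add: a3_def)
    have a3: "0 < a3 \<eta>" by (simp add: a3_def)
    have "(\<lambda>k. 1 - (B + 1) * \<eta> ^ 4 - 1 / real k) \<longlonglongrightarrow> 1 - (B + 1) * \<eta> ^ 4 - 0"
      by (intro tendsto_intros inv0)
    then have t_pos: "\<forall>\<^sub>F k in sequentially. 0 < 1 - (B + 1) * \<eta> ^ 4 - 1 / real k"
      by (rule order_tendstoD) (use small\<eta> in simp)
    have D_pos: "\<forall>\<^sub>F k in sequentially. 0 < D k" using D_lim by (simp add: filterlim_at_top_dense)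
    have "(\<lambda>k. A1 k * A2 k * A3 k) \<longlonglongrightarrow> a1 \<eta> * a2 \<eta> * a3 \<eta>"
      by (intro tendsto_mult A1_lim A2_lim A3_lim)
    then have "\<forall>\<^sub>F k in sequentially. a < A1 k * A2 k * A3 k" by (rule order_tendstoD) (rule \<eta>)
    then show "\<forall>\<^sub>F k in sequentially. a < tree_prob (p k) k / (esc_prob (p k) k * esc_prob_right (p k) k)"
      using win[OF \<eta>(1) less_imp_le[OF \<eta>(2)]] ye t_pos D_pos order_tendstoD(1)[OF A1_lim \<eta>(4)]
        order_tendstoD(1)[OF A2_lim \<eta>(5)] order_tendstoD(1)[OF A3_lim a3]
    proof eventually_elim
      case (elim k)
      interpret window "p k" k B \<eta> "nat \<lfloor>\<eta> ^ 4 * real k\<rfloor>" "y k" "e k" by (rule elim)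
      have "(y k * A1 k) * (e k * A2 k) * A3 k \<le> T k"
        unfolding T_def
        by (rule lower_bound) (use elim in \<open>auto simp: A1_def A2_def A3_def D_def C_def Y_def E_def \<theta>_def\<close>)
      then have "A1 k * A2 k * A3 k * (y k * e k) \<le> T k" by (simp only: mult_ac)
      then have "A1 k * A2 k * A3 k \<le> T k / (y k * e k)" using elim by (simp add: pos_le_divide_eq)
      then show ?case using elim by (simp add: T_def y_def e_def)
    qed
  qed
qed

text \<open>The left rate is at least C/8, so l (1 - y) <= 1 gives 1 - y <= 8/C; the right rate is
  at most 4/C.\<close>

lemma escape_product_large:
  assumes p: "0 < p" "p < 1" and k: "2 \<le> k" and C: "12 \<le> C" "C \<le> p * real k"
  shows "1 - 12 / C \<le> esc_prob p k * esc_prob_right p k"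
proof -
  define t where "t = (real k - 1) * p / 2"
  let ?l = "rate_left p k"
  have t: "C / 4 \<le> t"
  proof -
    have "1 * p \<le> real k / 2 * p" using k p by (intro mult_right_mono) auto
    then show ?thesis using C by (simp add: t_def algebra_simps)
  qed
  have "(1 / 2) * (1 + t) \<le> (1 - 1 / k) * (1 + t)"
    using k t C by (intro mult_right_mono) (auto simp: field_simps)
  also have "\<dots> \<le> ?l" unfolding t_def by (rule rate_left_lower[OF p k])
  finally have l: "C / 8 \<le> ?l" using t by simp
  then have l1: "1 < ?l" using C by simp
  define y where "y = esc_prob p k"
  have y: "0 < y" "y < 1" "1 - y = exp (- ?l * y)"
    unfolding y_def by (rule measure_ESC_properties[OF l1])+
  have "(1 - y) * (C / 8) \<le> (1 - y) * ?l" using l y(2) by (intro mult_left_mono) auto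
  also have "\<dots> \<le> 1" using survival_ge[OF y] by (simp only: mult.commute)
  finally have "1 - 8 / C \<le> y" using C by (simp add: field_simps)
  moreover have "rate_right p k \<le> 4 / C"
  proof -
    have "rate_right p k \<le> 1 / (1 + t)" unfolding t_def by (rule rate_right_upper[OF p k])
    also have "\<dots> \<le> 1 / (C / 4)" using t C by (intro divide_left_mono) auto
    finally show ?thesis by simp
  qed
  moreover have "4 / C \<le> 1" using C by simp
  ultimately have "1 - 8 / C \<le> y" "1 - 4 / C \<le> esc_prob_right p k"
    using rate_right_pos[OF p k] by (auto simp: measure_ESC_R)
  then have "(1 - 8 / C) * (1 - 4 / C) \<le> y * esc_prob_right p k"
    using C y(1) by (intro mult_mono) auto
  moreover have "(1 - 8 / C) * (1 - 4 / C) = 1 - 12 / C + 32 / C\<^sup>2"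
    using C by (simp add: field_simps power2_eq_square)
  moreover have "0 \<le> 32 / C\<^sup>2" by simp
  ultimately show ?thesis unfolding y_def by linarith
qed

section \<open>The full range of tilts\<close>

lemma measure_poisson_steps_le_1: "measure (poisson_steps l) X \<le> 1"
  using prob_space.prob_le_1[OF prob_space_poisson_steps] .

theorem theorem2:
  fixes p :: "nat \<Rightarrow> real"
  assumes "filterlim (\<lambda>k. p k * real k powr (3/2)) at_top sequentially"
    and "\<forall>\<^sub>F k in sequentially. p k \<le> 10 * (ln (real k) / real k)"
  shows "(\<lambda>k. measure_pmf.prob (placement_pmf (p k) k) (TREE k))
    \<sim>[sequentially]
    (\<lambda>k. measure (poisson_steps (rate_left (p k) k)) (ESC (rate_left (p k) k)) *
          measure (poisson_steps (rate_right (p k) k)) (ESC\<^sub>R (rate_right (p k) k)))"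
proof -
  have p_pos: "\<forall>\<^sub>F k in sequentially. 0 < p k"
  proof -
    have "\<forall>\<^sub>F k in sequentially. 0 < p k * real k powr (3/2)"
      using assms(1) by (simp add: filterlim_at_top_dense)
    then show ?thesis by eventually_elim (auto simp: zero_less_mult_iff)
  qed
  have p_lt: "\<forall>\<^sub>F k in sequentially. p k < 1"
  proof -
    have "(\<lambda>k. 10 * (ln (real k) / real k)) \<longlonglongrightarrow> 10 * 0"
      by (intro tendsto_mult tendsto_const lim_ln_over_n)
    then have "\<forall>\<^sub>F k in sequentially. 10 * (ln (real k) / real k) < 1" by (rule order_tendstoD) simp
    then show ?thesis using assms(2) by eventually_elim simp
  qed
  \<comment> \<open>\<open>s\<close> measures the loss for large tilts, \<open>b\<close> and
    \<open>b'\<close> the tolerance for bounded ones; the interval contains the ratio in both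
    cases.\<close>
  have key: "\<forall>\<^sub>F k in sequentially. tree_prob (p k) k / (esc_prob (p k) k * esc_prob_right (p k) k) \<in> {b * s<..max b' (1 / s)}"
    if s: "0 < s" "s < 1" and b: "0 < b" "b < 1" "1 < b'" for s b b'
  proof -
    \<comment> \<open>Makes 1 - 12/C equal to s, so the escape product is at least s for tilts of at
      least C/k.\<close>
    define C where "C = 12 / (1 - s)"
    have C: "12 \<le> C" "1 - 12 / C = s" using s by (auto simp: C_def field_simps)
    \<comment> \<open>Capping the tilt gives one sequence with bounded tilt, so no passage to
      subsequences is needed: it equals \<open>p k\<close> where that is at most C/k, and is the
      comparison tilt elsewhere.\<close>
    define p' where "p' = (\<lambda>k. min (p k) (C / real k))"
    have sq: "C / real k * real k powr (3/2) = C * sqrt (real k)" if "0 < k" for k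
    proof -
      have "real k powr (1 + 1/2) = real k powr 1 * real k powr (1/2)" by (rule powr_add)
      then show ?thesis using that by (simp add: powr_half_sqrt)
    qed
    have lim': "filterlim (\<lambda>k. p' k * real k powr (3/2)) at_top sequentially"
      unfolding filterlim_at_top
    proof
      fix Z :: real
      have "filterlim (\<lambda>k. C * sqrt (real k)) at_top sequentially"
        using C by (intro filterlim_tendsto_pos_mult_at_top[OF tendsto_const] filterlim_compose[OF sqrt_at_top filterlim_real_sequentially]) auto
      then have "\<forall>\<^sub>F k in sequentially. Z \<le> C * sqrt (real k)" by (simp add: filterlim_at_top)
      moreover have "\<forall>\<^sub>F k in sequentially. Z \<le> p k * real k powr (3/2)"
        using assms(1) by (simp add: filterlim_at_top)
      ultimately show "\<forall>\<^sub>F k in sequentially. Z \<le> p' k * real k powr (3/2)"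
        using eventually_gt_at_top[of 0]
      proof eventually_elim
        case (elim k)
        then show ?case using sq[of k] by (cases "p k \<le> C / real k") (simp_all only: p'_def min_def if_True if_False)
      qed
    qed
    have "\<forall>\<^sub>F k in sequentially. p' k * real k \<le> C"
      using eventually_gt_at_top[of 0]
      by eventually_elim (auto simp: p'_def min_def field_simps)
    from TREE_asymptotic_bounded[OF lim' this]
    have R: "(\<lambda>k. tree_prob (p' k) k / (esc_prob (p' k) k * esc_prob_right (p' k) k)) \<longlonglongrightarrow> 1" .
    show ?thesis
      using p_pos p_lt order_tendstoD(1)[OF R b(2)] order_tendstoD(2)[OF R b(3)] eventually_ge_at_top[of 2]
    proof eventually_elim
      case (elim k)
      define T where "T = tree_prob (p k) k"
      define g where "g = esc_prob (p k) k * esc_prob_right (p k) k"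
      show ?case unfolding T_def[symmetric] g_def[symmetric]
      proof (cases "p k \<le> C / real k")
        case True
        then have "p' k = p k" by (simp add: p'_def)
        then have "b < T / g" "T / g < b'" using elim by (auto simp: T_def g_def)
        moreover have "b * s < b" using b s by simp
        ultimately show "T / g \<in> {b * s<..max b' (1 / s)}" by auto
      next
        case False
        then have p'k: "p' k = C / real k" "C / real k < p k" by (auto simp: p'_def)
        have k0: "0 < real k" using elim by simp
        have Cp: "0 < C / real k" "C / real k < 1"
          using p'k(2) elim(2) C k0 by (simp, linarith)
        have g: "s \<le> g"
          unfolding g_def C(2)[symmetric] using elim C p'k k0
          by (intro escape_product_large) (auto simp: field_simps)
        have g1: "g \<le> 1"
          unfolding g_def by (intro mult_le_one measure_poisson_steps_le_1) auto
        define g' where "g' = esc_prob (p' k) k * esc_prob_right (p' k) k"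
        have g': "s \<le> g'"
          unfolding g'_def p'k C(2)[symmetric] using elim C Cp k0
          by (intro escape_product_large) auto
        have "b * s \<le> b * g'" using g' b by (intro mult_left_mono) auto
        also have "\<dots> < tree_prob (p' k) k"
          using elim(3) g' s unfolding g'_def[symmetric] by (simp add: pos_less_divide_eq)
        also have "\<dots> \<le> T"
          unfolding T_def p'k using Cp p'k elim by (intro prob_TREE_mono) auto
        also have "\<dots> \<le> T / g"
          using g g1 s by (simp add: T_def pos_le_divide_eq mult_left_le)
        finally have lower: "b * s < T / g" .
        have "T / g \<le> 1 / g" using g s by (intro divide_right_mono) (auto simp: T_def)
        also have "\<dots> \<le> 1 / s" using g s by (intro divide_left_mono) auto
        finally have upper: "T / g \<le> 1 / s" .
        show "T / g \<in> {b * s<..max b' (1 / s)}" using lower upper by auto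
      qed
    qed
  qed
  show ?thesis
  proof (rule asymp_equivI', rule order_tendstoI)
    fix a :: real assume a: "1 < a"
    \<comment> \<open>The midpoint of 1/a and 1, hence 1/s < a.\<close>
    define s where "s = (1 + 1 / a) / 2"
    have s: "0 < s" "s < 1" "1 / s < a" using a by (auto simp: s_def field_simps)
    show "\<forall>\<^sub>F k in sequentially. tree_prob (p k) k / (esc_prob (p k) k * esc_prob_right (p k) k) < a"
    proof -
      have "max ((1 + a) / 2) (1 / s) < a" using a s by auto
      then show ?thesis using key[OF s(1,2), of "1 / 2" "(1 + a) / 2"] a
        by (auto elim!: eventually_mono intro: le_less_trans)
    qed
  next
    fix a :: real assume a: "a < 1"
    \<comment> \<open>The midpoint of max a 0 and 1; its square is at least max a 0, so
      \<open>s\<close> can serve as \<open>b\<close> too.\<close>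
    define s where "s = (1 + max a 0) / 2"
    have s: "0 < s" "s < 1" "a \<le> s * s"
    proof -
      have "0 \<le> (1 - max a 0)\<^sup>2" by simp
      then have "max a 0 \<le> s * s" by (simp add: s_def power2_eq_square field_simps)
      then show "a \<le> s * s" by simp
    qed (use a in \<open>auto simp: s_def\<close>)
    show "\<forall>\<^sub>F k in sequentially. a < tree_prob (p k) k / (esc_prob (p k) k * esc_prob_right (p k) k)"
      using key[OF s(1,2) s(1,2), of 2] s by (auto elim!: eventually_mono)
  qed
qed

end
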